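(* Let $\Lambda$ be an algebra and let $S$ be a simple $\Lambda$-module whose first syzygy $\Omega^1 S$ is non-zero and semisimple. (1) Suppose that $S$ is not a direct summand of $\Omega^1 S$. Let $S_1$ be a simple submodule of $\Omega^1 S$ and let $m$ be the maximal integer such that $S_1^m$ is a direct summand of $\Omega^1 S$. Then there is an exact sequence $$0\to \Omega^1 S/S_1^m\to P_0(S)\to M\to 0$$ with $M$ indecomposable and $\tau$-rigid. (2) Suppose that $S$ is a direct summand of $\Omega^1 S$. Let $n$ be the maximal integer such that $S^n$ is a direct summand of $\Omega^1 S$. (a) If $\Omega^1 S\simeq S^n$, then there is no non-projective indecomposable $\tau$-rigid module $N$ with projective cover $P_0(N)\simeq P_0(S)$. (b) If $\Omega^1 S\not\simeq S^n$, then there is an exact sequence $$0\to \Omega^1 S/S^n\to P_0(S)\to N\to 0$$ such that $N$ is indecomposable, non-projective and $\tau$-rigid.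
   Context: All algebras are basic connected non-semisimple Artin algebras over a commutative Artin ring, and all modules are finitely generated left modules ($\Lambda$ is not assumed to be radical square zero here). $\tau$ denotes the Auslander-Reiten translation. A $\Lambda$-module $M$ is $\tau$-rigid if $\mathrm{Hom}_\Lambda(M,\tau M)=0$. $P_0(X)$ denotes the projective cover of a module $X$, and $\Omega^1 X$ denotes the first syzygy, i.e. the kernel of the projective cover $P_0(X)\to X$. $X^m$ denotes the direct sum of $m$ copies of $X$. *)

theory Defs
  imports "HOL-Algebra.Chinese_Remainder" "HOL-Algebra.Module" "HOL-Library.FuncSet"
begin

section \<open>Left modules over a not necessarily commutative ring\<close>

text \<open>The locale \<^locale>\<open>module\<close> of the library requires a commutative ring of scalars. The axioms
  below are the same, over an arbitrary ring. The record \<^typ>\<open>('a, 'b) module\<close> and the locale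
  \<^locale>\<open>submodule\<close> are reused; the fields \<^const>\<open>mult\<close> and \<^const>\<open>one\<close> of the record carry no
  meaning for a module. Right modules are left modules over the opposite ring.\<close>

locale left_module = R?: ring R + M?: abelian_group M
  for R :: "'a ring" (structure) and M :: "('a, 'b) module" (structure) +
  assumes smult_closed [simp, intro]:
      "\<lbrakk>a \<in> carrier R; x \<in> carrier M\<rbrakk> \<Longrightarrow> a \<odot>\<^bsub>M\<^esub> x \<in> carrier M"
    and smult_l_distr:
      "\<lbrakk>a \<in> carrier R; b \<in> carrier R; x \<in> carrier M\<rbrakk> \<Longrightarrow>
        (a \<oplus> b) \<odot>\<^bsub>M\<^esub> x = a \<odot>\<^bsub>M\<^esub> x \<oplus>\<^bsub>M\<^esub> b \<odot>\<^bsub>M\<^esub> x"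
    and smult_r_distr:
      "\<lbrakk>a \<in> carrier R; x \<in> carrier M; y \<in> carrier M\<rbrakk> \<Longrightarrow>
        a \<odot>\<^bsub>M\<^esub> (x \<oplus>\<^bsub>M\<^esub> y) = a \<odot>\<^bsub>M\<^esub> x \<oplus>\<^bsub>M\<^esub> a \<odot>\<^bsub>M\<^esub> y"
    and smult_assoc1:
      "\<lbrakk>a \<in> carrier R; b \<in> carrier R; x \<in> carrier M\<rbrakk> \<Longrightarrow>
        (a \<otimes> b) \<odot>\<^bsub>M\<^esub> x = a \<odot>\<^bsub>M\<^esub> (b \<odot>\<^bsub>M\<^esub> x)"
    and smult_one [simp]: "x \<in> carrier M \<Longrightarrow> \<one> \<odot>\<^bsub>M\<^esub> x = x"

definition op_ring :: "'a ring \<Rightarrow> 'a ring" where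
  "op_ring \<Lambda> = \<Lambda>\<lparr>mult := \<lambda>a b. b \<otimes>\<^bsub>\<Lambda>\<^esub> a\<rparr>"

definition regular :: "'a ring \<Rightarrow> ('a, 'a) module" where
  "regular \<Lambda> = \<lparr>carrier = carrier \<Lambda>, mult = mult \<Lambda>, one = one \<Lambda>, zero = zero \<Lambda>, add = add \<Lambda>,
                smult = mult \<Lambda>\<rparr>"

lemma op_ring_ring: assumes "ring \<Lambda>" shows "ring (op_ring \<Lambda>)"
proof -
  interpret ring \<Lambda> by fact
  have "abelian_group (op_ring \<Lambda>)"
  proof (rule abelian_groupI)
    fix x assume "x \<in> carrier (op_ring \<Lambda>)"
    then show "\<exists>y\<in>carrier (op_ring \<Lambda>). y \<oplus>\<^bsub>op_ring \<Lambda>\<^esub> x = \<zero>\<^bsub>op_ring \<Lambda>\<^esub>"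
      by (intro bexI[of _ "\<ominus>\<^bsub>\<Lambda>\<^esub> x"]) (auto simp: op_ring_def l_neg)
  qed (auto simp: op_ring_def a_ac)
  moreover have "monoid (op_ring \<Lambda>)"
    by (rule monoidI) (auto simp: op_ring_def m_assoc)
  ultimately show ?thesis
    by (rule ringI) (auto simp: op_ring_def l_distr r_distr)
qed

lemma regular_left_module: assumes "ring \<Lambda>" shows "left_module \<Lambda> (regular \<Lambda>)"
proof -
  interpret ring \<Lambda> by fact
  have ag: "abelian_group (regular \<Lambda>)"
  proof (rule abelian_groupI)
    fix x assume "x \<in> carrier (regular \<Lambda>)"
    then show "\<exists>y\<in>carrier (regular \<Lambda>). y \<oplus>\<^bsub>regular \<Lambda>\<^esub> x = \<zero>\<^bsub>regular \<Lambda>\<^esub>"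
      by (intro bexI[of _ "\<ominus>\<^bsub>\<Lambda>\<^esub> x"]) (auto simp: regular_def l_neg)
  qed (auto simp: regular_def a_ac)
  show ?thesis
    by (intro left_module.intro assms ag left_module_axioms.intro)
       (auto simp: regular_def m_assoc l_distr r_distr)
qed

definition restrict_scalars :: "('r \<Rightarrow> 'a) \<Rightarrow> ('a, 'b) module \<Rightarrow> ('r, 'b) module" where
  "restrict_scalars \<phi> M = \<lparr>carrier = carrier M, mult = mult M, one = one M, zero = zero M,
                           add = add M, smult = \<lambda>r x. \<phi> r \<odot>\<^bsub>M\<^esub> x\<rparr>"

abbreviation restr :: "('a, 'b) module \<Rightarrow> 'b set \<Rightarrow> ('a, 'b) module" where
  "restr M H \<equiv> M\<lparr>carrier := H\<rparr>"

definition quot_mod :: "('a, 'b) module \<Rightarrow> 'b set \<Rightarrow> ('a, 'b set) module" where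
  "quot_mod M H = \<lparr>carrier = a_rcosets\<^bsub>M\<^esub> H, mult = undefined, one = undefined, zero = H,
                   add = set_add M, smult = \<lambda>a X. \<Union>x\<in>X. H +>\<^bsub>M\<^esub> (a \<odot>\<^bsub>M\<^esub> x)\<rparr>"

definition mod_power :: "('a, 'b) module \<Rightarrow> nat \<Rightarrow> ('a, nat \<Rightarrow> 'b) module" where
  "mod_power M m = \<lparr>carrier = {..<m} \<rightarrow>\<^sub>E carrier M, mult = undefined, one = undefined,
                    zero = (\<lambda>i\<in>{..<m}. \<zero>\<^bsub>M\<^esub>),
                    add = (\<lambda>f g. \<lambda>i\<in>{..<m}. f i \<oplus>\<^bsub>M\<^esub> g i),
                    smult = (\<lambda>a f. \<lambda>i\<in>{..<m}. a \<odot>\<^bsub>M\<^esub> f i)\<rparr>"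

definition fin_gen :: "'a ring \<Rightarrow> ('a, 'b) module \<Rightarrow> bool" where
  "fin_gen \<Lambda> M \<longleftrightarrow>
     (\<exists>A. finite A \<and> A \<subseteq> carrier M \<and> (\<forall>H. submodule H \<Lambda> M \<and> A \<subseteq> H \<longrightarrow> H = carrier M))"

definition fg_left_module :: "'a ring \<Rightarrow> ('a, 'b) module \<Rightarrow> bool" where
  "fg_left_module \<Lambda> M \<longleftrightarrow> left_module \<Lambda> M \<and> fin_gen \<Lambda> M"

definition lmod_hom :: "'a ring \<Rightarrow> ('a, 'b) module \<Rightarrow> ('a, 'c) module \<Rightarrow> ('b \<Rightarrow> 'c) set" where
  "lmod_hom \<Lambda> M N = {f \<in> carrier M \<rightarrow> carrier N.
     (\<forall>x\<in>carrier M. \<forall>y\<in>carrier M. f (x \<oplus>\<^bsub>M\<^esub> y) = f x \<oplus>\<^bsub>N\<^esub> f y) \<and>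
     (\<forall>a\<in>carrier \<Lambda>. \<forall>x\<in>carrier M. f (a \<odot>\<^bsub>M\<^esub> x) = a \<odot>\<^bsub>N\<^esub> f x)}"

definition lmod_iso :: "'a ring \<Rightarrow> ('a, 'b) module \<Rightarrow> ('a, 'c) module \<Rightarrow> bool" where
  "lmod_iso \<Lambda> M N \<longleftrightarrow> (\<exists>f\<in>lmod_hom \<Lambda> M N. bij_betw f (carrier M) (carrier N))"

definition short_exact ::
  "'a ring \<Rightarrow> ('a, 'b) module \<Rightarrow> ('b \<Rightarrow> 'c) \<Rightarrow> ('a, 'c) module \<Rightarrow> ('c \<Rightarrow> 'd) \<Rightarrow> ('a, 'd) module \<Rightarrow> bool"
  where
  "short_exact \<Lambda> A f B g C \<longleftrightarrow>
     f \<in> lmod_hom \<Lambda> A B \<and> g \<in> lmod_hom \<Lambda> B C \<and> inj_on f (carrier A) \<and>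
     f ` carrier A = a_kernel B C g \<and> g ` carrier B = carrier C"

section \<open>Direct sums, simple, semisimple and indecomposable modules\<close>

definition complementary :: "'a ring \<Rightarrow> ('a, 'b) module \<Rightarrow> 'b set \<Rightarrow> 'b set \<Rightarrow> bool" where
  "complementary \<Lambda> M A B \<longleftrightarrow> submodule A \<Lambda> M \<and> submodule B \<Lambda> M \<and>
     A \<inter> B = {\<zero>\<^bsub>M\<^esub>} \<and> A <+>\<^bsub>M\<^esub> B = carrier M"

definition direct_summand :: "'a ring \<Rightarrow> ('a, 'c) module \<Rightarrow> ('a, 'b) module \<Rightarrow> bool" where
  "direct_summand \<Lambda> X M \<longleftrightarrow> (\<exists>A B. complementary \<Lambda> M A B \<and> lmod_iso \<Lambda> X (restr M A))"

definition max_power_summand :: "'a ring \<Rightarrow> ('a, 'c) module \<Rightarrow> ('a, 'b) module \<Rightarrow> nat \<Rightarrow> bool" where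
  "max_power_summand \<Lambda> X M m \<longleftrightarrow> direct_summand \<Lambda> (mod_power X m) M \<and>
     (\<forall>k. direct_summand \<Lambda> (mod_power X k) M \<longrightarrow> k \<le> m)"

definition internal_direct_sum ::
  "'a ring \<Rightarrow> ('a, 'b) module \<Rightarrow> nat \<Rightarrow> (nat \<Rightarrow> 'b set) \<Rightarrow> bool" where
  "internal_direct_sum \<Lambda> M n N \<longleftrightarrow> (\<forall>i<n. submodule (N i) \<Lambda> M) \<and>
     (\<forall>x\<in>carrier M. \<exists>!f. f \<in> (\<Pi>\<^sub>E i\<in>{..<n}. N i) \<and> x = (\<Oplus>\<^bsub>M\<^esub>i\<in>{..<n}. f i))"

definition simple_module :: "'a ring \<Rightarrow> ('a, 'b) module \<Rightarrow> bool" where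
  "simple_module \<Lambda> M \<longleftrightarrow> left_module \<Lambda> M \<and> carrier M \<noteq> {\<zero>\<^bsub>M\<^esub>} \<and>
     (\<forall>H. submodule H \<Lambda> M \<longrightarrow> H = {\<zero>\<^bsub>M\<^esub>} \<or> H = carrier M)"

definition semisimple_module :: "'a ring \<Rightarrow> ('a, 'b) module \<Rightarrow> bool" where
  "semisimple_module \<Lambda> M \<longleftrightarrow> left_module \<Lambda> M \<and>
     (\<exists>n N. internal_direct_sum \<Lambda> M n N \<and> (\<forall>i<n. simple_module \<Lambda> (restr M (N i))))"

definition indecomposable :: "'a ring \<Rightarrow> ('a, 'b) module \<Rightarrow> bool" where
  "indecomposable \<Lambda> M \<longleftrightarrow> left_module \<Lambda> M \<and> carrier M \<noteq> {\<zero>\<^bsub>M\<^esub>} \<and>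
     (\<forall>A B. complementary \<Lambda> M A B \<longrightarrow> A = {\<zero>\<^bsub>M\<^esub>} \<or> B = {\<zero>\<^bsub>M\<^esub>})"

section \<open>Artin algebras\<close>

definition artinian_cring :: "'r ring \<Rightarrow> bool" where
  "artinian_cring R \<longleftrightarrow> cring R \<and>
     (\<forall>I :: nat \<Rightarrow> 'r set. (\<forall>n. ideal (I n) R \<and> I (Suc n) \<subseteq> I n) \<longrightarrow> (\<exists>n. \<forall>m\<ge>n. I m = I n))"

definition artin_algebra :: "'r ring \<Rightarrow> ('r \<Rightarrow> 'a) \<Rightarrow> 'a ring \<Rightarrow> bool" where
  "artin_algebra R \<phi> \<Lambda> \<longleftrightarrow> artinian_cring R \<and> ring \<Lambda> \<and> \<phi> \<in> ring_hom R \<Lambda> \<and>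
     (\<forall>r\<in>carrier R. \<forall>a\<in>carrier \<Lambda>. \<phi> r \<otimes>\<^bsub>\<Lambda>\<^esub> a = a \<otimes>\<^bsub>\<Lambda>\<^esub> \<phi> r) \<and>
     fin_gen R (restrict_scalars \<phi> (regular \<Lambda>))"

definition basic_algebra :: "'a ring \<Rightarrow> bool" where
  "basic_algebra \<Lambda> \<longleftrightarrow> (\<exists>n N. internal_direct_sum \<Lambda> (regular \<Lambda>) n N \<and>
     (\<forall>i<n. indecomposable \<Lambda> (restr (regular \<Lambda>) (N i))) \<and>
     (\<forall>i<n. \<forall>j<n. i \<noteq> j \<longrightarrow>
        \<not> lmod_iso \<Lambda> (restr (regular \<Lambda>) (N i)) (restr (regular \<Lambda>) (N j))))"

text \<open>The factors of a product decomposition are isomorphic to corner rings of \<open>\<Lambda>\<close> at central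
  idempotents, so it is enough to consider factors whose elements have the type of those of \<open>\<Lambda>\<close>.\<close>

definition connected_algebra :: "'a ring \<Rightarrow> bool" where
  "connected_algebra \<Lambda> \<longleftrightarrow> carrier \<Lambda> \<noteq> {\<zero>\<^bsub>\<Lambda>\<^esub>} \<and>
     (\<forall>(A :: 'a ring) (B :: 'a ring). ring A \<and> ring B \<and> is_ring_iso \<Lambda> (RDirProd A B) \<longrightarrow>
        carrier A = {\<zero>\<^bsub>A\<^esub>} \<or> carrier B = {\<zero>\<^bsub>B\<^esub>})"

section \<open>Projective covers and injective envelopes\<close>

text \<open>A quantifier over all modules has to fix the type of their elements. Every finitely generated
  \<open>\<Lambda>\<close>-module is isomorphic to a quotient of some power of \<open>\<Lambda>\<close>, whose elements are sets of functions
  \<^typ>\<open>nat \<Rightarrow> 'a\<close>. Test objects of this type detect projectivity of finitely generated modules (split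
  an epimorphism from a free module of finite rank), and by Baer's criterion they detect injectivity
  of arbitrary modules.\<close>

type_synonym 'a univ = "(nat \<Rightarrow> 'a) set"

definition projective_module :: "'a ring \<Rightarrow> ('a, 'b) module \<Rightarrow> bool" where
  "projective_module \<Lambda> P \<longleftrightarrow> left_module \<Lambda> P \<and>
     (\<forall>(B :: ('a, 'a univ) module) (C :: ('a, 'a univ) module). \<forall>g h.
        left_module \<Lambda> B \<and> left_module \<Lambda> C \<and>
        g \<in> lmod_hom \<Lambda> B C \<and> g ` carrier B = carrier C \<and> h \<in> lmod_hom \<Lambda> P C \<longrightarrow>
        (\<exists>k\<in>lmod_hom \<Lambda> P B. \<forall>x\<in>carrier P. g (k x) = h x))"

definition injective_module :: "'a ring \<Rightarrow> ('a, 'b) module \<Rightarrow> bool" where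
  "injective_module \<Lambda> E \<longleftrightarrow> left_module \<Lambda> E \<and>
     (\<forall>(A :: ('a, 'a univ) module) (B :: ('a, 'a univ) module). \<forall>g h.
        left_module \<Lambda> A \<and> left_module \<Lambda> B \<and>
        g \<in> lmod_hom \<Lambda> A B \<and> inj_on g (carrier A) \<and> h \<in> lmod_hom \<Lambda> A E \<longrightarrow>
        (\<exists>k\<in>lmod_hom \<Lambda> B E. \<forall>x\<in>carrier A. k (g x) = h x))"

text \<open>An epimorphism is essential if no proper submodule of its source is mapped onto its target.\<close>

definition projective_cover ::
  "'a ring \<Rightarrow> ('a, 'b) module \<Rightarrow> ('b \<Rightarrow> 'c) \<Rightarrow> ('a, 'c) module \<Rightarrow> bool" where
  "projective_cover \<Lambda> P p X \<longleftrightarrow>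
     fg_left_module \<Lambda> P \<and> projective_module \<Lambda> P \<and> left_module \<Lambda> X \<and>
     p \<in> lmod_hom \<Lambda> P X \<and> p ` carrier P = carrier X \<and>
     (\<forall>H. submodule H \<Lambda> P \<and> p ` H = carrier X \<longrightarrow> H = carrier P)"

definition injective_envelope :: "'a ring \<Rightarrow> ('a, 'b) module \<Rightarrow> ('a, 'c) module \<Rightarrow> bool" where
  "injective_envelope \<Lambda> X E \<longleftrightarrow> left_module \<Lambda> X \<and> injective_module \<Lambda> E \<and>
     (\<exists>i\<in>lmod_hom \<Lambda> X E. inj_on i (carrier X) \<and>
        (\<forall>H. submodule H \<Lambda> E \<and> H \<inter> i ` carrier X = {\<zero>\<^bsub>E\<^esub>} \<longrightarrow> H = {\<zero>\<^bsub>E\<^esub>}))"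

text \<open>The first syzygy, for a projective cover \<open>p\<close> from \<open>P\<close> to \<open>X\<close>.\<close>

definition syzygy :: "('a, 'b) module \<Rightarrow> ('b \<Rightarrow> 'c) \<Rightarrow> ('a, 'c) module \<Rightarrow> ('a, 'b) module" where
  "syzygy P p X = restr P (a_kernel P X p)"

section \<open>The Auslander-Reiten translation\<close>

text \<open>\<open>\<tau> M = D (Tr M)\<close>, where \<open>Tr M\<close> is the cokernel of the map from \<open>Hom(P0, \<Lambda>)\<close> to \<open>Hom(P1, \<Lambda>)\<close>
  obtained from a minimal projective presentation of \<open>M\<close>, and \<open>D\<close> is the duality \<open>Hom(-, J)\<close> over
  \<open>R\<close>, where \<open>J\<close> is an injective envelope of \<open>R / rad R\<close>. Elements of the modules of homomorphisms
  are extensional functions, so that equal homomorphisms are equal as functions.\<close>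

definition rad_cring :: "'r ring \<Rightarrow> 'r set" where
  "rad_cring R = carrier R \<inter> \<Inter>{I. maximalideal I R}"

definition dualizing_module :: "'r ring \<Rightarrow> ('r, 'j) module \<Rightarrow> bool" where
  "dualizing_module R J \<longleftrightarrow> injective_envelope R (quot_mod (regular R) (rad_cring R)) J"

text \<open>\<open>Hom(P, \<Lambda>)\<close>, a module over the opposite ring.\<close>

definition regular_dual :: "'a ring \<Rightarrow> ('a, 'b) module \<Rightarrow> ('a, 'b \<Rightarrow> 'a) module" where
  "regular_dual \<Lambda> P =
     \<lparr>carrier = lmod_hom \<Lambda> P (regular \<Lambda>) \<inter> extensional (carrier P),
      mult = undefined, one = undefined, zero = (\<lambda>x\<in>carrier P. \<zero>\<^bsub>\<Lambda>\<^esub>),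
      add = (\<lambda>f g. \<lambda>x\<in>carrier P. f x \<oplus>\<^bsub>\<Lambda>\<^esub> g x),
      smult = (\<lambda>a f. \<lambda>x\<in>carrier P. f x \<otimes>\<^bsub>\<Lambda>\<^esub> a)\<rparr>"

lemma regular_dual_left_module:
  assumes "left_module \<Lambda> P" shows "left_module (op_ring \<Lambda>) (regular_dual \<Lambda> P)"
proof -
  interpret P: left_module \<Lambda> P by fact
  have m: "\<ominus>\<^bsub>\<Lambda>\<^esub> (x \<oplus>\<^bsub>\<Lambda>\<^esub> y) = \<ominus>\<^bsub>\<Lambda>\<^esub> x \<oplus>\<^bsub>\<Lambda>\<^esub> \<ominus>\<^bsub>\<Lambda>\<^esub> y"
    if "x \<in> carrier \<Lambda>" "y \<in> carrier \<Lambda>" for x y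
    using that by (rule P.R.minus_add)
  note defs = regular_dual_def lmod_hom_def regular_def op_ring_def
  have ag: "abelian_group (regular_dual \<Lambda> P)"
  proof (rule abelian_groupI)
    fix x assume x: "x \<in> carrier (regular_dual \<Lambda> P)"
    let ?y = "\<lambda>p\<in>carrier P. \<ominus>\<^bsub>\<Lambda>\<^esub> x p"
    show "\<exists>y\<in>carrier (regular_dual \<Lambda> P). y \<oplus>\<^bsub>regular_dual \<Lambda> P\<^esub> x = \<zero>\<^bsub>regular_dual \<Lambda> P\<^esub>"
      using x by (intro bexI[of _ ?y])
        (auto simp: defs P.R.l_neg m P.R.r_minus Pi_iff fun_eq_iff)
  qed (auto simp: defs P.R.a_ac P.R.r_distr Pi_iff fun_eq_iff extensional_def)
  show ?thesis
    apply (intro left_module.intro ag op_ring_ring P.R.ring_axioms left_module_axioms.intro)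
    by (auto simp: defs P.R.l_distr P.R.r_distr P.R.m_assoc Pi_iff fun_eq_iff extensional_def)
qed

definition transpose_of ::
  "'a ring \<Rightarrow> ('a, 'b) module \<Rightarrow> ('b \<Rightarrow> 'c) \<Rightarrow> ('a, 'c) module \<Rightarrow> ('a, ('b \<Rightarrow> 'a) set) module" where
  "transpose_of \<Lambda> P1 d P0 =
     quot_mod (regular_dual \<Lambda> P1) ((\<lambda>f. compose (carrier P1) f d) ` carrier (regular_dual \<Lambda> P0))"

text \<open>The dual of a module over the opposite ring of \<open>\<Lambda>\<close> is a \<open>\<Lambda>\<close>-module.\<close>

definition artin_dual ::
  "'r ring \<Rightarrow> ('r \<Rightarrow> 'a) \<Rightarrow> ('r, 'j) module \<Rightarrow> ('a, 'b) module \<Rightarrow> ('a, 'b \<Rightarrow> 'j) module" where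
  "artin_dual R \<phi> J X =
     \<lparr>carrier = lmod_hom R (restrict_scalars \<phi> X) J \<inter> extensional (carrier X),
      mult = undefined, one = undefined, zero = (\<lambda>x\<in>carrier X. \<zero>\<^bsub>J\<^esub>),
      add = (\<lambda>f g. \<lambda>x\<in>carrier X. f x \<oplus>\<^bsub>J\<^esub> g x),
      smult = (\<lambda>a f. \<lambda>x\<in>carrier X. f (a \<odot>\<^bsub>X\<^esub> x))\<rparr>"

lemma artin_dual_left_module:
  assumes "artin_algebra R \<phi> \<Lambda>" "left_module R J" "left_module (op_ring \<Lambda>) X"
  shows "left_module \<Lambda> (artin_dual R \<phi> J X)"
proof -
  interpret J: left_module R J by fact
  interpret X: left_module "op_ring \<Lambda>" X by fact
  interpret L: ring \<Lambda> using assms(1) by (simp add: artin_algebra_def)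
  have phi: "\<And>r. r \<in> carrier R \<Longrightarrow> \<phi> r \<in> carrier \<Lambda>"
    "\<And>r a. r \<in> carrier R \<Longrightarrow> a \<in> carrier \<Lambda> \<Longrightarrow> \<phi> r \<otimes>\<^bsub>\<Lambda>\<^esub> a = a \<otimes>\<^bsub>\<Lambda>\<^esub> \<phi> r"
    using assms(1) by (auto simp: artin_algebra_def ring_hom_def)
  have sc: "\<And>a x. a \<in> carrier \<Lambda> \<Longrightarrow> x \<in> carrier X \<Longrightarrow> a \<odot>\<^bsub>X\<^esub> x \<in> carrier X"
    "\<And>a b x. a \<in> carrier \<Lambda> \<Longrightarrow> b \<in> carrier \<Lambda> \<Longrightarrow> x \<in> carrier X \<Longrightarrow> (b \<otimes>\<^bsub>\<Lambda>\<^esub> a) \<odot>\<^bsub>X\<^esub> x = a \<odot>\<^bsub>X\<^esub> (b \<odot>\<^bsub>X\<^esub> x)"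
    "\<And>a b x. a \<in> carrier \<Lambda> \<Longrightarrow> b \<in> carrier \<Lambda> \<Longrightarrow> x \<in> carrier X \<Longrightarrow> (b \<oplus>\<^bsub>\<Lambda>\<^esub> a) \<odot>\<^bsub>X\<^esub> x = b \<odot>\<^bsub>X\<^esub> x \<oplus>\<^bsub>X\<^esub> (a \<odot>\<^bsub>X\<^esub> x)"
    "\<And>a x y. a \<in> carrier \<Lambda> \<Longrightarrow> y \<in> carrier X \<Longrightarrow> x \<in> carrier X \<Longrightarrow> a \<odot>\<^bsub>X\<^esub> (x \<oplus>\<^bsub>X\<^esub> y) = a \<odot>\<^bsub>X\<^esub> x \<oplus>\<^bsub>X\<^esub> (a \<odot>\<^bsub>X\<^esub> y)"
    "\<And>x. x \<in> carrier X \<Longrightarrow> \<one>\<^bsub>\<Lambda>\<^esub> \<odot>\<^bsub>X\<^esub> x = x"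
    using X.smult_closed X.smult_assoc1 X.smult_l_distr X.smult_r_distr X.smult_one by (auto simp: op_ring_def)
  note defs = artin_dual_def lmod_hom_def restrict_scalars_def
  have comm: "a \<odot>\<^bsub>X\<^esub> (\<phi> r \<odot>\<^bsub>X\<^esub> x) = \<phi> r \<odot>\<^bsub>X\<^esub> (a \<odot>\<^bsub>X\<^esub> x)"
    if "r \<in> carrier R" "a \<in> carrier \<Lambda>" "x \<in> carrier X" for r a x
  proof -
    have "a \<odot>\<^bsub>X\<^esub> (\<phi> r \<odot>\<^bsub>X\<^esub> x) = (\<phi> r \<otimes>\<^bsub>\<Lambda>\<^esub> a) \<odot>\<^bsub>X\<^esub> x"
      by (rule sc(2)[OF that(2) phi(1)[OF that(1)] that(3), symmetric])
    also have "\<phi> r \<otimes>\<^bsub>\<Lambda>\<^esub> a = a \<otimes>\<^bsub>\<Lambda>\<^esub> \<phi> r"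
      by (rule phi(2)[OF that(1,2)])
    also have "(a \<otimes>\<^bsub>\<Lambda>\<^esub> \<phi> r) \<odot>\<^bsub>X\<^esub> x = \<phi> r \<odot>\<^bsub>X\<^esub> (a \<odot>\<^bsub>X\<^esub> x)"
      by (rule sc(2)[OF phi(1)[OF that(1)] that(2,3)])
    finally show ?thesis .
  qed
  have z: "r \<odot>\<^bsub>J\<^esub> \<zero>\<^bsub>J\<^esub> = \<zero>\<^bsub>J\<^esub>" if "r \<in> carrier R" for r
    using that J.smult_r_distr[of r "\<zero>\<^bsub>J\<^esub>" "\<zero>\<^bsub>J\<^esub>"] by (metis J.M.add.r_cancel_one' J.M.l_zero J.M.zero_closed J.smult_closed)
  have m: "r \<odot>\<^bsub>J\<^esub> (\<ominus>\<^bsub>J\<^esub> x) = \<ominus>\<^bsub>J\<^esub> (r \<odot>\<^bsub>J\<^esub> x)" if "r \<in> carrier R" "x \<in> carrier J" for r x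
    using that J.smult_r_distr[of r "\<ominus>\<^bsub>J\<^esub> x" x] z by (metis J.M.a_inv_closed J.M.l_neg J.M.minus_equality J.smult_closed)
  have ag: "abelian_group (artin_dual R \<phi> J X)"
  proof (rule abelian_groupI)
    fix x assume x: "x \<in> carrier (artin_dual R \<phi> J X)"
    let ?y = "\<lambda>p\<in>carrier X. \<ominus>\<^bsub>J\<^esub> x p"
    show "\<exists>y\<in>carrier (artin_dual R \<phi> J X). y \<oplus>\<^bsub>artin_dual R \<phi> J X\<^esub> x = \<zero>\<^bsub>artin_dual R \<phi> J X\<^esub>"
      using x by (intro bexI[of _ ?y])
        (auto simp: defs J.M.l_neg J.M.minus_add m Pi_iff fun_eq_iff phi(1) sc)
  qed (auto simp: defs J.M.a_ac z J.smult_r_distr Pi_iff fun_eq_iff extensional_def phi(1) sc)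
  show ?thesis
    apply (intro left_module.intro ag L.ring_axioms left_module_axioms.intro)
    by (auto simp: defs Pi_iff fun_eq_iff extensional_def sc phi(1) comm)
qed

definition minimal_presentation ::
  "'a ring \<Rightarrow> ('a, 'b) module \<Rightarrow> ('b \<Rightarrow> 'c) \<Rightarrow> ('a, 'c) module \<Rightarrow> ('c \<Rightarrow> 'd) \<Rightarrow> ('a, 'd) module \<Rightarrow> bool"
  where
  "minimal_presentation \<Lambda> P1 d P0 e M \<longleftrightarrow>
     projective_cover \<Lambda> P0 e M \<and> projective_cover \<Lambda> P1 d (syzygy P0 e M)"

text \<open>Minimal projective presentations of a finitely generated module over an Artin algebra exist
  and are unique up to isomorphism; an arbitrary one is chosen.\<close>

definition ar_translate ::
  "'r ring \<Rightarrow> ('r \<Rightarrow> 'a) \<Rightarrow> 'a ring \<Rightarrow> ('r, 'j) module \<Rightarrow> ('a, 'b) module \<Rightarrow>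
     ('a, ('a univ \<Rightarrow> 'a) set \<Rightarrow> 'j) module" where
  "ar_translate R \<phi> \<Lambda> J M =
     (let (P1, d, P0, e) =
        (SOME (P1 :: ('a, 'a univ) module, d, P0 :: ('a, 'a univ) module, e).
           minimal_presentation \<Lambda> P1 d P0 e M)
      in artin_dual R \<phi> J (transpose_of \<Lambda> P1 d P0))"

definition tau_rigid ::
  "'r ring \<Rightarrow> ('r \<Rightarrow> 'a) \<Rightarrow> 'a ring \<Rightarrow> ('r, 'j) module \<Rightarrow> ('a, 'b) module \<Rightarrow> bool" where
  "tau_rigid R \<phi> \<Lambda> J M \<longleftrightarrow>
     (\<forall>f\<in>lmod_hom \<Lambda> M (ar_translate R \<phi> \<Lambda> J M). \<forall>x\<in>carrier M.
        f x = \<zero>\<^bsub>ar_translate R \<phi> \<Lambda> J M\<^esub>)"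

end

theory Submission
  imports Defs
begin

text \<open>Write \<open>\<Omega> = X \<oplus> Y\<close>, where \<open>X\<close> is isomorphic to \<open>T\<^sup>m\<close> with \<open>T\<close> simple and \<open>m\<close> maximal (\<open>T = S\<close> in the second
part). The module to look at is \<open>M = P/Y\<close>. Since \<open>P\<close> has \<open>\<Omega>\<close> as its greatest proper submodule, \<open>M\<close>
is local with top \<open>S\<close>, hence indecomposable, and \<open>\<Omega>/Y\<close>, which is isomorphic to \<open>X\<close>, is the kernel of
\<open>M \<rightarrow> S\<close>. If \<open>Y \<noteq> 0\<close>, then \<open>M\<close> is not projective, because \<open>P \<rightarrow> M\<close> is an essential epimorphism
that is not injective.

\<^bold>\<open>Why \<open>M\<close> is \<open>\<tau>\<close>-rigid.\<close> Let \<open>P1 \<rightarrow> P0 \<rightarrow> M\<close> be a minimal projective presentation; then even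
\<open>Hom(P1, M) = 0\<close>. Indeed a nonzero map from \<open>P1\<close> to a simple module \<open>U\<close> kills the kernel of the
projective cover \<open>P1 \<rightarrow> Y\<close> (\<open>projective_cover_kills_kernel\<close>), so it factors through \<open>Y\<close> and gives a
nonzero map \<open>\<Omega> \<rightarrow> U\<close> that vanishes on \<open>X\<close>. As \<open>\<Omega>\<close> is semisimple, this map splits, so \<open>U\<close> is a
summand of \<open>\<Omega>\<close> and, if \<open>U = T\<close>, then \<open>T\<^sup>m\<^sup>+\<^sup>1\<close> is one (\<open>direct_summand_power_Suc\<close>). This is
excluded for \<open>U = T\<close> by the maximality of \<open>m\<close>, and for \<open>U = S\<close> by the assumption on \<open>S\<close> in the first
part and by \<open>S = T\<close> in the second. But \<open>M\<close> is an extension of \<open>S\<close> by a power of \<open>T\<close>, so every map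
\<open>P1 \<rightarrow> M\<close> is zero (\<open>isotypic_quotient_tau_rigid\<close>). Finally \<open>Hom(P1, M) = 0\<close> forces
\<open>Hom(M, \<tau> M) = 0\<close>: for \<open>f : M \<rightarrow> \<tau> M\<close> the functional \<open>f m\<close> on \<open>Hom(P1, \<Lambda>)\<close> is determined by the
values at \<open>x \<mapsto> \<psi> x \<cdot> c\<close>, where \<open>\<psi>\<close> runs through a dual basis of \<open>P1\<close>, and \<open>c\<close> can be moved to the
other side, where it produces values of homomorphisms \<open>P1 \<rightarrow> M\<close> (\<open>tau_rigidI\<close>).

\<^bold>\<open>Why \<open>N\<close> is not \<open>\<tau>\<close>-rigid if \<open>\<Omega>\<close> is a power of \<open>S\<close>.\<close> Here \<open>N\<close> is not projective and \<open>P\<close> covers it, so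
the projective cover \<open>P0 \<rightarrow> N\<close> is not injective and its kernel embeds into \<open>\<Omega>\<close>, a power of \<open>S\<close>, so the kernel maps onto \<open>S\<close>. Hence there
is a nonzero \<open>P1 \<rightarrow> S\<close>, which lifts along the epimorphism \<open>s : N \<rightarrow> S\<close>. All maps \<open>P0 \<rightarrow> S\<close> vanish on the kernel, so
\<open>f m [g] = \<eta> (g q \<cdot> s m)\<close> is well defined on \<open>Tr N\<close> for every \<open>q \<in> P1\<close> and every \<open>R\<close>-linear
\<open>\<eta> : S \<rightarrow> J\<close>; for suitable \<open>q\<close> and \<open>\<eta>\<close> this is a nonzero homomorphism \<open>N \<rightarrow> \<tau> N\<close>
(\<open>not_tau_rigidI\<close>). A nonzero \<open>\<eta>\<close> exists because \<open>S\<close> has a quotient \<open>R/\<pp>\<close>, with \<open>\<pp>\<close> the annihilator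
of \<open>S\<close>, and \<open>R/\<pp>\<close> embeds into \<open>R/rad R\<close>, which lies in \<open>J\<close> (\<open>dualizing_functional\<close>).

\<^bold>\<open>Why there are minimal presentations.\<close> The translate \<open>\<tau> M\<close> is formed from a chosen minimal
presentation, so the argument requires that one exists. The kernels that occur are finite sums of
simple modules. The descending chain condition for left ideals passes from \<open>R\<close> to \<open>\<Lambda>\<close>
(\<open>artin_algebra_artinian\<close>); a left ideal that is minimal among those not annihilating a simple module
is a projective cover of it (\<open>simple_projective_cover\<close>), and the projective covers of independent
submodules add up to one of their sum (\<open>projective_cover_add\<close>).\<close>

section \<open>Submodules, homomorphisms and quotients\<close>

lemma a_kernel_eq: "a_kernel M N f = {x \<in> carrier M. f x = \<zero>\<^bsub>N\<^esub>}"
  by (simp add: a_kernel_def kernel_def)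

lemma set_add_eq: "A <+>\<^bsub>M\<^esub> B = {x \<oplus>\<^bsub>M\<^esub> y | x y. x \<in> A \<and> y \<in> B}"
  by (auto simp: set_add_def')

lemma set_addI: "a \<in> A \<Longrightarrow> b \<in> B \<Longrightarrow> a \<oplus>\<^bsub>M\<^esub> b \<in> A <+>\<^bsub>M\<^esub> B"
  by (auto simp: set_add_def')

lemma submod_subset: "submodule H \<Lambda> M \<Longrightarrow> H \<subseteq> carrier M"
  using subgroup.subset[of H "add_monoid M"] by (auto simp: submodule_def)

lemma submod_mem: "submodule H \<Lambda> M \<Longrightarrow> x \<in> H \<Longrightarrow> x \<in> carrier M"
  using submod_subset by blast

lemma submod_zero: "submodule H \<Lambda> M \<Longrightarrow> \<zero>\<^bsub>M\<^esub> \<in> H"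
  using subgroup.one_closed[of H "add_monoid M"] by (auto simp: submodule_def)

lemma submod_add: "submodule H \<Lambda> M \<Longrightarrow> x \<in> H \<Longrightarrow> y \<in> H \<Longrightarrow> x \<oplus>\<^bsub>M\<^esub> y \<in> H"
  using subgroup.m_closed[of H "add_monoid M"] by (auto simp: submodule_def)

lemma submod_minus: "submodule H \<Lambda> M \<Longrightarrow> x \<in> H \<Longrightarrow> \<ominus>\<^bsub>M\<^esub> x \<in> H"
  using subgroup.m_inv_closed[of H "add_monoid M"] by (auto simp: submodule_def a_inv_def)

lemma submod_diff: "submodule H \<Lambda> M \<Longrightarrow> x \<in> H \<Longrightarrow> y \<in> H \<Longrightarrow> x \<ominus>\<^bsub>M\<^esub> y \<in> H"
  by (simp add: a_minus_def submod_add submod_minus)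

lemma submod_smult: "submodule H \<Lambda> M \<Longrightarrow> a \<in> carrier \<Lambda> \<Longrightarrow> x \<in> H \<Longrightarrow> a \<odot>\<^bsub>M\<^esub> x \<in> H"
  by (rule submodule.smult_closed)

lemmas submod_closed = submod_mem submod_zero submod_add submod_minus submod_diff submod_smult

context left_module
begin

lemma smult_l_null [simp]: "x \<in> carrier M \<Longrightarrow> \<zero> \<odot>\<^bsub>M\<^esub> x = \<zero>\<^bsub>M\<^esub>"
  using smult_l_distr[of \<zero> \<zero> x] by (metis M.add.r_cancel_one' R.l_zero R.zero_closed smult_closed)

lemma smult_r_null [simp]: "a \<in> carrier R \<Longrightarrow> a \<odot>\<^bsub>M\<^esub> \<zero>\<^bsub>M\<^esub> = \<zero>\<^bsub>M\<^esub>"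
  using smult_r_distr[of a "\<zero>\<^bsub>M\<^esub>" "\<zero>\<^bsub>M\<^esub>"]
  by (metis M.add.r_cancel_one' M.l_zero M.zero_closed smult_closed)

lemma smult_l_minus:
  "a \<in> carrier R \<Longrightarrow> x \<in> carrier M \<Longrightarrow> (\<ominus> a) \<odot>\<^bsub>M\<^esub> x = \<ominus>\<^bsub>M\<^esub> (a \<odot>\<^bsub>M\<^esub> x)"
  using smult_l_distr[of "\<ominus> a" a x]
  by (metis M.minus_equality R.a_inv_closed R.l_neg smult_closed smult_l_null)

lemma smult_r_minus:
  "a \<in> carrier R \<Longrightarrow> x \<in> carrier M \<Longrightarrow> a \<odot>\<^bsub>M\<^esub> (\<ominus>\<^bsub>M\<^esub> x) = \<ominus>\<^bsub>M\<^esub> (a \<odot>\<^bsub>M\<^esub> x)"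
  using smult_r_distr[of a "\<ominus>\<^bsub>M\<^esub> x" x]
  by (metis M.minus_equality M.a_inv_closed M.l_neg smult_closed smult_r_null)

lemma smult_l_diff:
  "a \<in> carrier R \<Longrightarrow> b \<in> carrier R \<Longrightarrow> x \<in> carrier M \<Longrightarrow>
    (a \<ominus> b) \<odot>\<^bsub>M\<^esub> x = a \<odot>\<^bsub>M\<^esub> x \<ominus>\<^bsub>M\<^esub> b \<odot>\<^bsub>M\<^esub> x"
  by (simp add: a_minus_def smult_l_distr smult_l_minus)

lemma smult_r_diff:
  "a \<in> carrier R \<Longrightarrow> x \<in> carrier M \<Longrightarrow> y \<in> carrier M \<Longrightarrow>
    a \<odot>\<^bsub>M\<^esub> (x \<ominus>\<^bsub>M\<^esub> y) = a \<odot>\<^bsub>M\<^esub> x \<ominus>\<^bsub>M\<^esub> a \<odot>\<^bsub>M\<^esub> y"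
  by (simp add: a_minus_def smult_r_distr smult_r_minus)

lemma submoduleI:
  assumes "H \<subseteq> carrier M" "\<zero>\<^bsub>M\<^esub> \<in> H" "\<And>x y. x \<in> H \<Longrightarrow> y \<in> H \<Longrightarrow> x \<oplus>\<^bsub>M\<^esub> y \<in> H"
    and s: "\<And>a x. a \<in> carrier R \<Longrightarrow> x \<in> H \<Longrightarrow> a \<odot>\<^bsub>M\<^esub> x \<in> H"
  shows "submodule H R M"
proof -
  have "\<ominus>\<^bsub>M\<^esub> x \<in> H" if "x \<in> H" for x
    using s[of "\<ominus> \<one>" x] that assms(1) by (auto simp: smult_l_minus)
  then show ?thesis
    using assms by (intro submodule.intro subgroup.intro) (auto simp: submodule_axioms_def a_inv_def)
qed

lemma submodule_carrier: "submodule (carrier M) R M"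
  by (rule submoduleI) auto

lemma submodule_null: "submodule {\<zero>\<^bsub>M\<^esub>} R M"
  by (rule submoduleI) auto

lemma submodule_Int: "submodule A R M \<Longrightarrow> submodule B R M \<Longrightarrow> submodule (A \<inter> B) R M"
  by (rule submoduleI) (auto simp: submod_closed)

lemma submodule_set_add:
  assumes A: "submodule A R M" and B: "submodule B R M" shows "submodule (A <+>\<^bsub>M\<^esub> B) R M"
proof (rule submoduleI)
  show "A <+>\<^bsub>M\<^esub> B \<subseteq> carrier M" using submod_mem[OF A] submod_mem[OF B] by (auto simp: set_add_eq)
  show "\<zero>\<^bsub>M\<^esub> \<in> A <+>\<^bsub>M\<^esub> B" using submod_zero[OF A] submod_zero[OF B] by (force simp: set_add_eq)
next
  fix x y assume "x \<in> A <+>\<^bsub>M\<^esub> B" "y \<in> A <+>\<^bsub>M\<^esub> B"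
  then obtain a b a' b' where *: "a \<in> A" "b \<in> B" "a' \<in> A" "b' \<in> B" "x = a \<oplus>\<^bsub>M\<^esub> b" "y = a' \<oplus>\<^bsub>M\<^esub> b'"
    by (auto simp: set_add_eq)
  then have "x \<oplus>\<^bsub>M\<^esub> y = (a \<oplus>\<^bsub>M\<^esub> a') \<oplus>\<^bsub>M\<^esub> (b \<oplus>\<^bsub>M\<^esub> b')"
    using submod_mem[OF A] submod_mem[OF B] by (simp add: M.a_ac)
  then show "x \<oplus>\<^bsub>M\<^esub> y \<in> A <+>\<^bsub>M\<^esub> B"
    using * submod_add[OF A] submod_add[OF B] by (simp add: set_addI)
next
  fix c x assume c: "c \<in> carrier R" "x \<in> A <+>\<^bsub>M\<^esub> B"
  then obtain a b where *: "a \<in> A" "b \<in> B" "x = a \<oplus>\<^bsub>M\<^esub> b" by (auto simp: set_add_eq)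
  then have "c \<odot>\<^bsub>M\<^esub> x = c \<odot>\<^bsub>M\<^esub> a \<oplus>\<^bsub>M\<^esub> c \<odot>\<^bsub>M\<^esub> b"
    using c submod_mem[OF A] submod_mem[OF B] by (simp add: smult_r_distr)
  then show "c \<odot>\<^bsub>M\<^esub> x \<in> A <+>\<^bsub>M\<^esub> B"
    using c * submod_smult[OF A] submod_smult[OF B] by (simp add: set_addI)
qed

lemma subset_set_add:
  assumes "submodule A R M" "submodule B R M" shows "A \<subseteq> A <+>\<^bsub>M\<^esub> B" "B \<subseteq> A <+>\<^bsub>M\<^esub> B"
proof -
  show "A \<subseteq> A <+>\<^bsub>M\<^esub> B"
    using submod_mem[OF assms(1)] submod_zero[OF assms(2)] by (force simp: set_add_eq)
  show "B \<subseteq> A <+>\<^bsub>M\<^esub> B"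
    using submod_mem[OF assms(2)] submod_zero[OF assms(1)] by (force simp: set_add_eq)
qed

lemma submodule_cyclic:
  assumes "x \<in> carrier M" shows "submodule ((\<lambda>a. a \<odot>\<^bsub>M\<^esub> x) ` carrier R) R M"
proof (rule submoduleI)
  show "\<zero>\<^bsub>M\<^esub> \<in> (\<lambda>a. a \<odot>\<^bsub>M\<^esub> x) ` carrier R" using assms by (intro image_eqI[of _ _ \<zero>]) auto
next
  fix u v assume "u \<in> (\<lambda>a. a \<odot>\<^bsub>M\<^esub> x) ` carrier R" "v \<in> (\<lambda>a. a \<odot>\<^bsub>M\<^esub> x) ` carrier R"
  then show "u \<oplus>\<^bsub>M\<^esub> v \<in> (\<lambda>a. a \<odot>\<^bsub>M\<^esub> x) ` carrier R"
    using assms by (auto simp: smult_l_distr[symmetric])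
next
  fix c u assume "c \<in> carrier R" "u \<in> (\<lambda>a. a \<odot>\<^bsub>M\<^esub> x) ` carrier R"
  then show "c \<odot>\<^bsub>M\<^esub> u \<in> (\<lambda>a. a \<odot>\<^bsub>M\<^esub> x) ` carrier R"
    using assms by (auto simp: smult_assoc1[symmetric])
qed (use assms in auto)

lemma minus_add_cancel: "x \<in> carrier M \<Longrightarrow> y \<in> carrier M \<Longrightarrow> (x \<ominus>\<^bsub>M\<^esub> y) \<oplus>\<^bsub>M\<^esub> y = x"
  by (simp add: a_minus_def M.a_assoc M.l_neg)

lemma add_minus_cancel: "x \<in> carrier M \<Longrightarrow> y \<in> carrier M \<Longrightarrow> y \<oplus>\<^bsub>M\<^esub> (x \<ominus>\<^bsub>M\<^esub> y) = x"
  by (metis minus_add_cancel M.a_comm M.minus_closed)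

lemma add_diff_cancel: "x \<in> carrier M \<Longrightarrow> y \<in> carrier M \<Longrightarrow> (x \<oplus>\<^bsub>M\<^esub> y) \<ominus>\<^bsub>M\<^esub> y = x"
  by (simp add: a_minus_def M.a_assoc M.r_neg)

lemma add_diff_cancel': "x \<in> carrier M \<Longrightarrow> y \<in> carrier M \<Longrightarrow> (x \<oplus>\<^bsub>M\<^esub> y) \<ominus>\<^bsub>M\<^esub> x = y"
  by (metis add_diff_cancel M.a_comm)

lemma diff_eq_zero: "x \<in> carrier M \<Longrightarrow> y \<in> carrier M \<Longrightarrow> x \<ominus>\<^bsub>M\<^esub> y = \<zero>\<^bsub>M\<^esub> \<longleftrightarrow> x = y"
  by (metis minus_add_cancel M.l_zero M.r_neg a_minus_def)

lemma diff_zero: "x \<in> carrier M \<Longrightarrow> x \<ominus>\<^bsub>M\<^esub> \<zero>\<^bsub>M\<^esub> = x"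
  using minus_add_cancel[of x "\<zero>\<^bsub>M\<^esub>"] by simp

lemma left_module_restr:
  assumes H: "submodule H R M" shows "left_module R (restr M H)"
proof -
  have ag: "abelian_group (restr M H)"
  proof (rule abelian_groupI)
    fix x assume "x \<in> carrier (restr M H)"
    then show "\<exists>y\<in>carrier (restr M H). y \<oplus>\<^bsub>restr M H\<^esub> x = \<zero>\<^bsub>restr M H\<^esub>"
      using submod_minus[OF H] submod_mem[OF H] by (intro bexI[of _ "\<ominus>\<^bsub>M\<^esub> x"]) (auto simp: M.l_neg)
  qed (use H in \<open>auto simp: submod_closed M.a_ac\<close>)
  show ?thesis
    by (intro left_module.intro ag R.ring_axioms left_module_axioms.intro)
      (use H in \<open>auto simp: submod_closed smult_l_distr smult_r_distr smult_assoc1\<close>)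
qed

lemma submodule_restr_iff:
  assumes H: "submodule H R M"
  shows "submodule K R (restr M H) \<longleftrightarrow> submodule K R M \<and> K \<subseteq> H"
proof
  interpret H: left_module R "restr M H" by (rule left_module_restr[OF H])
  show "submodule K R (restr M H) \<Longrightarrow> submodule K R M \<and> K \<subseteq> H"
    using submod_subset[of K R "restr M H"] submod_zero[of K R "restr M H"]
      submod_add[of K R "restr M H"] submod_smult[of K R "restr M H"] submod_subset[OF H]
    by (intro conjI submoduleI) auto
  show "submodule K R M \<and> K \<subseteq> H \<Longrightarrow> submodule K R (restr M H)"
    by (intro H.submoduleI) (auto simp: submod_closed)
qed

end

lemma lmod_homI:
  assumes "\<And>x. x \<in> carrier M \<Longrightarrow> f x \<in> carrier N"
    "\<And>x y. x \<in> carrier M \<Longrightarrow> y \<in> carrier M \<Longrightarrow> f (x \<oplus>\<^bsub>M\<^esub> y) = f x \<oplus>\<^bsub>N\<^esub> f y"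
    "\<And>a x. a \<in> carrier \<Lambda> \<Longrightarrow> x \<in> carrier M \<Longrightarrow> f (a \<odot>\<^bsub>M\<^esub> x) = a \<odot>\<^bsub>N\<^esub> f x"
  shows "f \<in> lmod_hom \<Lambda> M N"
  using assms by (auto simp: lmod_hom_def)

lemma hom_closed: "f \<in> lmod_hom \<Lambda> M N \<Longrightarrow> x \<in> carrier M \<Longrightarrow> f x \<in> carrier N"
  by (auto simp: lmod_hom_def)

lemma hom_add: "f \<in> lmod_hom \<Lambda> M N \<Longrightarrow> x \<in> carrier M \<Longrightarrow> y \<in> carrier M \<Longrightarrow> f (x \<oplus>\<^bsub>M\<^esub> y) = f x \<oplus>\<^bsub>N\<^esub> f y"
  by (auto simp: lmod_hom_def)

lemma hom_smult: "f \<in> lmod_hom \<Lambda> M N \<Longrightarrow> a \<in> carrier \<Lambda> \<Longrightarrow> x \<in> carrier M \<Longrightarrow> f (a \<odot>\<^bsub>M\<^esub> x) = a \<odot>\<^bsub>N\<^esub> f x"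
  by (auto simp: lmod_hom_def)

lemma hom_comp: "f \<in> lmod_hom \<Lambda> M N \<Longrightarrow> g \<in> lmod_hom \<Lambda> N K \<Longrightarrow> (\<lambda>x. g (f x)) \<in> lmod_hom \<Lambda> M K"
  by (auto simp: lmod_hom_def Pi_iff)

lemma hom_to_restr: "f \<in> lmod_hom \<Lambda> M N \<Longrightarrow> (\<And>x. x \<in> carrier M \<Longrightarrow> f x \<in> H) \<Longrightarrow> f \<in> lmod_hom \<Lambda> M (restr N H)"
  by (auto simp: lmod_hom_def)

lemma hom_from_restr: "f \<in> lmod_hom \<Lambda> M N \<Longrightarrow> H \<subseteq> carrier M \<Longrightarrow> f \<in> lmod_hom \<Lambda> (restr M H) N"
  by (auto simp: lmod_hom_def subset_iff)

lemma hom_into_restr: "f \<in> lmod_hom \<Lambda> M (restr N H) \<Longrightarrow> H \<subseteq> carrier N \<Longrightarrow> f \<in> lmod_hom \<Lambda> M N"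
  by (auto simp: lmod_hom_def)

lemma hom_cong:
  assumes "f \<in> lmod_hom \<Lambda> M N" "left_module \<Lambda> M" "\<And>x. x \<in> carrier M \<Longrightarrow> f x = g x"
  shows "g \<in> lmod_hom \<Lambda> M N"
proof -
  interpret left_module \<Lambda> M by fact
  show ?thesis
    by (rule lmod_homI) (use assms in \<open>auto simp: assms(3)[symmetric] hom_add hom_smult hom_closed\<close>)
qed

lemma hom_zero:
  assumes "f \<in> lmod_hom \<Lambda> M N" "left_module \<Lambda> M" "left_module \<Lambda> N" shows "f \<zero>\<^bsub>M\<^esub> = \<zero>\<^bsub>N\<^esub>"
proof -
  interpret M: left_module \<Lambda> M by fact
  interpret N: left_module \<Lambda> N by fact
  show ?thesis
    using hom_smult[OF assms(1) M.R.zero_closed M.M.zero_closed] hom_closed[OF assms(1) M.M.zero_closed]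
    by simp
qed

lemma hom_minus:
  assumes "f \<in> lmod_hom \<Lambda> M N" "left_module \<Lambda> M" "left_module \<Lambda> N" "x \<in> carrier M"
  shows "f (\<ominus>\<^bsub>M\<^esub> x) = \<ominus>\<^bsub>N\<^esub> f x"
proof -
  interpret M: left_module \<Lambda> M by fact
  interpret N: left_module \<Lambda> N by fact
  have "\<ominus>\<^bsub>M\<^esub> x = (\<ominus>\<^bsub>\<Lambda>\<^esub> \<one>\<^bsub>\<Lambda>\<^esub>) \<odot>\<^bsub>M\<^esub> x" using assms(4) by (simp add: M.smult_l_minus)
  then show ?thesis
    using hom_smult[OF assms(1) _ assms(4), of "\<ominus>\<^bsub>\<Lambda>\<^esub> \<one>\<^bsub>\<Lambda>\<^esub>"] hom_closed[OF assms(1,4)]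
    by (simp add: N.smult_l_minus)
qed

lemma hom_diff:
  assumes "f \<in> lmod_hom \<Lambda> M N" "left_module \<Lambda> M" "left_module \<Lambda> N" "x \<in> carrier M" "y \<in> carrier M"
  shows "f (x \<ominus>\<^bsub>M\<^esub> y) = f x \<ominus>\<^bsub>N\<^esub> f y"
proof -
  interpret M: left_module \<Lambda> M by fact
  show ?thesis using assms by (simp add: a_minus_def hom_add[OF assms(1)] hom_minus[OF assms(1-3)])
qed

lemma hom_finsum:
  assumes f: "f \<in> lmod_hom \<Lambda> M N" and M: "left_module \<Lambda> M" and N: "left_module \<Lambda> N"
    and a: "\<And>i. i < n \<Longrightarrow> a i \<in> carrier M"
  shows "f (\<Oplus>\<^bsub>M\<^esub>i\<in>{..<n::nat}. a i) = (\<Oplus>\<^bsub>N\<^esub>i\<in>{..<n}. f (a i))"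
proof -
  interpret M: left_module \<Lambda> M by fact
  interpret N: left_module \<Lambda> N by fact
  show ?thesis using a
  proof (induction n)
    case 0 then show ?case using hom_zero[OF f M N] by simp
  next
    case (Suc n)
    have "(\<Oplus>\<^bsub>M\<^esub>i\<in>{..<n}. a i) \<in> carrier M" by (rule M.M.finsum_closed) (use Suc in auto)
    moreover have "(\<lambda>i. f (a i)) \<in> {..<n} \<rightarrow> carrier N" "f (a n) \<in> carrier N"
      using Suc hom_closed[OF f] by auto
    moreover have "a \<in> {..<n} \<rightarrow> carrier M" using Suc by auto
    ultimately show ?case using Suc hom_add[OF f] by (simp add: lessThan_Suc)
  qed
qed

lemma submodule_kernel:
  assumes "f \<in> lmod_hom \<Lambda> M N" "left_module \<Lambda> M" "left_module \<Lambda> N"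
  shows "submodule (a_kernel M N f) \<Lambda> M"
proof -
  interpret M: left_module \<Lambda> M by fact
  interpret N: left_module \<Lambda> N by fact
  show ?thesis
    by (rule M.submoduleI)
      (use assms in \<open>auto simp: a_kernel_eq hom_zero hom_add[OF assms(1)] hom_smult[OF assms(1)]\<close>)
qed

lemma submodule_vimage:
  assumes "f \<in> lmod_hom \<Lambda> M N" "left_module \<Lambda> M" "left_module \<Lambda> N" "submodule H \<Lambda> N"
  shows "submodule {x \<in> carrier M. f x \<in> H} \<Lambda> M"
proof -
  interpret M: left_module \<Lambda> M by fact
  show ?thesis
    by (rule M.submoduleI)
      (use assms in \<open>auto simp: hom_zero hom_add[OF assms(1)] hom_smult[OF assms(1)] submod_closed\<close>)
qed

lemma submodule_image:
  assumes f: "f \<in> lmod_hom \<Lambda> M N" and M: "left_module \<Lambda> M" and N: "left_module \<Lambda> N" and H: "submodule H \<Lambda> M"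
  shows "submodule (f ` H) \<Lambda> N"
proof -
  interpret M: left_module \<Lambda> M by fact
  interpret N: left_module \<Lambda> N by fact
  show ?thesis
  proof (rule N.submoduleI)
    show "f ` H \<subseteq> carrier N" using hom_closed[OF f] submod_mem[OF H] by auto
    show "\<zero>\<^bsub>N\<^esub> \<in> f ` H" using hom_zero[OF f M N] submod_zero[OF H] by (metis imageI)
    show "x \<oplus>\<^bsub>N\<^esub> y \<in> f ` H" if "x \<in> f ` H" "y \<in> f ` H" for x y
      using that hom_add[OF f] submod_mem[OF H] submod_add[OF H] by (auto simp: image_iff) metis
    show "a \<odot>\<^bsub>N\<^esub> x \<in> f ` H" if "a \<in> carrier \<Lambda>" "x \<in> f ` H" for a x
      using that hom_smult[OF f] submod_mem[OF H] submod_smult[OF H] by (auto simp: image_iff) metis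
  qed
qed

lemma hom_inj_iff:
  assumes f: "f \<in> lmod_hom \<Lambda> M N" and M: "left_module \<Lambda> M" and N: "left_module \<Lambda> N"
  shows "inj_on f (carrier M) \<longleftrightarrow> (\<forall>x\<in>carrier M. f x = \<zero>\<^bsub>N\<^esub> \<longrightarrow> x = \<zero>\<^bsub>M\<^esub>)"
proof -
  interpret M: left_module \<Lambda> M by fact
  interpret N: left_module \<Lambda> N by fact
  show ?thesis
  proof
    assume "inj_on f (carrier M)"
    then show "\<forall>x\<in>carrier M. f x = \<zero>\<^bsub>N\<^esub> \<longrightarrow> x = \<zero>\<^bsub>M\<^esub>"
      using hom_zero[OF assms] by (metis M.M.zero_closed inj_onD)
  next
    assume *: "\<forall>x\<in>carrier M. f x = \<zero>\<^bsub>N\<^esub> \<longrightarrow> x = \<zero>\<^bsub>M\<^esub>"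
    show "inj_on f (carrier M)"
    proof (rule inj_onI)
      fix x y assume xy: "x \<in> carrier M" "y \<in> carrier M" "f x = f y"
      then have "f (x \<ominus>\<^bsub>M\<^esub> y) = \<zero>\<^bsub>N\<^esub>"
        using hom_diff[OF f M N] hom_closed[OF f] N.diff_eq_zero by metis
      then show "x = y" using * xy M.diff_eq_zero M.M.minus_closed by metis
    qed
  qed
qed

lemma hom_inv_into:
  assumes f: "f \<in> lmod_hom \<Lambda> M N" and M: "left_module \<Lambda> M" and bij: "bij_betw f (carrier M) (carrier N)"
  shows "inv_into (carrier M) f \<in> lmod_hom \<Lambda> N M"
    and "bij_betw (inv_into (carrier M) f) (carrier N) (carrier M)"
proof -
  interpret M: left_module \<Lambda> M by fact
  have *: "inv_into (carrier M) f (f x) = x" if "x \<in> carrier M" for x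
    using bij that by (auto simp: bij_betw_def)
  have surj: "\<exists>x\<in>carrier M. y = f x" if "y \<in> carrier N" for y using bij that by (auto simp: bij_betw_def)
  show "inv_into (carrier M) f \<in> lmod_hom \<Lambda> N M"
  proof (rule lmod_homI)
    fix y assume "y \<in> carrier N" then show "inv_into (carrier M) f y \<in> carrier M"
      using surj * by metis
  next
    fix y y' assume "y \<in> carrier N" "y' \<in> carrier N"
    then obtain x x' where "x \<in> carrier M" "x' \<in> carrier M" "y = f x" "y' = f x'" using surj by metis
    then show "inv_into (carrier M) f (y \<oplus>\<^bsub>N\<^esub> y') = inv_into (carrier M) f y \<oplus>\<^bsub>M\<^esub> inv_into (carrier M) f y'"
      by (simp add: * hom_add[OF f, symmetric])
  next
    fix a y assume "a \<in> carrier \<Lambda>" "y \<in> carrier N"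
    moreover obtain x where "x \<in> carrier M" "y = f x" using surj \<open>y \<in> carrier N\<close> by metis
    ultimately show "inv_into (carrier M) f (a \<odot>\<^bsub>N\<^esub> y) = a \<odot>\<^bsub>M\<^esub> inv_into (carrier M) f y"
      by (simp add: * hom_smult[OF f, symmetric])
  qed
  show "bij_betw (inv_into (carrier M) f) (carrier N) (carrier M)" by (rule bij_betw_inv_into[OF bij])
qed

lemma hom_factor:
  assumes f: "f \<in> lmod_hom \<Lambda> A B" and g: "g \<in> lmod_hom \<Lambda> A C" and A: "left_module \<Lambda> A"
    and B: "left_module \<Lambda> B" and C: "left_module \<Lambda> C"
    and surj: "f ` carrier A = carrier B"
    and ker: "\<And>x. x \<in> carrier A \<Longrightarrow> f x = \<zero>\<^bsub>B\<^esub> \<Longrightarrow> g x = \<zero>\<^bsub>C\<^esub>"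
  obtains h where "h \<in> lmod_hom \<Lambda> B C" "\<And>x. x \<in> carrier A \<Longrightarrow> h (f x) = g x"
proof -
  interpret A: left_module \<Lambda> A by fact
  interpret B: left_module \<Lambda> B by fact
  interpret C: left_module \<Lambda> C by fact
  define h where "h y = g (inv_into (carrier A) f y)" for y
  have *: "h (f x) = g x" if x: "x \<in> carrier A" for x
  proof -
    let ?x = "inv_into (carrier A) f (f x)"
    have "?x \<in> carrier A" "f ?x = f x" using x by (auto intro: inv_into_into f_inv_into_f)
    then have "f (?x \<ominus>\<^bsub>A\<^esub> x) = \<zero>\<^bsub>B\<^esub>"
      using x hom_diff[OF f A B] B.diff_eq_zero hom_closed[OF f] by metis
    then have "g (?x \<ominus>\<^bsub>A\<^esub> x) = \<zero>\<^bsub>C\<^esub>" using ker x \<open>?x \<in> carrier A\<close> by simp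
    then show ?thesis using x \<open>?x \<in> carrier A\<close> hom_diff[OF g A C] C.diff_eq_zero hom_closed[OF g]
      unfolding h_def by metis
  qed
  have s: "\<exists>x\<in>carrier A. y = f x" if "y \<in> carrier B" for y using surj that by auto
  have "h \<in> lmod_hom \<Lambda> B C"
  proof (rule lmod_homI)
    fix y assume "y \<in> carrier B" then show "h y \<in> carrier C" using s * hom_closed[OF g] by metis
  next
    fix y y' assume "y \<in> carrier B" "y' \<in> carrier B"
    then obtain x x' where "x \<in> carrier A" "x' \<in> carrier A" "y = f x" "y' = f x'" using s by metis
    then show "h (y \<oplus>\<^bsub>B\<^esub> y') = h y \<oplus>\<^bsub>C\<^esub> h y'"
      by (simp add: * hom_add[OF f, symmetric] hom_add[OF g])
  next
    fix a y assume "a \<in> carrier \<Lambda>" "y \<in> carrier B"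
    moreover obtain x where "x \<in> carrier A" "y = f x" using s \<open>y \<in> carrier B\<close> by metis
    ultimately show "h (a \<odot>\<^bsub>B\<^esub> y) = a \<odot>\<^bsub>C\<^esub> h y"
      by (simp add: * hom_smult[OF f, symmetric] hom_smult[OF g])
  qed
  then show ?thesis using that * by blast
qed

text \<open>The axioms of a module are identities, so they pass to every structure onto which a module is mapped
compatibly with the operations. Quotients and transported copies become modules in this way.\<close>

lemma left_module_image:
  assumes M: "left_module \<Lambda> M" and surj: "f ` carrier M = carrier N" and z: "f \<zero>\<^bsub>M\<^esub> = \<zero>\<^bsub>N\<^esub>"
    and add: "\<And>x y. x \<in> carrier M \<Longrightarrow> y \<in> carrier M \<Longrightarrow> f (x \<oplus>\<^bsub>M\<^esub> y) = f x \<oplus>\<^bsub>N\<^esub> f y"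
    and sm: "\<And>a x. a \<in> carrier \<Lambda> \<Longrightarrow> x \<in> carrier M \<Longrightarrow> f (a \<odot>\<^bsub>M\<^esub> x) = a \<odot>\<^bsub>N\<^esub> f x"
  shows "left_module \<Lambda> N" "f \<in> lmod_hom \<Lambda> M N"
proof -
  interpret M: left_module \<Lambda> M by fact
  have s: "\<exists>x\<in>carrier M. y = f x" if "y \<in> carrier N" for y using surj that by auto
  have c: "f x \<in> carrier N" if "x \<in> carrier M" for x using surj that by auto
  have ag: "abelian_group N"
  proof (rule abelian_groupI)
    fix x y assume "x \<in> carrier N" "y \<in> carrier N"
    then obtain u v where [simp]: "x = f u" "y = f v" "u \<in> carrier M" "v \<in> carrier M" using s by metis
    show "x \<oplus>\<^bsub>N\<^esub> y \<in> carrier N" by (simp add: c add[symmetric])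
    show "x \<oplus>\<^bsub>N\<^esub> y = y \<oplus>\<^bsub>N\<^esub> x" by (simp add: M.M.a_comm add[symmetric])
  next
    fix x y w assume "x \<in> carrier N" "y \<in> carrier N" "w \<in> carrier N"
    then obtain u v t where [simp]: "x = f u" "y = f v" "u \<in> carrier M" "v \<in> carrier M"
      "w = f t" "t \<in> carrier M" using s by metis
    show "x \<oplus>\<^bsub>N\<^esub> y \<oplus>\<^bsub>N\<^esub> w = x \<oplus>\<^bsub>N\<^esub> (y \<oplus>\<^bsub>N\<^esub> w)" by (simp add: M.M.a_assoc add[symmetric])
  next
    show "\<zero>\<^bsub>N\<^esub> \<in> carrier N" using c[of "\<zero>\<^bsub>M\<^esub>"] by (simp add: z)
  next
    fix x assume "x \<in> carrier N"
    then obtain u where [simp]: "x = f u" "u \<in> carrier M" using s by metis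
    show "\<zero>\<^bsub>N\<^esub> \<oplus>\<^bsub>N\<^esub> x = x" by (simp add: z[symmetric] add[symmetric])
    show "\<exists>y\<in>carrier N. y \<oplus>\<^bsub>N\<^esub> x = \<zero>\<^bsub>N\<^esub>"
      by (rule bexI[of _ "f (\<ominus>\<^bsub>M\<^esub> u)"]) (auto simp: z[symmetric] add[symmetric] M.M.l_neg c)
  qed
  show "left_module \<Lambda> N"
  proof (intro left_module.intro ag M.R.ring_axioms left_module_axioms.intro)
    fix a x assume a: "a \<in> carrier \<Lambda>" "x \<in> carrier N"
    then obtain u where [simp]: "x = f u" "u \<in> carrier M" using s by metis
    show "a \<odot>\<^bsub>N\<^esub> x \<in> carrier N" using a by (simp add: sm[symmetric] c)
    fix b assume b: "b \<in> carrier \<Lambda>"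
    show "(a \<oplus>\<^bsub>\<Lambda>\<^esub> b) \<odot>\<^bsub>N\<^esub> x = a \<odot>\<^bsub>N\<^esub> x \<oplus>\<^bsub>N\<^esub> b \<odot>\<^bsub>N\<^esub> x"
      using a(1) b by (simp add: sm[symmetric] add[symmetric] M.smult_l_distr)
    show "(a \<otimes>\<^bsub>\<Lambda>\<^esub> b) \<odot>\<^bsub>N\<^esub> x = a \<odot>\<^bsub>N\<^esub> (b \<odot>\<^bsub>N\<^esub> x)"
      using a(1) b by (simp add: sm[symmetric] M.smult_assoc1)
  next
    fix a x y assume a: "a \<in> carrier \<Lambda>" "x \<in> carrier N" "y \<in> carrier N"
    then obtain u v where [simp]: "x = f u" "y = f v" "u \<in> carrier M" "v \<in> carrier M" using s by metis
    show "a \<odot>\<^bsub>N\<^esub> (x \<oplus>\<^bsub>N\<^esub> y) = a \<odot>\<^bsub>N\<^esub> x \<oplus>\<^bsub>N\<^esub> a \<odot>\<^bsub>N\<^esub> y"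
      using a(1) by (simp add: sm[symmetric] add[symmetric] M.smult_r_distr)
  next
    fix x assume "x \<in> carrier N"
    then obtain u where [simp]: "x = f u" "u \<in> carrier M" using s by metis
    show "\<one>\<^bsub>\<Lambda>\<^esub> \<odot>\<^bsub>N\<^esub> x = x" by (simp add: sm[symmetric])
  qed
  show "f \<in> lmod_hom \<Lambda> M N" by (rule lmod_homI) (auto simp: c add sm)
qed

context left_module begin

lemma a_rcos_eq_iff:
  assumes H: "submodule H R M" and x: "x \<in> carrier M" and y: "y \<in> carrier M"
  shows "H +>\<^bsub>M\<^esub> x = H +>\<^bsub>M\<^esub> y \<longleftrightarrow> x \<ominus>\<^bsub>M\<^esub> y \<in> H"
proof -
  have sg: "subgroup H (add_monoid M)" using H by (simp add: submodule_def)
  show ?thesis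
  proof
    assume *: "H +>\<^bsub>M\<^esub> x = H +>\<^bsub>M\<^esub> y"
    have "x \<in> H +>\<^bsub>M\<^esub> x" using submod_zero[OF H] x by (force simp: a_r_coset_def')
    then obtain h where "h \<in> H" "x = h \<oplus>\<^bsub>M\<^esub> y" using * by (auto simp: a_r_coset_def')
    then show "x \<ominus>\<^bsub>M\<^esub> y \<in> H" using y submod_mem[OF H] by (simp add: add_diff_cancel)
  next
    assume *: "x \<ominus>\<^bsub>M\<^esub> y \<in> H"
    have "x = (x \<ominus>\<^bsub>M\<^esub> y) \<oplus>\<^bsub>M\<^esub> y" by (simp add: minus_add_cancel x y)
    then have "x \<in> H +>\<^bsub>M\<^esub> y" using * by (auto simp: a_r_coset_def')
    then show "H +>\<^bsub>M\<^esub> x = H +>\<^bsub>M\<^esub> y" using M.a_repr_independence[OF _ y sg] by simp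
  qed
qed

lemma a_rcos_self: "submodule H R M \<Longrightarrow> x \<in> carrier M \<Longrightarrow> x \<in> H +>\<^bsub>M\<^esub> x"
  using submod_zero[of H R M] by (force simp: a_r_coset_def')

lemma a_rcos_zero: "submodule H R M \<Longrightarrow> H +>\<^bsub>M\<^esub> \<zero>\<^bsub>M\<^esub> = H"
  by (rule M.a_coset_add_zero[OF submod_subset])

text \<open>The scalar product of a coset is defined as a union over its representatives; all of them give the
same coset, so the union has a single member.\<close>

lemma quot_mod_facts:
  assumes H: "submodule H R M"
  shows "(\<lambda>x. H +>\<^bsub>M\<^esub> x) ` carrier M = carrier (quot_mod M H)"
    and "\<And>x y. x \<in> carrier M \<Longrightarrow> y \<in> carrier M \<Longrightarrow>
      H +>\<^bsub>M\<^esub> (x \<oplus>\<^bsub>M\<^esub> y) = (H +>\<^bsub>M\<^esub> x) \<oplus>\<^bsub>quot_mod M H\<^esub> (H +>\<^bsub>M\<^esub> y)"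
    and "\<And>a x. a \<in> carrier R \<Longrightarrow> x \<in> carrier M \<Longrightarrow>
      H +>\<^bsub>M\<^esub> (a \<odot>\<^bsub>M\<^esub> x) = a \<odot>\<^bsub>quot_mod M H\<^esub> (H +>\<^bsub>M\<^esub> x)"
    and "H +>\<^bsub>M\<^esub> \<zero>\<^bsub>M\<^esub> = \<zero>\<^bsub>quot_mod M H\<^esub>"
proof -
  interpret H: abelian_subgroup H M
    using H by (intro abelian_subgroupI3 additive_subgroupI M.abelian_group_axioms) (simp add: submodule_def)
  show "(\<lambda>x. H +>\<^bsub>M\<^esub> x) ` carrier M = carrier (quot_mod M H)"
    by (auto simp: quot_mod_def A_RCOSETS_def')
  show "H +>\<^bsub>M\<^esub> (x \<oplus>\<^bsub>M\<^esub> y) = (H +>\<^bsub>M\<^esub> x) \<oplus>\<^bsub>quot_mod M H\<^esub> (H +>\<^bsub>M\<^esub> y)"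
    if "x \<in> carrier M" "y \<in> carrier M" for x y
    using H.a_rcos_sum[OF that] by (simp add: quot_mod_def)
  show "H +>\<^bsub>M\<^esub> \<zero>\<^bsub>M\<^esub> = \<zero>\<^bsub>quot_mod M H\<^esub>" using a_rcos_zero[OF H] by (simp add: quot_mod_def)
  fix a x assume a: "a \<in> carrier R" and x: "x \<in> carrier M"
  have *: "H +>\<^bsub>M\<^esub> (a \<odot>\<^bsub>M\<^esub> y) = H +>\<^bsub>M\<^esub> (a \<odot>\<^bsub>M\<^esub> x)" if y: "y \<in> H +>\<^bsub>M\<^esub> x" for y
  proof -
    obtain h where h: "h \<in> H" "y = h \<oplus>\<^bsub>M\<^esub> x" using y by (auto simp: a_r_coset_def')
    have hM: "h \<in> carrier M" using h(1) submod_mem[OF H] by simp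
    have "a \<odot>\<^bsub>M\<^esub> y \<ominus>\<^bsub>M\<^esub> a \<odot>\<^bsub>M\<^esub> x = a \<odot>\<^bsub>M\<^esub> h"
      using a x hM h(2) by (simp add: smult_r_distr add_diff_cancel)
    then show ?thesis
      using a x hM h by (subst a_rcos_eq_iff[OF H]) (auto simp: submod_smult[OF H a])
  qed
  have "(\<Union>y\<in>H +>\<^bsub>M\<^esub> x. H +>\<^bsub>M\<^esub> (a \<odot>\<^bsub>M\<^esub> y)) = (\<Union>y\<in>H +>\<^bsub>M\<^esub> x. H +>\<^bsub>M\<^esub> (a \<odot>\<^bsub>M\<^esub> x))"
    by (rule SUP_cong[OF refl]) (rule *)
  also have "\<dots> = H +>\<^bsub>M\<^esub> (a \<odot>\<^bsub>M\<^esub> x)" using a_rcos_self[OF H x] by blast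
  finally show "H +>\<^bsub>M\<^esub> (a \<odot>\<^bsub>M\<^esub> x) = a \<odot>\<^bsub>quot_mod M H\<^esub> (H +>\<^bsub>M\<^esub> x)"
    by (simp add: quot_mod_def)
qed

lemma left_module_quot: "submodule H R M \<Longrightarrow> left_module R (quot_mod M H)"
  by (rule left_module_image(1)[OF left_module_axioms quot_mod_facts(1,4,2,3)])

lemma quot_proj_hom: "submodule H R M \<Longrightarrow> (\<lambda>x. H +>\<^bsub>M\<^esub> x) \<in> lmod_hom R M (quot_mod M H)"
  by (rule left_module_image(2)[OF left_module_axioms quot_mod_facts(1,4,2,3)])

lemma quot_proj_eq_zero:
  assumes "submodule H R M" "x \<in> carrier M"
  shows "H +>\<^bsub>M\<^esub> x = \<zero>\<^bsub>quot_mod M H\<^esub> \<longleftrightarrow> x \<in> H"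
  using a_rcos_eq_iff[OF assms M.zero_closed] quot_mod_facts(4)[OF assms(1)] assms(2)
  by (simp add: diff_zero)

end

lemma regular_simps [simp]:
  "carrier (regular \<Lambda>) = carrier \<Lambda>" "\<zero>\<^bsub>regular \<Lambda>\<^esub> = \<zero>\<^bsub>\<Lambda>\<^esub>"
  "x \<oplus>\<^bsub>regular \<Lambda>\<^esub> y = x \<oplus>\<^bsub>\<Lambda>\<^esub> y" "a \<odot>\<^bsub>regular \<Lambda>\<^esub> x = a \<otimes>\<^bsub>\<Lambda>\<^esub> x"
  by (simp_all add: regular_def)

lemma hom_null: "left_module \<Lambda> M \<Longrightarrow> left_module \<Lambda> N \<Longrightarrow> (\<lambda>x. \<zero>\<^bsub>N\<^esub>) \<in> lmod_hom \<Lambda> M N"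
proof (rule lmod_homI)
  assume "left_module \<Lambda> M" "left_module \<Lambda> N"
  then interpret M: left_module \<Lambda> M by simp
  interpret N: left_module \<Lambda> N by fact
  show "\<zero>\<^bsub>N\<^esub> \<in> carrier N" "\<zero>\<^bsub>N\<^esub> = \<zero>\<^bsub>N\<^esub> \<oplus>\<^bsub>N\<^esub> \<zero>\<^bsub>N\<^esub>" by auto
  show "\<zero>\<^bsub>N\<^esub> = a \<odot>\<^bsub>N\<^esub> \<zero>\<^bsub>N\<^esub>" if "a \<in> carrier \<Lambda>" for a using that by simp
qed

lemma hom_plus:
  assumes f: "f \<in> lmod_hom \<Lambda> M N" and g: "g \<in> lmod_hom \<Lambda> M N" and N: "left_module \<Lambda> N"
  shows "(\<lambda>x. f x \<oplus>\<^bsub>N\<^esub> g x) \<in> lmod_hom \<Lambda> M N"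
proof (rule lmod_homI)
  interpret N: left_module \<Lambda> N by fact
  note [simp] = hom_closed[OF f] hom_closed[OF g]
  show "f x \<oplus>\<^bsub>N\<^esub> g x \<in> carrier N" if "x \<in> carrier M" for x using that by simp
  show "f (x \<oplus>\<^bsub>M\<^esub> y) \<oplus>\<^bsub>N\<^esub> g (x \<oplus>\<^bsub>M\<^esub> y) = f x \<oplus>\<^bsub>N\<^esub> g x \<oplus>\<^bsub>N\<^esub> (f y \<oplus>\<^bsub>N\<^esub> g y)"
    if "x \<in> carrier M" "y \<in> carrier M" for x y
    using that by (simp add: hom_add[OF f] hom_add[OF g] N.M.a_ac)
  show "f (a \<odot>\<^bsub>M\<^esub> x) \<oplus>\<^bsub>N\<^esub> g (a \<odot>\<^bsub>M\<^esub> x) = a \<odot>\<^bsub>N\<^esub> (f x \<oplus>\<^bsub>N\<^esub> g x)"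
    if "a \<in> carrier \<Lambda>" "x \<in> carrier M" for a x
    using that by (simp add: hom_smult[OF f] hom_smult[OF g] N.smult_r_distr)
qed

lemma hom_sum:
  assumes M: "left_module \<Lambda> M" and N: "left_module \<Lambda> N"
    and f: "\<And>i. i < n \<Longrightarrow> f i \<in> lmod_hom \<Lambda> M N"
  shows "(\<lambda>x. \<Oplus>\<^bsub>N\<^esub>i\<in>{..<n::nat}. f i x) \<in> lmod_hom \<Lambda> M N"
proof -
  interpret N: left_module \<Lambda> N by fact
  show ?thesis using f
  proof (induction n)
    case 0 then show ?case using hom_null[OF M N] by simp
  next
    case (Suc n)
    have "(\<lambda>x. f n x \<oplus>\<^bsub>N\<^esub> (\<Oplus>\<^bsub>N\<^esub>i\<in>{..<n}. f i x)) \<in> lmod_hom \<Lambda> M N"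
      by (rule hom_plus[OF _ _ N]) (use Suc in auto)
    moreover have "f n x \<oplus>\<^bsub>N\<^esub> (\<Oplus>\<^bsub>N\<^esub>i\<in>{..<n}. f i x) = (\<Oplus>\<^bsub>N\<^esub>i\<in>{..<Suc n}. f i x)"
      if x: "x \<in> carrier M" for x
    proof -
      have "(\<lambda>i. f i x) \<in> {..<n} \<rightarrow> carrier N" "f n x \<in> carrier N"
        using hom_closed[OF Suc.prems x] by auto
      then show ?thesis by (simp add: lessThan_Suc)
    qed
    ultimately show ?case by (rule hom_cong[OF _ M])
  qed
qed

lemma hom_smult_right:
  assumes f: "f \<in> lmod_hom \<Lambda> M (regular \<Lambda>)" and N: "left_module \<Lambda> N" and b: "b \<in> carrier N"
  shows "(\<lambda>x. f x \<odot>\<^bsub>N\<^esub> b) \<in> lmod_hom \<Lambda> M N"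
proof (rule lmod_homI)
  interpret N: left_module \<Lambda> N by fact
  have [simp]: "f x \<in> carrier \<Lambda>" if "x \<in> carrier M" for x using hom_closed[OF f that] by simp
  show "f x \<odot>\<^bsub>N\<^esub> b \<in> carrier N" if "x \<in> carrier M" for x using that b by simp
  show "f (x \<oplus>\<^bsub>M\<^esub> y) \<odot>\<^bsub>N\<^esub> b = f x \<odot>\<^bsub>N\<^esub> b \<oplus>\<^bsub>N\<^esub> f y \<odot>\<^bsub>N\<^esub> b"
    if "x \<in> carrier M" "y \<in> carrier M" for x y
    using that b by (simp add: hom_add[OF f] N.smult_l_distr)
  show "f (a \<odot>\<^bsub>M\<^esub> x) \<odot>\<^bsub>N\<^esub> b = a \<odot>\<^bsub>N\<^esub> (f x \<odot>\<^bsub>N\<^esub> b)"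
    if "a \<in> carrier \<Lambda>" "x \<in> carrier M" for a x
    using that b by (simp add: hom_smult[OF f] N.smult_assoc1)
qed

lemma hom_id: "(\<lambda>x. x) \<in> lmod_hom \<Lambda> M M"
  by (auto simp: lmod_hom_def)

section \<open>Finite powers and generators\<close>

lemma mod_power_simps:
  "carrier (mod_power M n) = {..<n} \<rightarrow>\<^sub>E carrier M"
  "\<zero>\<^bsub>mod_power M n\<^esub> = (\<lambda>i\<in>{..<n}. \<zero>\<^bsub>M\<^esub>)"
  "v \<oplus>\<^bsub>mod_power M n\<^esub> w = (\<lambda>i\<in>{..<n}. v i \<oplus>\<^bsub>M\<^esub> w i)"
  "a \<odot>\<^bsub>mod_power M n\<^esub> v = (\<lambda>i\<in>{..<n}. a \<odot>\<^bsub>M\<^esub> v i)"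
  by (simp_all add: mod_power_def)

lemma mod_power_left_module:
  assumes "left_module \<Lambda> M" shows "left_module \<Lambda> (mod_power M n)"
proof -
  interpret M: left_module \<Lambda> M by fact
  note [simp] = mod_power_simps
  have ag: "abelian_group (mod_power M n)"
  proof (rule abelian_groupI)
    fix v assume "v \<in> carrier (mod_power M n)"
    then show "\<exists>w\<in>carrier (mod_power M n). w \<oplus>\<^bsub>mod_power M n\<^esub> v = \<zero>\<^bsub>mod_power M n\<^esub>"
      by (intro bexI[of _ "\<lambda>i\<in>{..<n}. \<ominus>\<^bsub>M\<^esub> v i"]) (auto simp: M.M.l_neg PiE_iff fun_eq_iff)
  qed (auto simp: M.M.a_ac PiE_iff fun_eq_iff extensional_def)
  show ?thesis
    by (intro left_module.intro ag M.R.ring_axioms left_module_axioms.intro)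
      (auto simp: M.smult_l_distr M.smult_r_distr M.smult_assoc1 PiE_iff fun_eq_iff extensional_def)
qed

lemma mod_power_proj_hom: "i < n \<Longrightarrow> (\<lambda>v. v i) \<in> lmod_hom \<Lambda> (mod_power M n) M"
  by (auto simp: lmod_hom_def mod_power_simps)

lemma lincomb_hom:
  assumes M: "left_module \<Lambda> M" and a: "\<And>i. i < n \<Longrightarrow> a i \<in> carrier M"
  shows "(\<lambda>c. \<Oplus>\<^bsub>M\<^esub>i\<in>{..<n}. c i \<odot>\<^bsub>M\<^esub> a i) \<in> lmod_hom \<Lambda> (mod_power (regular \<Lambda>) n) M"
proof -
  interpret M: left_module \<Lambda> M by fact
  show ?thesis
    by (intro hom_sum mod_power_left_module regular_left_module M.R.ring_axioms M
        hom_smult_right[OF mod_power_proj_hom _ a])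
qed

text \<open>The combinations of a finite family form a submodule that contains the family, so they exhaust the
module as soon as the family generates it.\<close>

lemma fin_gen_lincomb:
  assumes M: "left_module \<Lambda> M" and "fin_gen \<Lambda> M"
  obtains n :: nat and a where "\<forall>i<n. a i \<in> carrier M"
    "(\<lambda>c. \<Oplus>\<^bsub>M\<^esub>i\<in>{..<n}. c i \<odot>\<^bsub>M\<^esub> a i) ` carrier (mod_power (regular \<Lambda>) n) = carrier M"
proof -
  interpret M: left_module \<Lambda> M by fact
  obtain A where A: "finite A" "A \<subseteq> carrier M" "\<And>H. submodule H \<Lambda> M \<Longrightarrow> A \<subseteq> H \<Longrightarrow> H = carrier M"
    using assms(2) by (auto simp: fin_gen_def)
  obtain n a where na: "A = a ` {i::nat. i < n}" using A(1) by (auto simp: finite_conv_nat_seg_image)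
  have a: "a i \<in> carrier M" if "i < n" for i using na A(2) that by auto
  let ?F = "mod_power (regular \<Lambda>) n" and ?L = "\<lambda>c. \<Oplus>\<^bsub>M\<^esub>i\<in>{..<n}. c i \<odot>\<^bsub>M\<^esub> a i"
  have F: "left_module \<Lambda> ?F" by (intro mod_power_left_module regular_left_module M.R.ring_axioms)
  have L: "?L \<in> lmod_hom \<Lambda> ?F M" by (rule lincomb_hom[OF M a])
  have sub: "submodule (?L ` carrier ?F) \<Lambda> M"
    by (rule submodule_image[OF L F M]) (rule left_module.submodule_carrier[OF F])
  have "A \<subseteq> ?L ` carrier ?F"
  proof
    fix x assume "x \<in> A"
    then obtain j where j: "j < n" "x = a j" using na by auto
    let ?c = "\<lambda>i\<in>{..<n}. if j = i then \<one>\<^bsub>\<Lambda>\<^esub> else \<zero>\<^bsub>\<Lambda>\<^esub>"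
    have "?L ?c = (\<Oplus>\<^bsub>M\<^esub>i\<in>{..<n}. if j = i then a i else \<zero>\<^bsub>M\<^esub>)"
      by (rule M.M.finsum_cong') (auto simp: a)
    also have "\<dots> = x" using j a by (subst M.M.finsum_singleton) auto
    finally show "x \<in> ?L ` carrier ?F" by (intro image_eqI[of _ _ ?c]) (auto simp: mod_power_simps)
  qed
  then have "?L ` carrier ?F = carrier M" by (rule A(3)[OF sub])
  then show ?thesis using that a by blast
qed

lemma fin_gen_image:
  assumes f: "f \<in> lmod_hom \<Lambda> M N" and M: "left_module \<Lambda> M" and N: "left_module \<Lambda> N"
    and surj: "f ` carrier M = carrier N" and "fin_gen \<Lambda> M"
  shows "fin_gen \<Lambda> N"
proof -
  obtain A where A: "finite A" "A \<subseteq> carrier M" "\<And>H. submodule H \<Lambda> M \<Longrightarrow> A \<subseteq> H \<Longrightarrow> H = carrier M"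
    using assms(5) by (auto simp: fin_gen_def)
  have "H = carrier N" if H: "submodule H \<Lambda> N" and AH: "f ` A \<subseteq> H" for H
  proof -
    have "{x \<in> carrier M. f x \<in> H} = carrier M"
      by (rule A(3)[OF submodule_vimage[OF f M N H]]) (use A(2) AH in auto)
    then have "f ` carrier M \<subseteq> H" by auto
    then show ?thesis using surj submod_subset[OF H] by auto
  qed
  moreover have "finite (f ` A)" "f ` A \<subseteq> carrier N" using A surj by auto
  ultimately show ?thesis unfolding fin_gen_def by (intro exI[of _ "f ` A"]) auto
qed

section \<open>Transport of structure\<close>

text \<open>Projectivity is tested on modules with elements of type \<^typ>\<open>'a univ\<close>. Modules with other elements
enter such a test through isomorphic copies.\<close>

definition transport :: "('b \<Rightarrow> 'c) \<Rightarrow> ('a, 'b) module \<Rightarrow> ('a, 'c) module" where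
  "transport f M =
     \<lparr>carrier = f ` carrier M, mult = undefined, one = undefined, zero = f \<zero>\<^bsub>M\<^esub>,
      add = \<lambda>x y. f (inv_into (carrier M) f x \<oplus>\<^bsub>M\<^esub> inv_into (carrier M) f y),
      smult = \<lambda>a x. f (a \<odot>\<^bsub>M\<^esub> inv_into (carrier M) f x)\<rparr>"

text \<open>Projectivity is tested on modules with elements of type \<^typ>\<open>'a univ\<close>. Modules with other elements
enter such a test through isomorphic copies.\<close>

lemma transport:
  assumes M: "left_module \<Lambda> M" and inj: "inj_on f (carrier M)"
  shows transport_left_module: "left_module \<Lambda> (transport f M)"
    and transport_hom: "f \<in> lmod_hom \<Lambda> M (transport f M)"
    and transport_bij: "bij_betw f (carrier M) (carrier (transport f M))"
proof -
  have *: "inv_into (carrier M) f (f x) = x" if "x \<in> carrier M" for x using inj that by simp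
  show "left_module \<Lambda> (transport f M)" "f \<in> lmod_hom \<Lambda> M (transport f M)"
    by (rule left_module_image[OF M, of f]; simp add: transport_def *)+
  show "bij_betw f (carrier M) (carrier (transport f M))"
    using inj by (simp add: transport_def bij_betw_def)
qed

text \<open>An element of a finitely generated module is encoded by the set of all its coefficient vectors with
respect to a finite family of generators.\<close>

lemma fin_gen_embeds:
  fixes M :: "('a, 'b) module"
  assumes M: "left_module \<Lambda> M" and "fin_gen \<Lambda> M"
  obtains f :: "'b \<Rightarrow> 'a univ" where "inj_on f (carrier M)"
proof -
  obtain n a where L: "(\<lambda>c. \<Oplus>\<^bsub>M\<^esub>i\<in>{..<n::nat}. c i \<odot>\<^bsub>M\<^esub> a i) ` carrier (mod_power (regular \<Lambda>) n) = carrier M"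
    by (rule fin_gen_lincomb[OF assms])
  let ?L = "\<lambda>c. \<Oplus>\<^bsub>M\<^esub>i\<in>{..<n}. c i \<odot>\<^bsub>M\<^esub> a i" and ?F = "mod_power (regular \<Lambda>) n"
  have "inj_on (\<lambda>x. {c \<in> carrier ?F. ?L c = x}) (carrier M)"
  proof (rule inj_onI)
    fix x y assume "x \<in> carrier M" and eq: "{c \<in> carrier ?F. ?L c = x} = {c \<in> carrier ?F. ?L c = y}"
    then obtain c where "c \<in> carrier ?F" "?L c = x" using L by (metis (no_types, lifting) imageE)
    then have "c \<in> {c \<in> carrier ?F. ?L c = y}" using eq by blast
    then show "x = y" using \<open>?L c = x\<close> by simp
  qed
  then show ?thesis using that by blast
qed

section \<open>Projective modules\<close>

lemma projective_univ_lift: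
  fixes B C :: "('a, 'a univ) module"
  assumes "projective_module \<Lambda> P" "left_module \<Lambda> B" "left_module \<Lambda> C"
    "g \<in> lmod_hom \<Lambda> B C" "g ` carrier B = carrier C" "h \<in> lmod_hom \<Lambda> P C"
  shows "\<exists>k\<in>lmod_hom \<Lambda> P B. \<forall>x\<in>carrier P. g (k x) = h x"
  by (rule assms(1)[unfolded projective_module_def, THEN conjunct2, rule_format, of B C g h])
    (intro conjI assms(2-))

lemma projective_iso:
  assumes P: "projective_module \<Lambda> P" and Q: "left_module \<Lambda> Q" and f: "f \<in> lmod_hom \<Lambda> P Q"
    and bij: "bij_betw f (carrier P) (carrier Q)"
  shows "projective_module \<Lambda> Q"
  unfolding projective_module_def
proof (intro conjI allI impI Q)
  fix B C :: "('a, 'a univ) module" and g h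
  assume *: "left_module \<Lambda> B \<and> left_module \<Lambda> C \<and> g \<in> lmod_hom \<Lambda> B C \<and> g ` carrier B = carrier C \<and>
    h \<in> lmod_hom \<Lambda> Q C"
  have Pm: "left_module \<Lambda> P" using P by (simp add: projective_module_def)
  note inv = hom_inv_into[OF f Pm bij]
  have "(\<lambda>x. h (f x)) \<in> lmod_hom \<Lambda> P C" using * hom_comp[OF f] by blast
  then obtain k where k: "k \<in> lmod_hom \<Lambda> P B" "\<forall>x\<in>carrier P. g (k x) = h (f x)"
    using projective_univ_lift[OF P, of B C g "\<lambda>x. h (f x)"] * by blast
  have "(\<lambda>y. k (inv_into (carrier P) f y)) \<in> lmod_hom \<Lambda> Q B" by (rule hom_comp[OF inv(1) k(1)])
  moreover have "g (k (inv_into (carrier P) f y)) = h y" if "y \<in> carrier Q" for y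
    using that k(2) hom_closed[OF inv(1) that] bij by (simp add: bij_betw_def f_inv_into_f)
  ultimately show "\<exists>k\<in>lmod_hom \<Lambda> Q B. \<forall>x\<in>carrier Q. g (k x) = h x"
    by (intro bexI[of _ "\<lambda>y. k (inv_into (carrier P) f y)"]) auto
qed

text \<open>Lift the identity of \<open>P\<close> along an epimorphism from a free module of finite rank; the coordinates of the
lift are the dual basis. The test for projectivity is applied to copies of both modules.\<close>

lemma dual_basis:
  fixes P :: "('a, 'b) module"
  assumes fg: "fg_left_module \<Lambda> P" and proj: "projective_module \<Lambda> P"
  obtains n :: nat and a \<phi> where "\<forall>i<n. a i \<in> carrier P"
    "\<forall>i<n. \<phi> i \<in> lmod_hom \<Lambda> P (regular \<Lambda>)"
    "\<forall>x\<in>carrier P. x = (\<Oplus>\<^bsub>P\<^esub>i\<in>{..<n}. \<phi> i x \<odot>\<^bsub>P\<^esub> a i)"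
proof -
  have P: "left_module \<Lambda> P" and gen: "fin_gen \<Lambda> P" using fg by (auto simp: fg_left_module_def)
  interpret P: left_module \<Lambda> P by fact
  obtain n :: nat and a where a: "\<forall>i<n. a i \<in> carrier P"
    and surj: "(\<lambda>c. \<Oplus>\<^bsub>P\<^esub>i\<in>{..<n}. c i \<odot>\<^bsub>P\<^esub> a i) ` carrier (mod_power (regular \<Lambda>) n) = carrier P"
    by (rule fin_gen_lincomb[OF P gen])
  let ?L = "\<lambda>c. \<Oplus>\<^bsub>P\<^esub>i\<in>{..<n}. c i \<odot>\<^bsub>P\<^esub> a i" and ?F = "mod_power (regular \<Lambda>) n"
  have F: "left_module \<Lambda> ?F" by (intro mod_power_left_module regular_left_module P.R.ring_axioms)
  have L: "?L \<in> lmod_hom \<Lambda> ?F P" by (rule lincomb_hom[OF P]) (use a in auto)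
  obtain e :: "'b \<Rightarrow> 'a univ" where e: "inj_on e (carrier P)" using fin_gen_embeds[OF P gen] .
  note C = transport[OF P e]
  let ?s = "\<lambda>v :: nat \<Rightarrow> 'a. {v}"
  have s: "inj_on ?s (carrier ?F)" by simp
  note B = transport[OF F s]
  note B' = hom_inv_into[OF B(2) F B(3)]
  let ?r = "inv_into (carrier ?F) ?s"
  let ?g = "\<lambda>y. e (?L (?r y))"
  have g: "?g \<in> lmod_hom \<Lambda> (transport ?s ?F) (transport e P)"
    by (rule hom_comp[OF hom_comp[OF B'(1) L] C(2)])
  have "?g ` carrier (transport ?s ?F) = e ` ?L ` ?r ` carrier (transport ?s ?F)"
    by (simp only: image_image)
  also have "\<dots> = carrier (transport e P)"
    using surj B'(2) C(3) by (simp add: bij_betw_def)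
  finally obtain k where k: "k \<in> lmod_hom \<Lambda> P (transport ?s ?F)" "\<forall>x\<in>carrier P. ?g (k x) = e x"
    using projective_univ_lift[OF proj B(1) C(1) g _ C(2)] by blast
  have rk: "(\<lambda>x. ?r (k x)) \<in> lmod_hom \<Lambda> P ?F" by (rule hom_comp[OF k(1) B'(1)])
  have "x = ?L (?r (k x))" if "x \<in> carrier P" for x
  proof (rule inj_onD[OF e _ that])
    show "e x = e (?L (?r (k x)))" using k(2) that by simp
    show "?L (?r (k x)) \<in> carrier P" by (rule hom_closed[OF L hom_closed[OF rk that]])
  qed
  then show ?thesis
    using a hom_comp[OF rk mod_power_proj_hom] by (intro that[of n a "\<lambda>i x. ?r (k x) i"]) auto
qed

text \<open>With a dual basis \<open>\<phi>\<close>, \<open>a\<close> at hand, a lift of \<open>h\<close> is \<open>x \<mapsto> \<Sum> \<phi>\<^sub>i x \<cdot> b\<^sub>i\<close>, where \<open>g b\<^sub>i = h a\<^sub>i\<close>. It exists for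
target modules with elements of any type.\<close>

lemma projective_lift:
  assumes fg: "fg_left_module \<Lambda> P" and proj: "projective_module \<Lambda> P"
    and B: "left_module \<Lambda> B" and C: "left_module \<Lambda> C"
    and g: "g \<in> lmod_hom \<Lambda> B C" and surj: "g ` carrier B = carrier C" and h: "h \<in> lmod_hom \<Lambda> P C"
  obtains k where "k \<in> lmod_hom \<Lambda> P B" "\<And>x. x \<in> carrier P \<Longrightarrow> g (k x) = h x"
proof -
  have P: "left_module \<Lambda> P" using fg by (auto simp: fg_left_module_def)
  interpret P: left_module \<Lambda> P by fact
  interpret B: left_module \<Lambda> B by fact
  interpret C: left_module \<Lambda> C by fact
  obtain n :: nat and a \<phi> where a: "\<forall>i<n. a i \<in> carrier P"
    and \<phi>: "\<forall>i<n. \<phi> i \<in> lmod_hom \<Lambda> P (regular \<Lambda>)"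
    and x: "\<forall>x\<in>carrier P. x = (\<Oplus>\<^bsub>P\<^esub>i\<in>{..<n}. \<phi> i x \<odot>\<^bsub>P\<^esub> a i)"
    by (rule dual_basis[OF fg proj])
  have "\<forall>i. \<exists>b. i < n \<longrightarrow> b \<in> carrier B \<and> g b = h (a i)"
    using surj hom_closed[OF h] a by (metis imageE)
  then obtain b where b: "\<And>i. i < n \<Longrightarrow> b i \<in> carrier B" "\<And>i. i < n \<Longrightarrow> g (b i) = h (a i)" by metis
  let ?k = "\<lambda>x. \<Oplus>\<^bsub>B\<^esub>i\<in>{..<n}. \<phi> i x \<odot>\<^bsub>B\<^esub> b i"
  have "?k \<in> lmod_hom \<Lambda> P B" by (intro hom_sum P B hom_smult_right \<phi>[rule_format] b)
  moreover have "g (?k x) = h x" if xP: "x \<in> carrier P" for x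
  proof -
    have \<phi>x: "\<phi> i x \<in> carrier \<Lambda>" if "i < n" for i using hom_closed[OF \<phi>[rule_format, OF that] xP] by simp
    have "g (?k x) = (\<Oplus>\<^bsub>C\<^esub>i\<in>{..<n}. g (\<phi> i x \<odot>\<^bsub>B\<^esub> b i))"
      by (rule hom_finsum[OF g B C]) (use \<phi>x b in auto)
    also have "\<dots> = (\<Oplus>\<^bsub>C\<^esub>i\<in>{..<n}. h (\<phi> i x \<odot>\<^bsub>P\<^esub> a i))"
      by (rule C.M.finsum_cong')
        (use \<phi>x a b hom_closed[OF h] in \<open>auto simp: hom_smult[OF g] hom_smult[OF h]\<close>)
    also have "\<dots> = h (\<Oplus>\<^bsub>P\<^esub>i\<in>{..<n}. \<phi> i x \<odot>\<^bsub>P\<^esub> a i)"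
      by (rule hom_finsum[OF h P C, symmetric]) (use \<phi>x a in auto)
    finally show ?thesis using x xP by simp
  qed
  ultimately show ?thesis by (rule that)
qed

section \<open>Simple modules and projective covers\<close>

lemma simple_left_module: "simple_module \<Lambda> T \<Longrightarrow> left_module \<Lambda> T"
  by (simp add: simple_module_def)

lemma simple_cyclic:
  assumes T: "simple_module \<Lambda> T" and t: "t \<in> carrier T" "t \<noteq> \<zero>\<^bsub>T\<^esub>"
  shows "(\<lambda>a. a \<odot>\<^bsub>T\<^esub> t) ` carrier \<Lambda> = carrier T"
proof -
  interpret left_module \<Lambda> T by (rule simple_left_module[OF T])
  have "t \<in> (\<lambda>a. a \<odot>\<^bsub>T\<^esub> t) ` carrier \<Lambda>" using t by (intro image_eqI[of _ _ "\<one>\<^bsub>\<Lambda>\<^esub>"]) auto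
  then show ?thesis using T t(2) submodule_cyclic[OF t(1)] by (auto simp: simple_module_def)
qed

lemma simple_hom_surj:
  assumes T: "simple_module \<Lambda> T" and M: "left_module \<Lambda> M" and g: "g \<in> lmod_hom \<Lambda> M T"
    and x: "x \<in> carrier M" "g x \<noteq> \<zero>\<^bsub>T\<^esub>"
  shows "g ` carrier M = carrier T"
  using T submodule_image[OF g M simple_left_module[OF T] left_module.submodule_carrier[OF M]] x
  by (auto simp: simple_module_def)

lemma projective_coverD:
  assumes "projective_cover \<Lambda> P p X"
  shows "left_module \<Lambda> P" "left_module \<Lambda> X" "fg_left_module \<Lambda> P" "projective_module \<Lambda> P"
    "p \<in> lmod_hom \<Lambda> P X" "p ` carrier P = carrier X"
  using assms by (auto simp: projective_cover_def fg_left_module_def)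

lemma projective_cover_essential:
  assumes "projective_cover \<Lambda> P p X" "submodule H \<Lambda> P"
    and "\<And>x. x \<in> carrier P \<Longrightarrow> \<exists>h\<in>H. p h = p x"
  shows "H = carrier P"
proof -
  have "p ` H = carrier X"
  proof
    show "p ` H \<subseteq> carrier X" using projective_coverD(6)[OF assms(1)] submod_subset[OF assms(2)] by blast
    show "carrier X \<subseteq> p ` H"
    proof
      fix y assume "y \<in> carrier X"
      then obtain x where "x \<in> carrier P" "y = p x" using projective_coverD(6)[OF assms(1)] by blast
      then show "y \<in> p ` H" using assms(3)[of x] by (metis imageI)
    qed
  qed
  then show ?thesis using assms(1,2) by (simp add: projective_cover_def)
qed

text \<open>Otherwise \<open>g\<close> would map the submodule generated by \<open>x\<close> onto \<open>T\<close>, so every element of \<open>P\<close> could be moved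
into the kernel of \<open>g\<close> without changing its image in \<open>X\<close>, and the kernel of \<open>g\<close> would be all of \<open>P\<close>.\<close>

lemma projective_cover_kills_kernel:
  assumes pc: "projective_cover \<Lambda> P p X" and T: "simple_module \<Lambda> T" and g: "g \<in> lmod_hom \<Lambda> P T"
    and x: "x \<in> carrier P" "p x = \<zero>\<^bsub>X\<^esub>"
  shows "g x = \<zero>\<^bsub>T\<^esub>"
proof (rule ccontr)
  assume gx: "g x \<noteq> \<zero>\<^bsub>T\<^esub>"
  note D = projective_coverD[OF pc]
  interpret P: left_module \<Lambda> P by (rule D)
  interpret X: left_module \<Lambda> X by (rule D)
  interpret T: left_module \<Lambda> T by (rule simple_left_module[OF T])
  have "a_kernel P T g = carrier P"
  proof (rule projective_cover_essential[OF pc submodule_kernel[OF g D(1) T.left_module_axioms]])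
    fix y assume y: "y \<in> carrier P"
    obtain a where a: "a \<in> carrier \<Lambda>" "g y = a \<odot>\<^bsub>T\<^esub> g x"
      using simple_cyclic[OF T hom_closed[OF g x(1)] gx] hom_closed[OF g y] by (metis imageE)
    let ?h = "y \<ominus>\<^bsub>P\<^esub> a \<odot>\<^bsub>P\<^esub> x"
    have "?h \<in> carrier P" using x y a by simp
    moreover have "g ?h = \<zero>\<^bsub>T\<^esub>"
      using a x y hom_closed[OF g] hom_diff[OF g D(1) T.left_module_axioms] hom_smult[OF g]
      by (simp add: T.diff_eq_zero)
    moreover have "p ?h = p y"
      using a x y hom_closed[OF D(5)] hom_diff[OF D(5,1,2)] hom_smult[OF D(5)] by (simp add: X.diff_zero)
    ultimately show "\<exists>h\<in>a_kernel P T g. p h = p y" by (intro bexI[of _ ?h]) (auto simp: a_kernel_eq)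
  qed
  then show False using x gx by (auto simp: a_kernel_eq)
qed

text \<open>A lift \<open>\<alpha>\<close> of \<open>e\<close> along \<open>q\<close> is onto because \<open>q\<close> is essential. So it has a section, and the section is
onto because \<open>e\<close> is essential.\<close>

lemma projective_cover_unique:
  assumes Q: "projective_cover \<Lambda> Q q N" and P: "projective_cover \<Lambda> P e N"
  obtains \<alpha> where "\<alpha> \<in> lmod_hom \<Lambda> P Q" "bij_betw \<alpha> (carrier P) (carrier Q)"
    "\<And>x. x \<in> carrier P \<Longrightarrow> q (\<alpha> x) = e x"
proof -
  note D = projective_coverD[OF P] and E = projective_coverD[OF Q]
  interpret P: left_module \<Lambda> P by (rule D)
  interpret Q: left_module \<Lambda> Q by (rule E)
  obtain \<alpha> where \<alpha>: "\<alpha> \<in> lmod_hom \<Lambda> P Q" "\<And>x. x \<in> carrier P \<Longrightarrow> q (\<alpha> x) = e x"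
    using projective_lift[OF D(3,4) E(1,2,5,6) D(5)] by blast
  have surj: "\<alpha> ` carrier P = carrier Q"
  proof (rule projective_cover_essential[OF Q submodule_image[OF \<alpha>(1) D(1) E(1) P.submodule_carrier]])
    fix y assume "y \<in> carrier Q"
    then have "q y \<in> e ` carrier P" using hom_closed[OF E(5)] D(6) by simp
    then show "\<exists>h\<in>\<alpha> ` carrier P. q h = q y" using \<alpha>(2) by force
  qed
  obtain \<beta> where \<beta>: "\<beta> \<in> lmod_hom \<Lambda> Q P" "\<And>y. y \<in> carrier Q \<Longrightarrow> \<alpha> (\<beta> y) = y"
    using projective_lift[OF E(3,4) D(1) E(1) \<alpha>(1) surj hom_id] by blast
  have surj': "\<beta> ` carrier Q = carrier P"
  proof (rule projective_cover_essential[OF P submodule_image[OF \<beta>(1) E(1) D(1) Q.submodule_carrier]])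
    fix x assume x: "x \<in> carrier P"
    have "e (\<beta> (\<alpha> x)) = e x"
      using \<alpha>(2) \<beta>(2) hom_closed[OF \<alpha>(1) x] hom_closed[OF \<beta>(1)] x by metis
    then show "\<exists>h\<in>\<beta> ` carrier Q. e h = e x" using hom_closed[OF \<alpha>(1) x] by blast
  qed
  have "inj_on \<alpha> (carrier P)"
  proof (rule inj_on_inverseI)
    fix x assume "x \<in> carrier P"
    then obtain y where "y \<in> carrier Q" "x = \<beta> y" using surj' by blast
    then show "\<beta> (\<alpha> x) = x" using \<beta>(2) by simp
  qed
  then show ?thesis using that \<alpha> surj by (simp add: bij_betw_def)
qed

lemma projective_cover_iso_source:
  assumes pc: "projective_cover \<Lambda> P p X" and Q: "left_module \<Lambda> Q"
    and f: "f \<in> lmod_hom \<Lambda> P Q" and bij: "bij_betw f (carrier P) (carrier Q)"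
  shows "projective_cover \<Lambda> Q (\<lambda>y. p (inv_into (carrier P) f y)) X"
  unfolding projective_cover_def
proof (intro conjI allI impI)
  note D = projective_coverD[OF pc]
  note inv = hom_inv_into[OF f D(1) bij]
  let ?g = "inv_into (carrier P) f"
  show "fg_left_module \<Lambda> Q"
    using fin_gen_image[OF f D(1) Q] D(3) Q bij by (simp add: fg_left_module_def bij_betw_def)
  show "projective_module \<Lambda> Q" by (rule projective_iso[OF D(4) Q f bij])
  show "left_module \<Lambda> X" by (rule D)
  show "(\<lambda>y. p (?g y)) \<in> lmod_hom \<Lambda> Q X" by (rule hom_comp[OF inv(1) D(5)])
  have "(\<lambda>y. p (?g y)) ` carrier Q = p ` ?g ` carrier Q" by (simp only: image_image)
  then show "(\<lambda>y. p (?g y)) ` carrier Q = carrier X"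
    using inv(2) D(6) by (simp add: bij_betw_def)
  fix H assume H: "submodule H \<Lambda> Q \<and> (\<lambda>y. p (?g y)) ` H = carrier X"
  then have "p ` ?g ` H = carrier X" by (simp only: image_image)
  moreover have "submodule (?g ` H) \<Lambda> P" using submodule_image[OF inv(1) Q D(1)] H by blast
  ultimately have "?g ` H = carrier P" using pc unfolding projective_cover_def by blast
  then have "f ` ?g ` H = carrier Q" using bij by (simp add: bij_betw_def)
  moreover have "f (?g y) = y" if "y \<in> H" for y
    using that H submod_mem[of H \<Lambda> Q y] bij by (simp add: bij_betw_def f_inv_into_f)
  ultimately show "H = carrier Q" by (simp add: image_image)
qed

lemma projective_cover_quot:
  assumes pc: "projective_cover \<Lambda> P p X" and Y: "submodule Y \<Lambda> P" "Y \<subseteq> a_kernel P X p"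
  shows "projective_cover \<Lambda> P (\<lambda>x. Y +>\<^bsub>P\<^esub> x) (quot_mod P Y)"
  unfolding projective_cover_def
proof (intro conjI allI impI)
  note D = projective_coverD[OF pc]
  interpret P: left_module \<Lambda> P by (rule D)
  interpret X: left_module \<Lambda> X by (rule D)
  show "fg_left_module \<Lambda> P" "projective_module \<Lambda> P" by (rule D)+
  show "left_module \<Lambda> (quot_mod P Y)" by (rule P.left_module_quot[OF Y(1)])
  show "(\<lambda>x. Y +>\<^bsub>P\<^esub> x) \<in> lmod_hom \<Lambda> P (quot_mod P Y)" by (rule P.quot_proj_hom[OF Y(1)])
  show "(\<lambda>x. Y +>\<^bsub>P\<^esub> x) ` carrier P = carrier (quot_mod P Y)" by (rule P.quot_mod_facts[OF Y(1)])
  fix H assume H: "submodule H \<Lambda> P \<and> (\<lambda>x. Y +>\<^bsub>P\<^esub> x) ` H = carrier (quot_mod P Y)"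
  show "H = carrier P"
  proof (rule projective_cover_essential[OF pc])
    fix x assume x: "x \<in> carrier P"
    then have "Y +>\<^bsub>P\<^esub> x \<in> (\<lambda>x. Y +>\<^bsub>P\<^esub> x) ` H" using H P.quot_mod_facts(1)[OF Y(1)] by auto
    then obtain h where h: "h \<in> H" "Y +>\<^bsub>P\<^esub> h = Y +>\<^bsub>P\<^esub> x" by auto
    have hP: "h \<in> carrier P" using H h(1) by (auto intro: submod_mem[of H \<Lambda> P])
    have "h \<ominus>\<^bsub>P\<^esub> x \<in> Y" using h(2) P.a_rcos_eq_iff[OF Y(1) hP x] by simp
    then have "p (h \<ominus>\<^bsub>P\<^esub> x) = \<zero>\<^bsub>X\<^esub>" using Y(2) by (auto simp: a_kernel_eq)
    then have "p h = p x"
      using hom_diff[OF D(5,1,2) hP x] hom_closed[OF D(5)] hP x X.diff_eq_zero by metis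
    then show "\<exists>h\<in>H. p h = p x" using h(1) by blast
  qed (use H in blast)
qed

section \<open>Binary products\<close>

definition prod_mod :: "('a, 'b) module \<Rightarrow> ('a, 'c) module \<Rightarrow> ('a, 'b \<times> 'c) module" where
  "prod_mod A B = \<lparr>carrier = carrier A \<times> carrier B, mult = undefined, one = undefined,
     zero = (\<zero>\<^bsub>A\<^esub>, \<zero>\<^bsub>B\<^esub>), add = \<lambda>(x, y) (x', y'). (x \<oplus>\<^bsub>A\<^esub> x', y \<oplus>\<^bsub>B\<^esub> y'),
     smult = \<lambda>a (x, y). (a \<odot>\<^bsub>A\<^esub> x, a \<odot>\<^bsub>B\<^esub> y)\<rparr>"

lemma prod_mod_simps [simp]:
  "carrier (prod_mod A B) = carrier A \<times> carrier B" "\<zero>\<^bsub>prod_mod A B\<^esub> = (\<zero>\<^bsub>A\<^esub>, \<zero>\<^bsub>B\<^esub>)"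
  "(x, y) \<oplus>\<^bsub>prod_mod A B\<^esub> (x', y') = (x \<oplus>\<^bsub>A\<^esub> x', y \<oplus>\<^bsub>B\<^esub> y')"
  "a \<odot>\<^bsub>prod_mod A B\<^esub> (x, y) = (a \<odot>\<^bsub>A\<^esub> x, a \<odot>\<^bsub>B\<^esub> y)"
  by (simp_all add: prod_mod_def)

lemma prod_left_module:
  assumes "left_module \<Lambda> A" "left_module \<Lambda> B" shows "left_module \<Lambda> (prod_mod A B)"
proof -
  interpret A: left_module \<Lambda> A by fact
  interpret B: left_module \<Lambda> B by fact
  have ag: "abelian_group (prod_mod A B)"
  proof (rule abelian_groupI)
    fix v assume "v \<in> carrier (prod_mod A B)"
    then show "\<exists>w\<in>carrier (prod_mod A B). w \<oplus>\<^bsub>prod_mod A B\<^esub> v = \<zero>\<^bsub>prod_mod A B\<^esub>"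
      by (intro bexI[of _ "(\<ominus>\<^bsub>A\<^esub> fst v, \<ominus>\<^bsub>B\<^esub> snd v)"]) (auto simp: A.M.l_neg B.M.l_neg)
  qed (auto simp: A.M.a_ac B.M.a_ac)
  show ?thesis
    by (intro left_module.intro ag A.R.ring_axioms left_module_axioms.intro)
      (auto simp: A.smult_l_distr A.smult_r_distr A.smult_assoc1
        B.smult_l_distr B.smult_r_distr B.smult_assoc1)
qed

lemma prod_injections:
  assumes "left_module \<Lambda> A" "left_module \<Lambda> B"
  shows "(\<lambda>x. (x, \<zero>\<^bsub>B\<^esub>)) \<in> lmod_hom \<Lambda> A (prod_mod A B)"
    and "(\<lambda>y. (\<zero>\<^bsub>A\<^esub>, y)) \<in> lmod_hom \<Lambda> B (prod_mod A B)"
proof -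
  interpret A: left_module \<Lambda> A by fact
  interpret B: left_module \<Lambda> B by fact
  show "(\<lambda>x. (x, \<zero>\<^bsub>B\<^esub>)) \<in> lmod_hom \<Lambda> A (prod_mod A B)"
    "(\<lambda>y. (\<zero>\<^bsub>A\<^esub>, y)) \<in> lmod_hom \<Lambda> B (prod_mod A B)"
    by (auto simp: lmod_hom_def)
qed

lemma prod_projections:
  "fst \<in> lmod_hom \<Lambda> (prod_mod A B) A" "snd \<in> lmod_hom \<Lambda> (prod_mod A B) B"
  by (auto simp: lmod_hom_def)

lemma prod_fin_gen:
  assumes A: "left_module \<Lambda> A" and B: "left_module \<Lambda> B" and "fin_gen \<Lambda> A" "fin_gen \<Lambda> B"
  shows "fin_gen \<Lambda> (prod_mod A B)"
proof -
  interpret A: left_module \<Lambda> A by fact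
  interpret B: left_module \<Lambda> B by fact
  note AB = prod_left_module[OF A B] and inj = prod_injections[OF A B]
  obtain X where X: "finite X" "X \<subseteq> carrier A" "\<And>H. submodule H \<Lambda> A \<Longrightarrow> X \<subseteq> H \<Longrightarrow> H = carrier A"
    using assms(3) by (auto simp: fin_gen_def)
  obtain Y where Y: "finite Y" "Y \<subseteq> carrier B" "\<And>H. submodule H \<Lambda> B \<Longrightarrow> Y \<subseteq> H \<Longrightarrow> H = carrier B"
    using assms(4) by (auto simp: fin_gen_def)
  let ?G = "(\<lambda>x. (x, \<zero>\<^bsub>B\<^esub>)) ` X \<union> (\<lambda>y. (\<zero>\<^bsub>A\<^esub>, y)) ` Y"
  have "H = carrier (prod_mod A B)" if H: "submodule H \<Lambda> (prod_mod A B)" and G: "?G \<subseteq> H" for H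
  proof -
    have "{x \<in> carrier A. (x, \<zero>\<^bsub>B\<^esub>) \<in> H} = carrier A"
      by (rule X(3)[OF submodule_vimage[OF inj(1) A AB H]]) (use X(2) G in auto)
    moreover have "{y \<in> carrier B. (\<zero>\<^bsub>A\<^esub>, y) \<in> H} = carrier B"
      by (rule Y(3)[OF submodule_vimage[OF inj(2) B AB H]]) (use Y(2) G in auto)
    ultimately have *: "(x, \<zero>\<^bsub>B\<^esub>) \<in> H" "(\<zero>\<^bsub>A\<^esub>, y) \<in> H" if "x \<in> carrier A" "y \<in> carrier B" for x y
      using that by blast+
    have "(x, y) \<in> H" if "x \<in> carrier A" "y \<in> carrier B" for x y
      using submod_add[OF H *[OF that]] that by simp
    then show ?thesis using submod_subset[OF H] by auto
  qed
  moreover have "finite ?G" "?G \<subseteq> carrier (prod_mod A B)" using X(1,2) Y(1,2) by auto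
  ultimately show ?thesis unfolding fin_gen_def by (intro exI[of _ ?G]) auto
qed

lemma hom_from_prod:
  assumes A: "left_module \<Lambda> A" and B: "left_module \<Lambda> B" and C: "left_module \<Lambda> C"
    and f: "f \<in> lmod_hom \<Lambda> A C" and g: "g \<in> lmod_hom \<Lambda> B C"
  shows "(\<lambda>z. f (fst z) \<oplus>\<^bsub>C\<^esub> g (snd z)) \<in> lmod_hom \<Lambda> (prod_mod A B) C"
  by (rule hom_plus[OF hom_comp[OF prod_projections(1) f] hom_comp[OF prod_projections(2) g] C])

lemma prod_projective:
  assumes A: "projective_module \<Lambda> A" and B: "projective_module \<Lambda> B"
  shows "projective_module \<Lambda> (prod_mod A B)"
  unfolding projective_module_def
proof (intro conjI allI impI)
  have Am: "left_module \<Lambda> A" and Bm: "left_module \<Lambda> B" using A B by (auto simp: projective_module_def)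
  interpret A: left_module \<Lambda> A by fact
  interpret B: left_module \<Lambda> B by fact
  show "left_module \<Lambda> (prod_mod A B)" by (rule prod_left_module[OF Am Bm])
  fix X Y :: "('a, 'a univ) module" and g h
  assume *: "left_module \<Lambda> X \<and> left_module \<Lambda> Y \<and> g \<in> lmod_hom \<Lambda> X Y \<and> g ` carrier X = carrier Y \<and>
    h \<in> lmod_hom \<Lambda> (prod_mod A B) Y"
  then have X: "left_module \<Lambda> X" and Y: "left_module \<Lambda> Y" and g: "g \<in> lmod_hom \<Lambda> X Y"
    and s: "g ` carrier X = carrier Y" and h: "h \<in> lmod_hom \<Lambda> (prod_mod A B) Y" by auto
  obtain k where k: "k \<in> lmod_hom \<Lambda> A X" "\<forall>x\<in>carrier A. g (k x) = h (x, \<zero>\<^bsub>B\<^esub>)"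
    using projective_univ_lift[OF A X Y g s hom_comp[OF prod_injections(1)[OF Am Bm] h]] by blast
  obtain l where l: "l \<in> lmod_hom \<Lambda> B X" "\<forall>y\<in>carrier B. g (l y) = h (\<zero>\<^bsub>A\<^esub>, y)"
    using projective_univ_lift[OF B X Y g s hom_comp[OF prod_injections(2)[OF Am Bm] h]] by blast
  have "g (k (fst z) \<oplus>\<^bsub>X\<^esub> l (snd z)) = h z" if "z \<in> carrier (prod_mod A B)" for z
  proof -
    obtain x y where z: "z = (x, y)" "x \<in> carrier A" "y \<in> carrier B" using \<open>z \<in> _\<close> by auto
    have "h z = h ((x, \<zero>\<^bsub>B\<^esub>) \<oplus>\<^bsub>prod_mod A B\<^esub> (\<zero>\<^bsub>A\<^esub>, y))" using z by simp
    also have "\<dots> = h (x, \<zero>\<^bsub>B\<^esub>) \<oplus>\<^bsub>Y\<^esub> h (\<zero>\<^bsub>A\<^esub>, y)" by (rule hom_add[OF h]) (use z in auto)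
    also have "\<dots> = g (k (fst z) \<oplus>\<^bsub>X\<^esub> l (snd z))"
      using z k l hom_closed[OF k(1)] hom_closed[OF l(1)] by (simp add: hom_add[OF g])
    finally show ?thesis by simp
  qed
  then show "\<exists>k\<in>lmod_hom \<Lambda> (prod_mod A B) X. \<forall>z\<in>carrier (prod_mod A B). g (k z) = h z"
    by (intro bexI[OF _ hom_from_prod[OF Am Bm X k(1) l(1)]] ballI)
qed

text \<open>Only essentiality needs an argument. Let \<open>H\<close> be mapped onto \<open>U \<oplus> V\<close>. The members of \<open>H\<close> whose
second component dies in \<open>V\<close> still reach all of \<open>U\<close>, so their first components exhaust \<open>A\<close>. Subtracting
such members, one sees that the members of \<open>H\<close> with first component zero reach all of \<open>V\<close>, so \<open>H\<close>
contains \<open>B\<close>, and then also \<open>A\<close>.\<close>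

lemma projective_cover_add:
  fixes M (structure)
  assumes M: "left_module \<Lambda> M" and U: "submodule U \<Lambda> M" and V: "submodule V \<Lambda> M"
    and disj: "U \<inter> V = {\<zero>}"
    and A: "projective_cover \<Lambda> A a (restr M U)" and B: "projective_cover \<Lambda> B b (restr M V)"
  shows "projective_cover \<Lambda> (prod_mod A B) (\<lambda>z. a (fst z) \<oplus> b (snd z)) (restr M (U <+>\<^bsub>M\<^esub> V))"
  unfolding projective_cover_def
proof (intro conjI allI impI)
  note D = projective_coverD[OF A] and E = projective_coverD[OF B]
  interpret M: left_module \<Lambda> M by fact
  interpret A: left_module \<Lambda> A by (rule D)
  interpret B: left_module \<Lambda> B by (rule E)
  let ?d = "\<lambda>z. a (fst z) \<oplus> b (snd z)" and ?P = "prod_mod A B"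
  have a: "a \<in> lmod_hom \<Lambda> A M" by (rule hom_into_restr[OF D(5) submod_subset[OF U]])
  have b: "b \<in> lmod_hom \<Lambda> B M" by (rule hom_into_restr[OF E(5) submod_subset[OF V]])
  have aU: "a x \<in> U" if "x \<in> carrier A" for x using hom_closed[OF D(5) that] by simp
  have bV: "b y \<in> V" if "y \<in> carrier B" for y using hom_closed[OF E(5) that] by simp
  note P = prod_left_module[OF D(1) E(1)]
  interpret P: left_module \<Lambda> ?P by (rule P)
  have UV: "submodule (U <+>\<^bsub>M\<^esub> V) \<Lambda> M" by (rule M.submodule_set_add[OF U V])
  show "left_module \<Lambda> (restr M (U <+>\<^bsub>M\<^esub> V))" by (rule M.left_module_restr[OF UV])
  show "fg_left_module \<Lambda> ?P"
    using P prod_fin_gen[OF D(1) E(1)] D(3) E(3) by (simp add: fg_left_module_def)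
  show "projective_module \<Lambda> ?P" by (rule prod_projective[OF D(4) E(4)])
  show "?d \<in> lmod_hom \<Lambda> ?P (restr M (U <+>\<^bsub>M\<^esub> V))"
    by (rule hom_to_restr[OF hom_from_prod[OF D(1) E(1) M a b]]) (auto intro!: set_addI simp: aU bV)
  show "?d ` carrier ?P = carrier (restr M (U <+>\<^bsub>M\<^esub> V))"
  proof
    show "?d ` carrier ?P \<subseteq> carrier (restr M (U <+>\<^bsub>M\<^esub> V))" by (auto intro!: set_addI simp: aU bV)
    show "carrier (restr M (U <+>\<^bsub>M\<^esub> V)) \<subseteq> ?d ` carrier ?P"
    proof
      fix w assume "w \<in> carrier (restr M (U <+>\<^bsub>M\<^esub> V))"
      then obtain u v where w: "u \<in> U" "v \<in> V" "w = u \<oplus> v" by (auto simp: set_add_eq)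
      then have "u \<in> a ` carrier A" "v \<in> b ` carrier B" using D(6) E(6) by simp_all
      then obtain x y where "x \<in> carrier A" "u = a x" "y \<in> carrier B" "v = b y" by blast
      then show "w \<in> ?d ` carrier ?P" using w by (intro image_eqI[of _ _ "(x, y)"]) auto
    qed
  qed
  fix H assume "submodule H \<Lambda> ?P \<and> ?d ` H = carrier (restr M (U <+>\<^bsub>M\<^esub> V))"
  then have H: "submodule H \<Lambda> ?P" and dH: "?d ` H = U <+>\<^bsub>M\<^esub> V" by auto
  have Hc: "x \<in> carrier A" "y \<in> carrier B" if "(x, y) \<in> H" for x y using submod_mem[OF H that] by auto
  have split: "u = u' \<and> v = v'" if "u \<in> U" "u' \<in> U" "v \<in> V" "v' \<in> V" "u \<oplus> v = u' \<oplus> v'" for u u' v v'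
  proof -
    have c: "u \<in> carrier M" "u' \<in> carrier M" "v \<in> carrier M" "v' \<in> carrier M"
      using that submod_mem[OF U] submod_mem[OF V] by auto
    have "u = (u' \<oplus> v') \<ominus> v" using M.add_diff_cancel[OF c(1,3)] that(5) by simp
    also have "\<dots> = u' \<oplus> (v' \<ominus> v)" using c by (simp add: a_minus_def M.M.a_assoc)
    finally have "u \<ominus> u' = v' \<ominus> v" using c by (metis M.add_diff_cancel' M.M.minus_closed)
    then have "u \<ominus> u' \<in> U \<inter> V" using submod_diff[OF U that(1,2)] submod_diff[OF V that(4,3)] by simp
    then have "u \<ominus> u' = \<zero>" using disj by simp
    then have "u = u'" using c M.diff_eq_zero by simp
    then show ?thesis using that(5) c by simp
  qed
  \<comment> \<open>Every element of \<open>A\<close> is the first component of a member of \<open>H\<close> whose second component lies in the kernel of \<open>b\<close>.\<close>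
  have H1: "\<exists>y\<in>carrier B. b y = \<zero> \<and> (x, y) \<in> H" if "x \<in> carrier A" for x
  proof -
    let ?K = "{z \<in> carrier ?P. b (snd z) \<in> {\<zero>}}"
    have "submodule (H \<inter> ?K) \<Lambda> ?P"
      by (rule P.submodule_Int[OF H submodule_vimage[OF hom_comp[OF prod_projections(2) b] P M M.submodule_null]])
    then have "submodule (fst ` (H \<inter> ?K)) \<Lambda> A"
      by (rule submodule_image[OF prod_projections(1) P D(1)])
    then have "fst ` (H \<inter> ?K) = carrier A"
    proof (rule projective_cover_essential[OF A])
      fix x assume x: "x \<in> carrier A"
      have "a x \<in> ?d ` H" unfolding dH using M.subset_set_add(1)[OF U V] aU[OF x] by auto
      then obtain z where z: "z \<in> H" "a x = a (fst z) \<oplus> b (snd z)" by auto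
      have zc: "fst z \<in> carrier A" "snd z \<in> carrier B" using Hc[of "fst z" "snd z"] z(1) by auto
      have "a x \<oplus> \<zero> = a (fst z) \<oplus> b (snd z)" using z(2) hom_closed[OF a x] by simp
      then have "a x = a (fst z) \<and> \<zero> = b (snd z)"
        by (rule split[OF aU[OF x] aU[OF zc(1)] submod_zero[OF V] bV[OF zc(2)]])
      then show "\<exists>h\<in>fst ` (H \<inter> ?K). a h = a x"
        using z(1) zc submod_mem[OF H z(1)] by (intro bexI[of _ "fst z"] image_eqI[of _ _ z]) auto
    qed
    then have "x \<in> fst ` (H \<inter> ?K)" using that by simp
    then obtain z where "z \<in> H" "b (snd z) = \<zero>" "x = fst z" by auto
    then show ?thesis using Hc[of "fst z" "snd z"] by (intro bexI[of _ "snd z"]) auto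
  qed
  have "{y \<in> carrier B. (\<zero>\<^bsub>A\<^esub>, y) \<in> H} = carrier B"
  proof (rule projective_cover_essential[OF B submodule_vimage[OF prod_injections(2)[OF D(1) E(1)] E(1) P H]])
    fix y assume y: "y \<in> carrier B"
    have "b y \<in> ?d ` H" unfolding dH using M.subset_set_add(2)[OF U V] bV[OF y] by auto
    then obtain z where z: "z \<in> H" "b y = a (fst z) \<oplus> b (snd z)" by auto
    have zc: "fst z \<in> carrier A" "snd z \<in> carrier B" using Hc[of "fst z" "snd z"] z(1) by auto
    have "\<zero> \<oplus> b y = a (fst z) \<oplus> b (snd z)" using z(2) hom_closed[OF b y] by simp
    then have by': "\<zero> = a (fst z) \<and> b y = b (snd z)"
      by (rule split[OF submod_zero[OF U] aU[OF zc(1)] bV[OF y] bV[OF zc(2)]])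
    obtain y' where y': "y' \<in> carrier B" "b y' = \<zero>" "(fst z, y') \<in> H" using H1[OF zc(1)] by blast
    have "z \<ominus>\<^bsub>?P\<^esub> (fst z, y') \<in> H" by (rule submod_diff[OF H z(1) y'(3)])
    moreover have "fst (z \<ominus>\<^bsub>?P\<^esub> (fst z, y')) = \<zero>\<^bsub>A\<^esub>"
      using hom_diff[OF prod_projections(1) P D(1), of z "(fst z, y')"] zc y' submod_mem[OF H z(1)]
      by (simp add: A.diff_eq_zero)
    moreover have "snd (z \<ominus>\<^bsub>?P\<^esub> (fst z, y')) = snd z \<ominus>\<^bsub>B\<^esub> y'"
      using hom_diff[OF prod_projections(2) P E(1), of z "(fst z, y')"] zc y' submod_mem[OF H z(1)] by simp
    ultimately have in_H: "(\<zero>\<^bsub>A\<^esub>, snd z \<ominus>\<^bsub>B\<^esub> y') \<in> H" by (metis prod.collapse)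
    have "b (snd z \<ominus>\<^bsub>B\<^esub> y') = b y"
      using by'[THEN conjunct2] y' zc hom_closed[OF b] by (simp add: hom_diff[OF b E(1) M] M.diff_zero)
    then show "\<exists>h\<in>{y \<in> carrier B. (\<zero>\<^bsub>A\<^esub>, y) \<in> H}. b h = b y"
      using in_H zc y' by (intro bexI[of _ "snd z \<ominus>\<^bsub>B\<^esub> y'"]) auto
  qed
  then have H2: "(\<zero>\<^bsub>A\<^esub>, y) \<in> H" if "y \<in> carrier B" for y using that by blast
  have "(x, y) \<in> H" if xy: "x \<in> carrier A" "y \<in> carrier B" for x y
  proof -
    obtain y' where y': "y' \<in> carrier B" "(x, y') \<in> H" using H1[OF xy(1)] by blast
    have "(x, y') \<oplus>\<^bsub>?P\<^esub> (\<zero>\<^bsub>A\<^esub>, y \<ominus>\<^bsub>B\<^esub> y') \<in> H"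
      by (rule submod_add[OF H y'(2) H2]) (use xy y' in simp)
    then show ?thesis using xy y' by (simp add: B.add_minus_cancel)
  qed
  then show "H = carrier ?P" using submod_subset[OF H] by auto
qed

section \<open>Complements and sums of simple submodules\<close>

lemma set_addE:
  fixes M (structure)
  assumes "x \<in> A <+>\<^bsub>M\<^esub> B" obtains a b where "a \<in> A" "b \<in> B" "x = a \<oplus> b"
  using assms by (auto simp: set_add_eq)

lemma complementary_projection:
  fixes M (structure)
  assumes M: "left_module \<Lambda> M" and AB: "complementary \<Lambda> M A B"
  obtains \<pi> where "\<pi> \<in> lmod_hom \<Lambda> M (restr M A)" "\<forall>x\<in>carrier M. x \<ominus> \<pi> x \<in> B"
    "\<forall>a\<in>A. \<pi> a = a" "\<forall>b\<in>B. \<pi> b = \<zero>"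
proof -
  interpret M: left_module \<Lambda> M by fact
  have A: "submodule A \<Lambda> M" and B: "submodule B \<Lambda> M" and disj: "A \<inter> B = {\<zero>}"
    and sum: "A <+>\<^bsub>M\<^esub> B = carrier M" using AB by (auto simp: complementary_def)
  have ex: "\<exists>a\<in>A. x \<ominus> a \<in> B" if "x \<in> carrier M" for x
  proof -
    have "x \<in> A <+>\<^bsub>M\<^esub> B" using that sum by simp
    then obtain a b where "a \<in> A" "b \<in> B" "x = a \<oplus> b" by (rule set_addE)
    then show ?thesis
      using submod_mem[OF A] submod_mem[OF B] by (intro bexI[of _ a]) (auto simp: M.add_diff_cancel')
  qed
  define \<pi> where "\<pi> x = (SOME a. a \<in> A \<and> x \<ominus> a \<in> B)" for x
  have \<pi>: "\<pi> x \<in> A" "x \<ominus> \<pi> x \<in> B" if "x \<in> carrier M" for x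
    using someI_ex[of "\<lambda>a. a \<in> A \<and> x \<ominus> a \<in> B"] ex[OF that] unfolding \<pi>_def by blast+
  have unique: "\<pi> x = a" if x: "x \<in> carrier M" and a: "a \<in> A" "x \<ominus> a \<in> B" for x a
  proof -
    have c: "a \<in> carrier M" "\<pi> x \<in> carrier M" using a \<pi>(1)[OF x] submod_mem[OF A] by auto
    have "(x \<ominus> a) \<ominus> (x \<ominus> \<pi> x) = \<pi> x \<ominus> a"
    proof -
      have "((x \<ominus> a) \<ominus> (x \<ominus> \<pi> x)) = (\<ominus> x \<oplus> x) \<oplus> (\<pi> x \<ominus> a)"
        using x c by (simp add: a_minus_def M.M.minus_add M.M.a_ac)
      then show ?thesis using x c by (simp add: M.M.l_neg)
    qed
    then have "\<pi> x \<ominus> a \<in> A \<inter> B"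
      using submod_diff[OF A \<pi>(1)[OF x] a(1)] submod_diff[OF B a(2) \<pi>(2)[OF x]] by simp
    then show ?thesis using disj c M.diff_eq_zero by simp
  qed
  have "\<pi> \<in> lmod_hom \<Lambda> M (restr M A)"
  proof (rule lmod_homI)
    show "\<pi> x \<in> carrier (restr M A)" if "x \<in> carrier M" for x using \<pi>(1)[OF that] by simp
  next
    fix x y assume xy: "x \<in> carrier M" "y \<in> carrier M"
    have c: "\<pi> x \<in> carrier M" "\<pi> y \<in> carrier M" using \<pi>(1) xy submod_mem[OF A] by auto
    have "(x \<oplus> y) \<ominus> (\<pi> x \<oplus> \<pi> y) = (x \<ominus> \<pi> x) \<oplus> (y \<ominus> \<pi> y)"
      using xy c by (simp add: a_minus_def M.M.minus_add M.M.a_ac)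
    then show "\<pi> (x \<oplus> y) = \<pi> x \<oplus>\<^bsub>restr M A\<^esub> \<pi> y"
      using unique[of "x \<oplus> y" "\<pi> x \<oplus> \<pi> y"] xy submod_add[OF A \<pi>(1) \<pi>(1)]
        submod_add[OF B \<pi>(2) \<pi>(2)] by simp
  next
    fix a x assume ax: "a \<in> carrier \<Lambda>" "x \<in> carrier M"
    have c: "\<pi> x \<in> carrier M" using \<pi>(1) ax submod_mem[OF A] by auto
    have "a \<odot> x \<ominus> a \<odot> \<pi> x = a \<odot> (x \<ominus> \<pi> x)"
      using ax c by (simp add: M.smult_r_diff)
    then show "\<pi> (a \<odot> x) = a \<odot>\<^bsub>restr M A\<^esub> \<pi> x"
      using unique[of "a \<odot> x" "a \<odot> \<pi> x"] ax submod_smult[OF A ax(1) \<pi>(1)]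
        submod_smult[OF B ax(1) \<pi>(2)] by simp
  qed
  moreover have "\<forall>a\<in>A. \<pi> a = a"
  proof
    fix a assume a: "a \<in> A"
    have c: "a \<in> carrier M" by (rule submod_mem[OF A a])
    have "a \<ominus> a = \<zero>" using M.diff_eq_zero[OF c c] by simp
    then show "\<pi> a = a" using unique[OF c a] submod_zero[OF B] by simp
  qed
  moreover have "\<forall>b\<in>B. \<pi> b = \<zero>"
    using unique submod_mem[OF B] submod_zero[OF A] M.diff_zero by auto
  ultimately show ?thesis using that \<pi>(2) by blast
qed

text \<open>The sums are finite but need not be direct: this makes the notion obviously stable under homomorphic
images, and stability under submodules follows from the existence of complements.\<close>

inductive simples_sum :: "'a ring \<Rightarrow> ('a, 'b) module \<Rightarrow> 'b set \<Rightarrow> bool" for \<Lambda> M where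
  null: "simples_sum \<Lambda> M {\<zero>\<^bsub>M\<^esub>}"
| add: "simples_sum \<Lambda> M U \<Longrightarrow> submodule T \<Lambda> M \<Longrightarrow> simple_module \<Lambda> (restr M T) \<Longrightarrow>
    simples_sum \<Lambda> M (U <+>\<^bsub>M\<^esub> T)"

lemma simples_sum_submodule:
  fixes M (structure)
  assumes "simples_sum \<Lambda> M U" "left_module \<Lambda> M" shows "submodule U \<Lambda> M"
proof -
  interpret left_module \<Lambda> M by fact
  show ?thesis using assms(1) by induction (auto intro: submodule_null submodule_set_add)
qed

lemma simple_submodule_meet:
  fixes M (structure)
  assumes M: "left_module \<Lambda> M" and T: "submodule T \<Lambda> M" "simple_module \<Lambda> (restr M T)"
    and K: "submodule K \<Lambda> M"
  shows "T \<subseteq> K \<or> K \<inter> T = {\<zero>}"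
proof -
  interpret left_module \<Lambda> M by fact
  have "submodule (K \<inter> T) \<Lambda> (restr M T)"
    using submodule_Int[OF K T(1)] submodule_restr_iff[OF T(1)] by blast
  then have "K \<inter> T = {\<zero>} \<or> K \<inter> T = T" using T(2) by (auto simp: simple_module_def)
  then show ?thesis by blast
qed

lemma set_add_least: "submodule K \<Lambda> M \<Longrightarrow> U \<subseteq> K \<Longrightarrow> V \<subseteq> K \<Longrightarrow> U <+>\<^bsub>M\<^esub> V \<subseteq> K"
  by (auto simp: set_add_eq submod_add subset_iff)

text \<open>Go through the simple summands one by one and keep those that are not contained in the sum of \<open>K\<close> and the
ones kept before.\<close>

lemma simples_sum_complement:
  fixes M (structure)
  assumes "simples_sum \<Lambda> M U" and M: "left_module \<Lambda> M" and K: "submodule K \<Lambda> M"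
  shows "\<exists>B. simples_sum \<Lambda> M B \<and> B \<subseteq> U \<and> K \<inter> B = {\<zero>} \<and> U \<subseteq> K <+>\<^bsub>M\<^esub> B"
  using assms(1)
proof induction
  interpret M: left_module \<Lambda> M by fact
  case null
  show ?case
    using simples_sum.null[of \<Lambda> M] submod_zero[OF K] submod_zero[OF M.submodule_set_add[OF K M.submodule_null]]
    by (intro exI[of _ "{\<zero>}"]) auto
next
  interpret M: left_module \<Lambda> M by fact
  case (add U T)
  note U = simples_sum_submodule[OF add.hyps(1) M] and T = add.hyps(2,3)
  obtain B where B: "simples_sum \<Lambda> M B" "B \<subseteq> U" "K \<inter> B = {\<zero>}" "U \<subseteq> K <+>\<^bsub>M\<^esub> B"
    using add.IH by blast
  note Bs = simples_sum_submodule[OF B(1) M]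
  note KB = M.submodule_set_add[OF K Bs]
  from simple_submodule_meet[OF M T KB] show ?case
  proof
    assume "T \<subseteq> K <+>\<^bsub>M\<^esub> B"
    then have "U <+>\<^bsub>M\<^esub> T \<subseteq> K <+>\<^bsub>M\<^esub> B" using set_add_least[OF KB B(4)] by blast
    then show ?thesis using B M.subset_set_add(1)[OF U T(1)] by (intro exI[of _ B]) auto
  next
    assume disj: "(K <+>\<^bsub>M\<^esub> B) \<inter> T = {\<zero>}"
    let ?B = "B <+>\<^bsub>M\<^esub> T"
    note BT = M.submodule_set_add[OF Bs T(1)]
    note KBT = M.submodule_set_add[OF K BT]
    have "k = \<zero>" if k: "k \<in> K" "k \<in> ?B" for k
    proof -
      obtain b t where bt: "b \<in> B" "t \<in> T" "k = b \<oplus> t" using k(2) by (auto simp: set_add_eq)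
      have c: "b \<in> carrier M" "t \<in> carrier M" "k \<in> carrier M"
        using bt k submod_mem[OF Bs] submod_mem[OF T(1)] submod_mem[OF K] by auto
      have "t = k \<ominus> b" using c bt(3) M.add_diff_cancel' by simp
      also have "\<dots> \<in> K <+>\<^bsub>M\<^esub> B"
        unfolding a_minus_def by (rule set_addI[OF k(1) submod_minus[OF Bs bt(1)]])
      finally have "t = \<zero>" using disj bt(2) by blast
      then have "k \<in> K \<inter> B" using k(1) bt c by simp
      then show ?thesis using B(3) by blast
    qed
    then have "K \<inter> ?B = {\<zero>}" using submod_zero[OF K] submod_zero[OF BT] by blast
    moreover have "K <+>\<^bsub>M\<^esub> B \<subseteq> K <+>\<^bsub>M\<^esub> ?B"
      using set_add_least[OF KBT M.subset_set_add(1)[OF K BT]] M.subset_set_add(1)[OF Bs T(1)]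
        M.subset_set_add(2)[OF K BT] by blast
    moreover have "T \<subseteq> K <+>\<^bsub>M\<^esub> ?B"
      using M.subset_set_add(2)[OF Bs T(1)] M.subset_set_add(2)[OF K BT] by blast
    ultimately have "U <+>\<^bsub>M\<^esub> T \<subseteq> K <+>\<^bsub>M\<^esub> ?B" "K \<inter> ?B = {\<zero>}"
      using set_add_least[OF KBT, of U T] B(4) by auto
    moreover have "?B \<subseteq> U <+>\<^bsub>M\<^esub> T"
      using set_add_least[OF M.submodule_set_add[OF U T(1)], of B T] B(2)
        M.subset_set_add[OF U T(1)] by blast
    moreover have "simples_sum \<Lambda> M ?B" by (rule simples_sum.add[OF B(1) T])
    ultimately show ?thesis by blast
  qed
qed

lemma simples_sum_image:
  assumes f: "f \<in> lmod_hom \<Lambda> M N" and M: "left_module \<Lambda> M" and N: "left_module \<Lambda> N"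
    and "simples_sum \<Lambda> M U"
  shows "simples_sum \<Lambda> N (f ` U)"
  using assms(4)
proof induction
  case null then show ?case using hom_zero[OF f M N] simples_sum.null[of \<Lambda> N] by simp
next
  interpret M: left_module \<Lambda> M by fact
  interpret N: left_module \<Lambda> N by fact
  case (add U T)
  note U = simples_sum_submodule[OF add.hyps(1) M] and T = add.hyps(2,3)
  note fU = submodule_image[OF f M N U] and fT = submodule_image[OF f M N T(1)]
  have eq: "f ` (U <+>\<^bsub>M\<^esub> T) = f ` U <+>\<^bsub>N\<^esub> f ` T"
  proof
    show "f ` (U <+>\<^bsub>M\<^esub> T) \<subseteq> f ` U <+>\<^bsub>N\<^esub> f ` T"
    proof
      fix y assume "y \<in> f ` (U <+>\<^bsub>M\<^esub> T)"
      then obtain u t where ut: "u \<in> U" "t \<in> T" "y = f (u \<oplus>\<^bsub>M\<^esub> t)" by (auto simp: set_add_eq)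
      then have "y = f u \<oplus>\<^bsub>N\<^esub> f t" using submod_mem[OF U] submod_mem[OF T(1)] by (simp add: hom_add[OF f])
      then show "y \<in> f ` U <+>\<^bsub>N\<^esub> f ` T" using ut by (blast intro: set_addI)
    qed
    show "f ` U <+>\<^bsub>N\<^esub> f ` T \<subseteq> f ` (U <+>\<^bsub>M\<^esub> T)"
    proof
      fix y assume "y \<in> f ` U <+>\<^bsub>N\<^esub> f ` T"
      then obtain u t where ut: "u \<in> U" "t \<in> T" "y = f u \<oplus>\<^bsub>N\<^esub> f t" by (auto simp: set_add_eq)
      then have "y = f (u \<oplus>\<^bsub>M\<^esub> t)"
        using submod_mem[OF U] submod_mem[OF T(1)] by (simp add: hom_add[OF f])
      then show "y \<in> f ` (U <+>\<^bsub>M\<^esub> T)" using ut by (blast intro: set_addI)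
    qed
  qed
  show ?case
  proof (cases "T \<subseteq> a_kernel M N f")
    case True
    then have "f ` T \<subseteq> {\<zero>\<^bsub>N\<^esub>}" by (auto simp: a_kernel_eq)
    moreover have "{\<zero>\<^bsub>N\<^esub>} \<subseteq> f ` U" using submod_zero[OF fU] by simp
    ultimately have "f ` T \<subseteq> f ` U" by (rule order_trans)
    then have "f ` (U <+>\<^bsub>M\<^esub> T) = f ` U"
      unfolding eq by (intro subset_antisym set_add_least[OF fU] N.subset_set_add(1)[OF fU fT]) auto
    then show ?thesis using add.IH by simp
  next
    case False
    have "simple_module \<Lambda> (restr N (f ` T))"
      unfolding simple_module_def
    proof (intro conjI allI impI)
      show "left_module \<Lambda> (restr N (f ` T))" by (rule N.left_module_restr[OF fT])
      obtain t where "t \<in> T" "f t \<noteq> \<zero>\<^bsub>N\<^esub>" using False submod_mem[OF T(1)] by (auto simp: a_kernel_eq)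
      then show "carrier (restr N (f ` T)) \<noteq> {\<zero>\<^bsub>restr N (f ` T)\<^esub>}" by auto
      fix H assume "submodule H \<Lambda> (restr N (f ` T))"
      then have H: "submodule H \<Lambda> N" "H \<subseteq> f ` T" using N.submodule_restr_iff[OF fT] by auto
      have "T \<subseteq> {x \<in> carrier M. f x \<in> H} \<or> {x \<in> carrier M. f x \<in> H} \<inter> T = {\<zero>\<^bsub>M\<^esub>}"
        by (rule simple_submodule_meet[OF M T submodule_vimage[OF f M N H(1)]])
      then show "H = {\<zero>\<^bsub>restr N (f ` T)\<^esub>} \<or> H = carrier (restr N (f ` T))"
      proof
        assume "T \<subseteq> {x \<in> carrier M. f x \<in> H}" then show ?thesis using H(2) by auto
      next
        assume *: "{x \<in> carrier M. f x \<in> H} \<inter> T = {\<zero>\<^bsub>M\<^esub>}"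
        have "y = \<zero>\<^bsub>N\<^esub>" if y: "y \<in> H" for y
        proof -
          obtain t where t: "t \<in> T" "y = f t" using H(2) y by blast
          then have "t \<in> {x \<in> carrier M. f x \<in> H} \<inter> T" using y submod_mem[OF T(1)] by auto
          then have "t = \<zero>\<^bsub>M\<^esub>" using * by blast
          then show ?thesis using t(2) hom_zero[OF f M N] by simp
        qed
        then have "H = {\<zero>\<^bsub>N\<^esub>}" using submod_zero[OF H(1)] by blast
        then show ?thesis by simp
      qed
    qed
    then show ?thesis unfolding eq by (rule simples_sum.add[OF add.IH fT])
  qed
qed

lemma set_add_restr [simp]: "A <+>\<^bsub>restr M V\<^esub> B = A <+>\<^bsub>M\<^esub> B"
  by (simp add: set_add_eq)

lemma simples_sum_restr:
  fixes M (structure)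
  assumes "simples_sum \<Lambda> M U" and M: "left_module \<Lambda> M" and V: "submodule V \<Lambda> M" and "U \<subseteq> V"
  shows "simples_sum \<Lambda> (restr M V) U"
  using assms(1,4)
proof induction
  case null then show ?case using simples_sum.null[of \<Lambda> "restr M V"] by simp
next
  interpret M: left_module \<Lambda> M by fact
  case (add U T)
  note U = simples_sum_submodule[OF add.hyps(1) M] and T = add.hyps(2,3)
  have "U \<subseteq> V" "T \<subseteq> V" using add.prems M.subset_set_add[OF U T(1)] by auto
  then have "simples_sum \<Lambda> (restr M V) (U <+>\<^bsub>restr M V\<^esub> T)"
    using T by (intro simples_sum.add add.IH) (auto simp: M.submodule_restr_iff[OF V])
  then show ?case by simp
qed

text \<open>By complements, a submodule is also a homomorphic image.\<close>

lemma simples_sum_subset: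
  fixes M (structure)
  assumes U: "simples_sum \<Lambda> M U" and M: "left_module \<Lambda> M" and K: "submodule K \<Lambda> M" and KU: "K \<subseteq> U"
  shows "simples_sum \<Lambda> M K"
proof -
  interpret M: left_module \<Lambda> M by fact
  obtain B where B: "simples_sum \<Lambda> M B" "B \<subseteq> U" "K \<inter> B = {\<zero>}" "U \<subseteq> K <+>\<^bsub>M\<^esub> B"
    using simples_sum_complement[OF U M K] by blast
  note Us = simples_sum_submodule[OF U M] and Bs = simples_sum_submodule[OF B(1) M]
  note MU = M.left_module_restr[OF Us]
  have "K <+>\<^bsub>M\<^esub> B = U" using B(4) set_add_least[OF Us KU B(2)] by blast
  then have "complementary \<Lambda> (restr M U) K B"
    using K Bs KU B(2,3) by (simp add: complementary_def M.submodule_restr_iff[OF Us])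
  then obtain \<pi> where \<pi>: "\<pi> \<in> lmod_hom \<Lambda> (restr M U) (restr (restr M U) K)" "\<forall>a\<in>K. \<pi> a = a"
    by (rule complementary_projection[OF MU])
  have \<pi>M: "\<pi> \<in> lmod_hom \<Lambda> (restr M U) M" using \<pi>(1) hom_into_restr[OF _ submod_subset[OF K]] by simp
  have "\<pi> ` U = K" using hom_closed[OF \<pi>(1)] \<pi>(2) KU by force
  then show ?thesis
    using simples_sum_image[OF \<pi>M MU M simples_sum_restr[OF U M Us]] by simp
qed

lemma submod_finsum:
  fixes M (structure)
  assumes M: "left_module \<Lambda> M" and H: "submodule H \<Lambda> M" and "\<And>i. i < n \<Longrightarrow> f i \<in> H"
  shows "(\<Oplus>i\<in>{..<n::nat}. f i) \<in> H"
  using assms(3)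
proof (induction n)
  interpret M: left_module \<Lambda> M by fact
  case 0 then show ?case using submod_zero[OF H] by simp
next
  interpret M: left_module \<Lambda> M by fact
  case (Suc n)
  then have "f \<in> {..<n} \<rightarrow> carrier M" "f n \<in> carrier M" using submod_mem[OF H] by auto
  then show ?case using Suc by (simp add: lessThan_Suc submod_add[OF H])
qed

lemma semisimple_simples_sum:
  fixes M (structure)
  assumes "semisimple_module \<Lambda> M" shows "simples_sum \<Lambda> M (carrier M)"
proof -
  have M: "left_module \<Lambda> M" using assms by (simp add: semisimple_module_def)
  interpret M: left_module \<Lambda> M by fact
  obtain n N where ids: "internal_direct_sum \<Lambda> M n N"
    and simple: "\<forall>i<n. simple_module \<Lambda> (restr M (N i))"
    using assms unfolding semisimple_module_def by blast
  have N: "submodule (N i) \<Lambda> M" "simple_module \<Lambda> (restr M (N i))" if "i < n" for i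
    using ids simple that by (simp_all add: internal_direct_sum_def)
  have sum: "\<exists>f. f \<in> (\<Pi>\<^sub>E i\<in>{..<n}. N i) \<and> x = (\<Oplus>i\<in>{..<n}. f i)" if "x \<in> carrier M" for x
    using ids[unfolded internal_direct_sum_def, THEN conjunct2] that by (blast dest: ex1_implies_ex)
  have "\<exists>U. simples_sum \<Lambda> M U \<and> (\<forall>i<k. N i \<subseteq> U)" if "k \<le> n" for k
    using that
  proof (induction k)
    case 0 then show ?case using simples_sum.null[of \<Lambda> M] by blast
  next
    case (Suc k)
    then obtain U where U: "simples_sum \<Lambda> M U" "\<forall>i<k. N i \<subseteq> U" by auto
    have k: "k < n" using Suc by simp
    note s = M.subset_set_add[OF simples_sum_submodule[OF U(1) M] N(1)[OF k]]
    have "simples_sum \<Lambda> M (U <+>\<^bsub>M\<^esub> N k)" by (rule simples_sum.add[OF U(1) N[OF k]])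
    moreover have "\<forall>i<Suc k. N i \<subseteq> U <+>\<^bsub>M\<^esub> N k" using s U(2) less_Suc_eq by auto
    ultimately show ?case by blast
  qed
  from this[of n] obtain U where U: "simples_sum \<Lambda> M U" "\<forall>i<n. N i \<subseteq> U" by blast
  note Us = simples_sum_submodule[OF U(1) M]
  have "x \<in> U" if x: "x \<in> carrier M" for x
  proof -
    obtain f where f: "f \<in> (\<Pi>\<^sub>E i\<in>{..<n}. N i)" "x = (\<Oplus>i\<in>{..<n}. f i)" using sum[OF x] by blast
    show ?thesis unfolding f(2) by (rule submod_finsum[OF M Us]) (use f(1) U(2) in auto)
  qed
  then have "U = carrier M" using submod_subset[OF Us] by blast
  then show ?thesis using U(1) by simp
qed

lemma simples_sum_hom_nonzero:
  assumes "simples_sum \<Lambda> M U" and M: "left_module \<Lambda> M" and N: "left_module \<Lambda> N"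
    and q: "q \<in> lmod_hom \<Lambda> M N" and "\<exists>u\<in>U. q u \<noteq> \<zero>\<^bsub>N\<^esub>"
  shows "\<exists>T. submodule T \<Lambda> M \<and> simple_module \<Lambda> (restr M T) \<and> T \<subseteq> U \<and> (\<exists>t\<in>T. q t \<noteq> \<zero>\<^bsub>N\<^esub>)"
  using assms(1,5)
proof induction
  case null then show ?case using hom_zero[OF q M N] by simp
next
  interpret M: left_module \<Lambda> M by fact
  interpret N: left_module \<Lambda> N by fact
  case (add U T)
  note U = simples_sum_submodule[OF add.hyps(1) M] and T = add.hyps(2,3)
  show ?case
  proof (cases "\<exists>t\<in>T. q t \<noteq> \<zero>\<^bsub>N\<^esub>")
    case True then show ?thesis using T M.subset_set_add[OF U T(1)] by blast
  next
    case False
    obtain u t where ut: "u \<in> U" "t \<in> T" "q (u \<oplus>\<^bsub>M\<^esub> t) \<noteq> \<zero>\<^bsub>N\<^esub>" using add.prems by (auto simp: set_add_eq)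
    then have "q u \<noteq> \<zero>\<^bsub>N\<^esub>"
      using False submod_mem[OF U] submod_mem[OF T(1)] by (auto simp: hom_add[OF q])
    then show ?thesis using add.IH ut(1) M.subset_set_add(1)[OF U T(1)] by blast
  qed
qed

text \<open>One of the simple summands of \<open>M\<close> is not killed by \<open>q\<close>; it is mapped isomorphically onto \<open>T\<close> and is
therefore a complement of the kernel.\<close>

lemma simple_quotient_splits:
  fixes M (structure)
  assumes M: "left_module \<Lambda> M" and ss: "simples_sum \<Lambda> M (carrier M)" and T: "simple_module \<Lambda> T"
    and q: "q \<in> lmod_hom \<Lambda> M T" and nz: "\<exists>x\<in>carrier M. q x \<noteq> \<zero>\<^bsub>T\<^esub>"
  obtains N where "complementary \<Lambda> M N (a_kernel M T q)" "q \<in> lmod_hom \<Lambda> (restr M N) T"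
    "bij_betw q N (carrier T)"
proof -
  interpret M: left_module \<Lambda> M by fact
  note Tm = simple_left_module[OF T]
  interpret T: left_module \<Lambda> T by (rule Tm)
  obtain N where N: "submodule N \<Lambda> M" "simple_module \<Lambda> (restr M N)" "\<exists>t\<in>N. q t \<noteq> \<zero>\<^bsub>T\<^esub>"
    using simples_sum_hom_nonzero[OF ss M Tm q nz] by blast
  note K = submodule_kernel[OF q M Tm] and Nm = M.left_module_restr[OF N(1)]
  have qN: "q \<in> lmod_hom \<Lambda> (restr M N) T" by (rule hom_from_restr[OF q submod_subset[OF N(1)]])
  have img: "q ` N = carrier T" using simple_hom_surj[OF T Nm qN] N(3) by auto
  have disj: "a_kernel M T q \<inter> N = {\<zero>}"
    using simple_submodule_meet[OF M N(1,2) K] N(3) by (auto simp: a_kernel_eq)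
  then have "inj_on q N"
    using hom_inj_iff[OF qN Nm Tm] submod_mem[OF N(1)] by (auto simp: a_kernel_eq)
  then have bij: "bij_betw q N (carrier T)" using img by (simp add: bij_betw_def)
  have "x \<in> N <+>\<^bsub>M\<^esub> a_kernel M T q" if x: "x \<in> carrier M" for x
  proof -
    obtain y where y: "y \<in> N" "q y = q x" using img hom_closed[OF q x] by (metis imageE)
    have yM: "y \<in> carrier M" by (rule submod_mem[OF N(1) y(1)])
    have "x \<ominus> y \<in> a_kernel M T q"
      using x yM y(2) hom_closed[OF q] by (auto simp: a_kernel_eq hom_diff[OF q M Tm] T.diff_eq_zero)
    then show ?thesis using set_addI[OF y(1)] M.add_minus_cancel[OF x yM] by metis
  qed
  then have "N <+>\<^bsub>M\<^esub> a_kernel M T q = carrier M"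
    using submod_subset[OF M.submodule_set_add[OF N(1) K]] by blast
  then have "complementary \<Lambda> M N (a_kernel M T q)"
    using N(1) K disj by (auto simp: complementary_def)
  then show ?thesis using that qN bij by blast
qed

lemma direct_summand_simple_quotient:
  assumes M: "left_module \<Lambda> M" and ss: "simples_sum \<Lambda> M (carrier M)" and T: "simple_module \<Lambda> T"
    and q: "q \<in> lmod_hom \<Lambda> M T" and nz: "\<exists>x\<in>carrier M. q x \<noteq> \<zero>\<^bsub>T\<^esub>"
  shows "direct_summand \<Lambda> T M"
proof -
  interpret M: left_module \<Lambda> M by fact
  obtain N where N: "complementary \<Lambda> M N (a_kernel M T q)" "q \<in> lmod_hom \<Lambda> (restr M N) T"
    "bij_betw q N (carrier T)" using simple_quotient_splits[OF assms] .
  have "left_module \<Lambda> (restr M N)" using N(1) M.left_module_restr by (simp add: complementary_def)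
  then have "lmod_iso \<Lambda> T (restr M N)" using hom_inv_into[OF N(2)] N(3) unfolding lmod_iso_def by auto
  then show ?thesis using N(1) unfolding direct_summand_def by blast
qed

text \<open>Split \<open>M = N \<oplus> ker q\<close> with \<open>N\<close> isomorphic to \<open>T\<close>. Since \<open>X\<close> lies in the kernel, the modular law gives
\<open>ker q = X \<oplus> (Y \<inter> ker q)\<close>, so \<open>N \<oplus> X\<close> is a summand of \<open>M\<close>.\<close>

lemma direct_summand_power_Suc:
  fixes M (structure)
  assumes M: "left_module \<Lambda> M" and ss: "simples_sum \<Lambda> M (carrier M)" and T: "simple_module \<Lambda> T"
    and q: "q \<in> lmod_hom \<Lambda> M T" and nz: "\<exists>x\<in>carrier M. q x \<noteq> \<zero>\<^bsub>T\<^esub>"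
    and XY: "complementary \<Lambda> M X Y" and qX: "\<forall>x\<in>X. q x = \<zero>\<^bsub>T\<^esub>"
    and iso: "lmod_iso \<Lambda> (mod_power T m) (restr M X)"
  shows "direct_summand \<Lambda> (mod_power T (Suc m)) M"
proof -
  interpret M: left_module \<Lambda> M by fact
  note Tm = simple_left_module[OF T]
  interpret T: left_module \<Lambda> T by (rule Tm)
  obtain N where N: "complementary \<Lambda> M N (a_kernel M T q)" "q \<in> lmod_hom \<Lambda> (restr M N) T"
    "bij_betw q N (carrier T)" using simple_quotient_splits[OF M ss T q nz] .
  let ?L = "a_kernel M T q"
  have X: "submodule X \<Lambda> M" and Y: "submodule Y \<Lambda> M" and XY0: "X \<inter> Y = {\<zero>}"
    and XY1: "X <+>\<^bsub>M\<^esub> Y = carrier M" using XY by (auto simp: complementary_def)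
  have Ns: "submodule N \<Lambda> M" and L: "submodule ?L \<Lambda> M" and NL0: "N \<inter> ?L = {\<zero>}"
    and NL1: "N <+>\<^bsub>M\<^esub> ?L = carrier M" using N(1) by (auto simp: complementary_def)
  have XL: "X \<subseteq> ?L" using qX submod_mem[OF X] by (auto simp: a_kernel_eq)
  let ?A = "N <+>\<^bsub>M\<^esub> X" and ?B = "Y \<inter> ?L"
  note A = M.submodule_set_add[OF Ns X] and B = M.submodule_Int[OF Y L]
  have NX: "n = \<zero>" if "n \<in> N" "n \<in> ?L" for n using that NL0 by blast
  have "complementary \<Lambda> M ?A ?B"
    unfolding complementary_def
  proof (intro conjI A B)
    have "z = \<zero>" if z: "z \<in> ?A" "z \<in> ?B" for z
    proof -
      obtain n x where nx: "n \<in> N" "x \<in> X" "z = n \<oplus> x" using z(1) by (auto simp: set_add_eq)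
      have c: "n \<in> carrier M" "x \<in> carrier M" using nx submod_mem[OF Ns] submod_mem[OF X] by auto
      have "n = z \<ominus> x" using nx(3) c M.add_diff_cancel by simp
      also have "\<dots> \<in> ?L" using submod_diff[OF L, of z x] z(2) nx(2) XL by blast
      finally have "n = \<zero>" using NX nx(1) by blast
      then have "z \<in> X \<inter> Y" using nx c z by auto
      then show ?thesis using XY0 by blast
    qed
    then show "?A \<inter> ?B = {\<zero>}" using submod_zero[OF A] submod_zero[OF B] by blast
    have "w \<in> ?A <+>\<^bsub>M\<^esub> ?B" if w: "w \<in> carrier M" for w
    proof -
      have "w \<in> N <+>\<^bsub>M\<^esub> ?L" using w NL1 by simp
      then obtain n l where nl: "n \<in> N" "l \<in> ?L" "w = n \<oplus> l" by (rule set_addE)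
      have lM: "l \<in> carrier M" and nM: "n \<in> carrier M" using nl submod_mem[OF L] submod_mem[OF Ns] by auto
      have "l \<in> X <+>\<^bsub>M\<^esub> Y" using lM XY1 by simp
      then obtain x y where xy: "x \<in> X" "y \<in> Y" "l = x \<oplus> y" by (rule set_addE)
      have c: "x \<in> carrier M" "y \<in> carrier M" using xy submod_mem[OF X] submod_mem[OF Y] by auto
      have "y = l \<ominus> x" using xy(3) c M.add_diff_cancel' by simp
      also have "\<dots> \<in> ?L" using submod_diff[OF L nl(2)] xy(1) XL by blast
      finally have "y \<in> ?B" using xy(2) by blast
      moreover have "w = (n \<oplus> x) \<oplus> y" using nl(3) xy(3) nM c by (simp add: M.M.a_assoc)
      ultimately show ?thesis using set_addI[OF set_addI[OF nl(1) xy(1)]] by metis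
    qed
    then show "?A <+>\<^bsub>M\<^esub> ?B = carrier M" using submod_subset[OF M.submodule_set_add[OF A B]] by blast
  qed
  moreover have "lmod_iso \<Lambda> (mod_power T (Suc m)) (restr M ?A)"
  proof -
    obtain \<theta> where \<theta>: "\<theta> \<in> lmod_hom \<Lambda> (mod_power T m) (restr M X)"
      and \<theta>b: "bij_betw \<theta> (carrier (mod_power T m)) X" using iso unfolding lmod_iso_def by auto
    note Nm = M.left_module_restr[OF Ns]
    have Nb: "bij_betw q (carrier (restr M N)) (carrier T)" using N(3) by simp
    note \<nu> = hom_inv_into[OF N(2) Nm Nb]
    let ?\<nu> = "inv_into N q" and ?r = "\<lambda>v. restrict v {..<m}"
    have \<nu>1: "?\<nu> \<in> lmod_hom \<Lambda> T M" using hom_into_restr[OF \<nu>(1) submod_subset[OF Ns]] by simp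
    have \<nu>N: "?\<nu> t \<in> N" if "t \<in> carrier T" for t using hom_closed[OF \<nu>(1) that] by simp
    have \<theta>1: "\<theta> \<in> lmod_hom \<Lambda> (mod_power T m) M" by (rule hom_into_restr[OF \<theta> submod_subset[OF X]])
    have \<theta>X: "\<theta> v \<in> X" if "v \<in> carrier (mod_power T m)" for v using hom_closed[OF \<theta> that] by simp
    note Pm = mod_power_left_module[OF Tm, of m] and PSm = mod_power_left_module[OF Tm, of "Suc m"]
    have r: "?r \<in> lmod_hom \<Lambda> (mod_power T (Suc m)) (mod_power T m)"
      by (rule lmod_homI) (auto simp: mod_power_simps PiE_iff fun_eq_iff)
    let ?h = "\<lambda>v. ?\<nu> (v m) \<oplus> \<theta> (?r v)"
    have h: "?h \<in> lmod_hom \<Lambda> (mod_power T (Suc m)) M"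
      by (intro hom_plus[OF hom_comp[OF mod_power_proj_hom \<nu>1] hom_comp[OF r \<theta>1] M]) simp
    have vm: "v m \<in> carrier T" if "v \<in> carrier (mod_power T (Suc m))" for v
      using that by (auto simp: mod_power_simps)
    have hA: "?h \<in> lmod_hom \<Lambda> (mod_power T (Suc m)) (restr M ?A)"
      by (rule hom_to_restr[OF h]) (intro set_addI \<nu>N \<theta>X vm hom_closed[OF r])
    have surj: "?h ` carrier (mod_power T (Suc m)) = ?A"
    proof
      show "?h ` carrier (mod_power T (Suc m)) \<subseteq> ?A" using hom_closed[OF hA] by auto
      show "?A \<subseteq> ?h ` carrier (mod_power T (Suc m))"
      proof
        fix z assume "z \<in> ?A"
        then obtain n x where nx: "n \<in> N" "x \<in> X" "z = n \<oplus> x" by (auto simp: set_add_eq)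
        obtain v where v: "v \<in> carrier (mod_power T m)" "\<theta> v = x"
          using nx(2) \<theta>b by (metis bij_betw_def imageE)
        let ?v = "v(m := q n)"
        have qn: "q n \<in> carrier T" using nx(1) N(3) by (auto simp: bij_betw_def)
        have v': "?v \<in> carrier (mod_power T (Suc m))"
          using v(1) qn by (auto simp: mod_power_simps PiE_iff extensional_def less_Suc_eq)
        have "?r ?v = v" using v(1) by (auto simp: mod_power_simps PiE_iff extensional_def fun_eq_iff)
        moreover have "?\<nu> (q n) = n" using N(3) nx(1) by (simp add: bij_betw_def)
        ultimately have "z = ?h ?v" using nx(3) v(2) by simp
        then show "z \<in> ?h ` carrier (mod_power T (Suc m))" using v' by blast
      qed
    qed
    have "inj_on ?h (carrier (mod_power T (Suc m)))"
      unfolding hom_inj_iff[OF h PSm M]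
    proof (intro ballI impI)
      fix v assume v: "v \<in> carrier (mod_power T (Suc m))" and hv: "?h v = \<zero>"
      let ?n = "?\<nu> (v m)" and ?x = "\<theta> (?r v)"
      have n: "?n \<in> N" by (rule \<nu>N[OF vm[OF v]])
      have x: "?x \<in> X" by (rule \<theta>X[OF hom_closed[OF r v]])
      have c: "?n \<in> carrier M" "?x \<in> carrier M" using n x submod_mem[OF Ns] submod_mem[OF X] by auto
      have "?n = \<zero> \<ominus> ?x" using hv c M.add_diff_cancel[OF c] by simp
      also have "\<dots> \<in> ?L" using submod_diff[OF L submod_zero[OF L]] x XL by blast
      finally have n0: "?n = \<zero>" using NX n by blast
      then have x0: "?x = \<zero>" using hv c by simp
      have "v m = q ?n" using vm[OF v] N(3) by (simp add: bij_betw_def f_inv_into_f)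
      then have vm0: "v m = \<zero>\<^bsub>T\<^esub>" using n0 hom_zero[OF q M Tm] by simp
      have "inj_on \<theta> (carrier (mod_power T m))" using \<theta>b by (simp add: bij_betw_def)
      then have "?r v = \<zero>\<^bsub>mod_power T m\<^esub>"
        using hom_inj_iff[OF \<theta>1 Pm M] x0 hom_closed[OF r v] by blast
      then have "v i = \<zero>\<^bsub>T\<^esub>" if "i < m" for i
        using that by (auto simp: mod_power_simps fun_eq_iff split: if_splits)
      then show "v = \<zero>\<^bsub>mod_power T (Suc m)\<^esub>"
        using v vm0 by (auto simp: mod_power_simps PiE_iff extensional_def fun_eq_iff less_Suc_eq)
    qed
    then show ?thesis using hA surj unfolding lmod_iso_def by (auto simp: bij_betw_def)
  qed
  ultimately show ?thesis unfolding direct_summand_def by blast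
qed

section \<open>The descending chain condition\<close>

definition artinian_module :: "'a ring \<Rightarrow> ('a, 'b) module \<Rightarrow> bool" where
  "artinian_module \<Lambda> M \<longleftrightarrow> left_module \<Lambda> M \<and>
     (\<forall>H :: nat \<Rightarrow> 'b set. (\<forall>n. submodule (H n) \<Lambda> M \<and> H (Suc n) \<subseteq> H n) \<longrightarrow> (\<exists>n. \<forall>m\<ge>n. H m = H n))"

lemma artinian_module_minimal:
  assumes M: "artinian_module \<Lambda> M" and "I\<^sub>0 \<in> F" and F: "\<And>I. I \<in> F \<Longrightarrow> submodule I \<Lambda> M"
  obtains I where "I \<in> F" "\<forall>I'\<in>F. I' \<subseteq> I \<longrightarrow> I' = I"
proof (rule ccontr)
  assume *: "\<not> thesis"
  have "\<forall>I\<in>F. \<exists>I'\<in>F. I' \<subset> I"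
  proof (rule ballI, rule ccontr)
    fix I assume "I \<in> F" "\<not> (\<exists>I'\<in>F. I' \<subset> I)"
    then show False using * that[of I] by blast
  qed
  then obtain f where f: "\<And>I. I \<in> F \<Longrightarrow> f I \<in> F" "\<And>I. I \<in> F \<Longrightarrow> f I \<subset> I" by metis
  define H where "H n = (f ^^ n) I\<^sub>0" for n
  have HF: "H n \<in> F" for n unfolding H_def by (induction n) (auto simp: assms(2) f(1))
  have dec: "H (Suc n) \<subset> H n" for n using f(2)[OF HF[of n]] by (simp add: H_def)
  have "\<forall>n. submodule (H n) \<Lambda> M \<and> H (Suc n) \<subseteq> H n" using F[OF HF] dec by blast
  then obtain n where "\<forall>m\<ge>n. H m = H n" using M unfolding artinian_module_def by blast
  then have "H (Suc n) = H n" by (meson le_SucI order_refl)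
  then show False using dec[of n] by simp
qed

lemma submodule_regular_ideal:
  fixes R :: "'r ring"
  assumes "cring R" "submodule I R (regular R)" shows "ideal I R"
proof -
  interpret cring R by fact
  have mult: "a \<otimes>\<^bsub>R\<^esub> x \<in> I" if "a \<in> carrier R" "x \<in> I" for a x
    using submod_smult[OF assms(2) that] by simp
  have Ic: "x \<in> carrier R" if "x \<in> I" for x using submod_mem[OF assms(2) that] by simp
  have mult': "x \<otimes>\<^bsub>R\<^esub> a \<in> I" if "a \<in> carrier R" "x \<in> I" for a x
    using mult[OF that] m_comm[OF that(1) Ic[OF that(2)]] by simp
  have sg: "subgroup I (add_monoid R)"
  proof (rule add.subgroupI)
    show "I \<subseteq> carrier R" using Ic by blast
    show "I \<noteq> {}" using submod_zero[OF assms(2)] by auto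
    show "\<ominus>\<^bsub>R\<^esub> x \<in> I" if "x \<in> I" for x
      using mult[of "\<ominus>\<^bsub>R\<^esub> \<one>\<^bsub>R\<^esub>" x] that Ic[OF that] by (simp add: l_minus)
    show "x \<oplus>\<^bsub>R\<^esub> y \<in> I" if "x \<in> I" "y \<in> I" for x y using submod_add[OF assms(2) that] by simp
  qed
  show ?thesis
    by (rule idealI[OF ring_axioms sg]) (simp_all add: mult mult')
qed

text \<open>A chain in \<open>U + R a\<close> becomes stationary when its traces on \<open>U\<close> and the ideals of the coefficients of \<open>a\<close>
occurring in its members do.\<close>

lemma artinian_extend:
  fixes M :: "('r, 'b) module" (structure)
  assumes R: "artinian_cring R" and M: "left_module R M" and U: "submodule U R M" and a: "a \<in> carrier M"
    and dcc: "\<And>H :: nat \<Rightarrow> 'b set. (\<And>n. submodule (H n) R M \<and> H (Suc n) \<subseteq> H n) \<Longrightarrow> H 0 \<subseteq> U \<Longrightarrow> \<exists>n. \<forall>m\<ge>n. H m = H n"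
    and H: "\<And>n. submodule (H n) R M \<and> H (Suc n) \<subseteq> H n"
    and H0: "H 0 \<subseteq> U <+>\<^bsub>M\<^esub> ((\<lambda>r. r \<odot> a) ` carrier R)"
  shows "\<exists>n. \<forall>m\<ge>n. H m = H n"
proof -
  interpret M: left_module R M by fact
  interpret RR: left_module R "regular R" by (rule regular_left_module[OF M.R.ring_axioms])
  have cr: "cring R" using R by (simp add: artinian_cring_def)
  have Hs: "submodule (H n) R M" for n using H by blast
  have mono: "H m \<subseteq> H n" if "n \<le> m" for m n
    using lift_Suc_antimono_le[of H n m] H that by blast
  define I where "I n = {r \<in> carrier R. \<exists>u\<in>U. u \<oplus> r \<odot> a \<in> H n}" for n
  have "submodule (I n) R (regular R)" for n
  proof (rule RR.submoduleI)
    show "I n \<subseteq> carrier (regular R)" by (auto simp: I_def)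
    show "\<zero>\<^bsub>regular R\<^esub> \<in> I n"
      using submod_zero[OF U] submod_zero[OF Hs] a by (auto simp: I_def intro!: bexI[of _ "\<zero>"])
  next
    fix r s assume "r \<in> I n" "s \<in> I n"
    then obtain u v where uv: "r \<in> carrier R" "s \<in> carrier R" "u \<in> U" "v \<in> U"
      "u \<oplus> r \<odot> a \<in> H n" "v \<oplus> s \<odot> a \<in> H n" by (auto simp: I_def)
    have c: "u \<in> carrier M" "v \<in> carrier M" using uv submod_mem[OF U] by auto
    have "(u \<oplus> v) \<oplus> (r \<oplus>\<^bsub>R\<^esub> s) \<odot> a = (u \<oplus> r \<odot> a) \<oplus> (v \<oplus> s \<odot> a)"
      using uv c a by (simp add: M.smult_l_distr M.M.a_ac)
    also have "\<dots> \<in> H n" by (rule submod_add[OF Hs uv(5,6)])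
    finally show "r \<oplus>\<^bsub>regular R\<^esub> s \<in> I n" using uv submod_add[OF U uv(3,4)] by (auto simp: I_def)
  next
    fix c r assume c: "c \<in> carrier R" and "r \<in> I n"
    then obtain u where u: "r \<in> carrier R" "u \<in> U" "u \<oplus> r \<odot> a \<in> H n" by (auto simp: I_def)
    have uM: "u \<in> carrier M" using u submod_mem[OF U] by auto
    have "c \<odot> u \<oplus> (c \<otimes>\<^bsub>R\<^esub> r) \<odot> a = c \<odot> (u \<oplus> r \<odot> a)"
      using u uM a c by (simp add: M.smult_r_distr M.smult_assoc1)
    also have "\<dots> \<in> H n" by (rule submod_smult[OF Hs c u(3)])
    finally show "c \<odot>\<^bsub>regular R\<^esub> r \<in> I n" using u c submod_smult[OF U c u(2)] by (auto simp: I_def)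
  qed
  then have "ideal (I n) R" for n by (rule submodule_regular_ideal[OF cr])
  moreover have "I (Suc n) \<subseteq> I n" for n using H[of n] by (auto simp: I_def dest!: subsetD)
  ultimately have "\<forall>n. ideal (I n) R \<and> I (Suc n) \<subseteq> I n" by blast
  then obtain n\<^sub>1 where n1: "\<forall>m\<ge>n\<^sub>1. I m = I n\<^sub>1" using R unfolding artinian_cring_def by blast
  have "\<exists>n. \<forall>m\<ge>n. H m \<inter> U = H n \<inter> U"
    by (rule dcc) (use H M.submodule_Int[OF Hs U] in auto)
  then obtain n\<^sub>2 where n2: "\<forall>m\<ge>n\<^sub>2. H m \<inter> U = H n\<^sub>2 \<inter> U" by blast
  define N where "N = max n\<^sub>1 n\<^sub>2"
  have "H N \<subseteq> H m" if m: "m \<ge> N" for m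
  proof
    fix x assume x: "x \<in> H N"
    have xM: "x \<in> carrier M" by (rule submod_mem[OF Hs x])
    have "x \<in> U <+>\<^bsub>M\<^esub> ((\<lambda>r. r \<odot> a) ` carrier R)" using subsetD[OF order_trans[OF mono[of 0 N] H0] x] by simp
    then obtain u r where ur: "u \<in> U" "r \<in> carrier R" "x = u \<oplus> r \<odot> a" by (auto simp: set_add_eq)
    have le: "n\<^sub>1 \<le> N" "n\<^sub>2 \<le> N" "n\<^sub>1 \<le> m" "n\<^sub>2 \<le> m" using m by (simp_all add: N_def)
    have "I N = I n\<^sub>1" "I m = I n\<^sub>1" by (rule n1[rule_format], rule le)+
    moreover have "r \<in> I N" using x ur by (auto simp: I_def)
    ultimately obtain v where v: "v \<in> U" "v \<oplus> r \<odot> a \<in> H m" by (auto simp: I_def)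
    have c: "u \<in> carrier M" "v \<in> carrier M" using ur v submod_mem[OF U] by auto
    let ?y = "v \<oplus> r \<odot> a"
    have yM: "?y \<in> carrier M" using c ur a by simp
    have "x \<ominus> ?y = (u \<ominus> v) \<oplus> (r \<odot> a \<oplus> (\<ominus> (r \<odot> a)))"
      using ur(2,3) c a by (simp add: a_minus_def M.M.minus_add M.M.a_ac)
    also have "\<dots> = u \<ominus> v" using c ur(2) a by (simp add: M.M.r_neg)
    finally have eq: "x \<ominus> ?y = u \<ominus> v" .
    have "x \<ominus> ?y \<in> H N" using submod_diff[OF Hs x] v(2) mono[OF m] by blast
    moreover have "x \<ominus> ?y \<in> U" unfolding eq by (rule submod_diff[OF U ur(1) v(1)])
    moreover have "H N \<inter> U = H n\<^sub>2 \<inter> U" "H m \<inter> U = H n\<^sub>2 \<inter> U" by (rule n2[rule_format], rule le)+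
    ultimately have "x \<ominus> ?y \<in> H m" by blast
    then have "(x \<ominus> ?y) \<oplus> ?y \<in> H m" by (rule submod_add[OF Hs _ v(2)])
    then show "x \<in> H m" using M.minus_add_cancel[OF xM yM] by simp
  qed
  then show ?thesis using mono by (intro exI[of _ N]) blast
qed

lemma artinian_fin_gen:
  fixes M :: "('r, 'b) module" (structure)
  assumes R: "artinian_cring R" and M: "left_module R M" and fg: "fin_gen R M"
  shows "artinian_module R M"
proof -
  interpret M: left_module R M by fact
  obtain A where A: "finite A" "A \<subseteq> carrier M" "\<And>H. submodule H R M \<Longrightarrow> A \<subseteq> H \<Longrightarrow> H = carrier M"
    using fg by (auto simp: fin_gen_def)
  define P where "P U \<longleftrightarrow> submodule U R M \<and> (\<forall>H :: nat \<Rightarrow> 'b set.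
    (\<forall>n. submodule (H n) R M \<and> H (Suc n) \<subseteq> H n) \<longrightarrow> H 0 \<subseteq> U \<longrightarrow> (\<exists>n. \<forall>m\<ge>n. H m = H n))" for U
  have "\<exists>U. P U \<and> A \<subseteq> U"
    using A(1,2)
  proof induction
    case empty
    have "\<exists>n. \<forall>m\<ge>n. H m = H n"
      if H: "\<forall>n. submodule (H n) R M \<and> H (Suc n) \<subseteq> H n" and H0: "H 0 \<subseteq> {\<zero>}" for H :: "nat \<Rightarrow> 'b set"
    proof -
      have "H m \<subseteq> H 0" for m using lift_Suc_antimono_le[of H 0 m] H by blast
      then have "H m = {\<zero>}" for m using H0 submod_zero[of "H m" R M] H by blast
      then show ?thesis by blast
    qed
    then show ?case using M.submodule_null unfolding P_def by blast
  next
    case (insert a A)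
    then obtain U where U: "P U" "A \<subseteq> U" by auto
    have a: "a \<in> carrier M" using insert.prems by simp
    let ?C = "(\<lambda>r. r \<odot> a) ` carrier R"
    have Us: "submodule U R M" using U(1) by (simp add: P_def)
    note C = M.submodule_cyclic[OF a]
    have "P (U <+>\<^bsub>M\<^esub> ?C)"
      unfolding P_def
    proof (intro conjI allI impI M.submodule_set_add[OF Us C])
      fix H :: "nat \<Rightarrow> 'b set"
      assume H: "\<forall>n. submodule (H n) R M \<and> H (Suc n) \<subseteq> H n" "H 0 \<subseteq> U <+>\<^bsub>M\<^esub> ?C"
      show "\<exists>n. \<forall>m\<ge>n. H m = H n"
      proof (rule artinian_extend[OF R M Us a])
        show "\<exists>n. \<forall>m\<ge>n. K m = K n"
          if "\<And>n. submodule (K n) R M \<and> K (Suc n) \<subseteq> K n" "K 0 \<subseteq> U" for K :: "nat \<Rightarrow> 'b set"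
          using U(1) that by (simp add: P_def)
      qed (use H in auto)
    qed
    moreover have "a \<in> ?C" using a by (intro image_eqI[of _ _ "\<one>\<^bsub>R\<^esub>"]) auto
    then have "insert a A \<subseteq> U <+>\<^bsub>M\<^esub> ?C" using M.subset_set_add[OF Us C] U(2) by blast
    ultimately show ?case by blast
  qed
  then obtain U where U: "P U" "A \<subseteq> U" by blast
  then have "U = carrier M" using A(3) by (simp add: P_def)
  then have "\<exists>n. \<forall>m\<ge>n. H m = H n"
    if "\<forall>n. submodule (H n) R M \<and> H (Suc n) \<subseteq> H n" for H :: "nat \<Rightarrow> 'b set"
    using U(1) that submod_subset[of "H 0" R M] by (simp add: P_def)
  then show ?thesis using M by (simp add: artinian_module_def)
qed

lemma restrict_scalars_simps [simp]:
  "carrier (restrict_scalars \<phi> M) = carrier M" "\<zero>\<^bsub>restrict_scalars \<phi> M\<^esub> = \<zero>\<^bsub>M\<^esub>"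
  "x \<oplus>\<^bsub>restrict_scalars \<phi> M\<^esub> y = x \<oplus>\<^bsub>M\<^esub> y" "r \<odot>\<^bsub>restrict_scalars \<phi> M\<^esub> x = \<phi> r \<odot>\<^bsub>M\<^esub> x"
  by (simp_all add: restrict_scalars_def)

lemma restrict_scalars_left_module:
  fixes R :: "'r ring"
  assumes R: "ring R" and \<phi>: "\<phi> \<in> ring_hom R \<Lambda>" and M: "left_module \<Lambda> M"
  shows "left_module R (restrict_scalars \<phi> M)"
proof -
  interpret R: ring R by fact
  interpret M: left_module \<Lambda> M by fact
  note [simp] = ring_hom_closed[OF \<phi>] ring_hom_add[OF \<phi>] ring_hom_mult[OF \<phi>] ring_hom_one[OF \<phi>]
  have ag: "abelian_group (restrict_scalars \<phi> M)"
  proof (rule abelian_groupI)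
    fix x assume "x \<in> carrier (restrict_scalars \<phi> M)"
    then show "\<exists>y\<in>carrier (restrict_scalars \<phi> M). y \<oplus>\<^bsub>restrict_scalars \<phi> M\<^esub> x = \<zero>\<^bsub>restrict_scalars \<phi> M\<^esub>"
      by (intro bexI[of _ "\<ominus>\<^bsub>M\<^esub> x"]) (auto simp: M.M.l_neg)
  qed (auto simp: M.M.a_ac)
  show ?thesis
    by (intro left_module.intro ag R left_module_axioms.intro)
      (auto simp: M.smult_l_distr M.smult_r_distr M.smult_assoc1)
qed

lemma submodule_restrict_scalars:
  fixes R :: "'r ring"
  assumes R: "ring R" and \<phi>: "\<phi> \<in> ring_hom R \<Lambda>" and M: "left_module \<Lambda> M" and H: "submodule H \<Lambda> M"
  shows "submodule H R (restrict_scalars \<phi> M)"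
proof -
  interpret left_module R "restrict_scalars \<phi> M" by (rule restrict_scalars_left_module[OF R \<phi> M])
  show ?thesis
    by (rule submoduleI) (use H ring_hom_closed[OF \<phi>] in \<open>auto simp: submod_closed\<close>)
qed

lemma artin_algebra_facts:
  assumes "artin_algebra R \<phi> \<Lambda>"
  shows "artinian_cring R" "cring R" "ring R" "ring \<Lambda>" "\<phi> \<in> ring_hom R \<Lambda>"
    "fin_gen R (restrict_scalars \<phi> (regular \<Lambda>))"
proof -
  show 1: "artinian_cring R" "ring \<Lambda>" "\<phi> \<in> ring_hom R \<Lambda>" "fin_gen R (restrict_scalars \<phi> (regular \<Lambda>))"
    using assms by (simp_all add: artin_algebra_def)
  show "cring R" using 1 by (simp add: artinian_cring_def)
  then show "ring R" by (simp add: cring_def)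
qed

lemma artin_algebra_artinian:
  assumes "artin_algebra R \<phi> \<Lambda>" shows "artinian_module \<Lambda> (regular \<Lambda>)"
proof -
  note A = artin_algebra_facts[OF assms]
  note L = regular_left_module[OF A(4)]
  have "artinian_module R (restrict_scalars \<phi> (regular \<Lambda>))"
    by (rule artinian_fin_gen[OF A(1) restrict_scalars_left_module[OF A(3,5) L] A(6)])
  then show ?thesis
    using L submodule_restrict_scalars[OF A(3,5) L] unfolding artinian_module_def by blast
qed

section \<open>Projective covers of semisimple modules\<close>

text \<open>Let \<open>I\<close> be minimal among the left ideals with \<open>I T \<noteq> 0\<close>, choose \<open>t \<in> T\<close> with \<open>I t = T\<close> and \<open>u \<in> I\<close> with \<open>u t = t\<close>.
By minimality, a submodule of \<open>I\<close> containing an element that does not kill \<open>t\<close> is all of \<open>I\<close>. So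
\<open>x \<mapsto> x t\<close> is an essential epimorphism from \<open>I\<close> to \<open>T\<close>, and only the projectivity of \<open>I\<close> remains.
For this it suffices to find \<open>e \<in> I\<close> with \<open>x e = x\<close> for all \<open>x \<in> I\<close>.

Also \<open>I u = I\<close> by minimality, so there is \<open>e \<in> I\<close> with \<open>e u = u\<close>; then \<open>(x e - x) u = 0\<close>, and it is enough
that right multiplication by \<open>u\<close> is injective on \<open>I\<close>. The element \<open>n = u (u - 1)\<close> of \<open>I\<close> kills \<open>t\<close>. For
\<open>x \<in> I\<close> with \<open>x t = 0\<close> the element \<open>1 - x\<close> has a left inverse, again by minimality. Together with the
descending chain condition for the left ideals generated by the powers of \<open>n\<close> this makes \<open>n\<close> nilpotent, say \<open>n\<^sup>k = 0\<close>. If now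
\<open>x \<in> I\<close> and \<open>x u = 0\<close>, write \<open>x = y u\<^sup>k\<close> with \<open>y \<in> I\<close>: then
\<open>0 = y n\<^sup>k = x (u - 1)\<^sup>k = \<plusminus> x\<close>.\<close>

lemma simple_projective_cover:
  fixes \<Lambda> (structure)
  assumes art: "artinian_module \<Lambda> (regular \<Lambda>)" and T: "simple_module \<Lambda> T"
  obtains I t where "projective_cover \<Lambda> (restr (regular \<Lambda>) I) (\<lambda>x. x \<odot>\<^bsub>T\<^esub> t) T"
proof -
  have Lm: "left_module \<Lambda> (regular \<Lambda>)" using art by (simp add: artinian_module_def)
  interpret ring \<Lambda> by (rule left_module.axioms(1)[OF Lm])
  interpret L: left_module \<Lambda> "regular \<Lambda>" by (rule Lm)
  note Tm = simple_left_module[OF T]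
  interpret T: left_module \<Lambda> T by (rule Tm)
  define F where "F = {I. submodule I \<Lambda> (regular \<Lambda>) \<and> (\<exists>x\<in>I. \<exists>t\<in>carrier T. x \<odot>\<^bsub>T\<^esub> t \<noteq> \<zero>\<^bsub>T\<^esub>)}"
  obtain t\<^sub>1 where t1: "t\<^sub>1 \<in> carrier T" "t\<^sub>1 \<noteq> \<zero>\<^bsub>T\<^esub>"
    using T T.M.zero_closed by (auto simp: simple_module_def)
  have "carrier \<Lambda> \<in> F"
    using L.submodule_carrier t1 unfolding F_def by (auto intro!: bexI[of _ "\<one>"] bexI[of _ t\<^sub>1])
  moreover have "submodule I \<Lambda> (regular \<Lambda>)" if "I \<in> F" for I using that by (simp add: F_def)
  ultimately obtain I where IF: "I \<in> F" and min: "\<forall>I'\<in>F. I' \<subseteq> I \<longrightarrow> I' = I"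
    by (rule artinian_module_minimal[OF art])
  from IF obtain x\<^sub>0 t where I: "submodule I \<Lambda> (regular \<Lambda>)" and x0: "x\<^sub>0 \<in> I"
    and t: "t \<in> carrier T" and xt: "x\<^sub>0 \<odot>\<^bsub>T\<^esub> t \<noteq> \<zero>\<^bsub>T\<^esub>" by (auto simp: F_def)
  have Ic: "x \<in> carrier \<Lambda>" if "x \<in> I" for x using submod_mem[OF I that] by simp
  have Im: "a \<otimes> x \<in> I" if "a \<in> carrier \<Lambda>" "x \<in> I" for a x using submod_smult[OF I that] by simp
  have dif: "x \<ominus>\<^bsub>regular \<Lambda>\<^esub> y = x \<ominus> y" for x y
    by (simp add: regular_def a_minus_def a_inv_def m_inv_def)
  have Id: "x \<ominus> y \<in> I" if "x \<in> I" "y \<in> I" for x y using submod_diff[OF I that] by (simp add: dif)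
  have FI: "submodule H \<Lambda> (regular \<Lambda>) \<Longrightarrow> H \<subseteq> I \<Longrightarrow> h \<in> H \<Longrightarrow> h \<odot>\<^bsub>T\<^esub> t \<noteq> \<zero>\<^bsub>T\<^esub> \<Longrightarrow> H = I" for H h
    using min t by (auto simp: F_def)
  have ev: "(\<lambda>x. x \<odot>\<^bsub>T\<^esub> t) \<in> lmod_hom \<Lambda> (regular \<Lambda>) T" by (rule hom_smult_right[OF hom_id Tm t])
  note IM = L.left_module_restr[OF I]
  have evI: "(\<lambda>x. x \<odot>\<^bsub>T\<^esub> t) \<in> lmod_hom \<Lambda> (restr (regular \<Lambda>) I) T"
    by (rule hom_from_restr[OF ev submod_subset[OF I]])
  have surj: "(\<lambda>x. x \<odot>\<^bsub>T\<^esub> t) ` I = carrier T" using simple_hom_surj[OF T IM evI] x0 xt by auto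
  have t0: "t \<noteq> \<zero>\<^bsub>T\<^esub>" using xt Ic[OF x0] by auto
  obtain u where u: "u \<in> I" "u \<odot>\<^bsub>T\<^esub> t = t" using surj t by (metis imageE)
  have uc: "u \<in> carrier \<Lambda>" by (rule Ic[OF u(1)])
  have rm: "submodule ((\<lambda>x. x \<otimes> w) ` I) \<Lambda> (regular \<Lambda>)" if "w \<in> carrier \<Lambda>" for w
  proof -
    have "(\<lambda>x. x \<otimes> w) \<in> lmod_hom \<Lambda> (regular \<Lambda>) (regular \<Lambda>)"
      using hom_smult_right[OF hom_id Lm, of w] that by simp
    from submodule_image[OF this Lm Lm I] show ?thesis .
  qed
  have Iu: "(\<lambda>x. x \<otimes> u) ` I = I"
  proof (rule FI[OF rm[OF uc]])
    show "(\<lambda>x. x \<otimes> u) ` I \<subseteq> I" using Im Ic u by auto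
    show "u \<otimes> u \<in> (\<lambda>x. x \<otimes> u) ` I" using u by blast
    show "(u \<otimes> u) \<odot>\<^bsub>T\<^esub> t \<noteq> \<zero>\<^bsub>T\<^esub>" using u uc t t0 by (simp add: T.smult_assoc1)
  qed
  \<comment> \<open>Right multiplication by \<open>1 - x\<close> maps \<open>I\<close> onto \<open>I\<close>, so \<open>x = y (1 - x)\<close> and \<open>(1 + y) (1 - x) = 1\<close>.\<close>
  have left_inv: "\<exists>w\<in>carrier \<Lambda>. w \<otimes> (\<one> \<ominus> x) = \<one>" if x: "x \<in> I" "x \<odot>\<^bsub>T\<^esub> t = \<zero>\<^bsub>T\<^esub>" for x
  proof -
    have xc: "x \<in> carrier \<Lambda>" by (rule Ic[OF x(1)])
    let ?v = "\<one> \<ominus> x"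
    have vc: "?v \<in> carrier \<Lambda>" using xc by simp
    have "(\<lambda>y. y \<otimes> ?v) ` I = I"
    proof (rule FI[OF rm[OF vc]])
      have "y \<otimes> ?v = y \<ominus> y \<otimes> x" if "y \<in> carrier \<Lambda>" for y
        using that xc by (simp add: a_minus_def r_distr r_minus)
      then show "(\<lambda>y. y \<otimes> ?v) ` I \<subseteq> I" using Ic Id Im x(1) by auto
      show "u \<otimes> ?v \<in> (\<lambda>y. y \<otimes> ?v) ` I" using u by blast
      have "?v \<odot>\<^bsub>T\<^esub> t = t" using xc x(2) t by (simp add: T.smult_l_diff T.diff_zero)
      then show "(u \<otimes> ?v) \<odot>\<^bsub>T\<^esub> t \<noteq> \<zero>\<^bsub>T\<^esub>" using u uc vc t t0 by (simp add: T.smult_assoc1)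
    qed
    then have "x \<in> (\<lambda>y. y \<otimes> ?v) ` I" using x(1) by simp
    then obtain y where y: "y \<in> I" "x = y \<otimes> ?v" by blast
    have "(\<one> \<oplus> y) \<otimes> ?v = ?v \<oplus> x" using y vc Ic[OF y(1)] by (simp add: l_distr)
    also have "\<dots> = \<one>" using xc by (simp add: a_minus_def a_assoc l_neg)
    finally show ?thesis using Ic[OF y(1)] by (intro bexI[of _ "\<one> \<oplus> y"]) auto
  qed
  let ?w = "u \<ominus> \<one>"
  let ?n = "u \<otimes> ?w"
  have wc: "?w \<in> carrier \<Lambda>" and nc: "?n \<in> carrier \<Lambda>" using uc by auto
  have n_eq: "?n = u \<otimes> u \<ominus> u" using uc by (simp add: a_minus_def r_distr r_minus)
  have comm: "u \<otimes> ?w = ?w \<otimes> u" using uc by (simp add: a_minus_def r_distr r_minus l_distr l_minus)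
  have nI: "?n \<in> I" unfolding n_eq by (intro Id Im u uc)
  have nt: "?n \<odot>\<^bsub>T\<^esub> t = \<zero>\<^bsub>T\<^esub>"
    unfolding n_eq using u uc t by (simp add: T.smult_l_diff T.smult_assoc1 T.diff_eq_zero)
  obtain k :: nat where nk: "?n [^] k = \<zero>"
  proof -
    define H where "H k = (\<lambda>c. c \<otimes> ?n [^] (k::nat)) ` carrier \<Lambda>" for k
    have "submodule (H k) \<Lambda> (regular \<Lambda>)" for k
      using L.submodule_cyclic[of "?n [^] k"] nc by (simp add: H_def)
    moreover have "H (Suc k) \<subseteq> H k" for k
    proof
      fix x assume "x \<in> H (Suc k)"
      then obtain c where c: "c \<in> carrier \<Lambda>" "x = c \<otimes> ?n [^] Suc k" by (auto simp: H_def)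
      have "x = (c \<otimes> ?n) \<otimes> ?n [^] k"
        unfolding c(2) using nat_pow_Suc2[OF nc, of k] c(1) nc nat_pow_closed[OF nc, of k] m_assoc by metis
      then show "x \<in> H k" using c(1) nc unfolding H_def by blast
    qed
    ultimately obtain k where "\<forall>m\<ge>k. H m = H k" using art unfolding artinian_module_def by blast
    then have "H (Suc k) = H k" by (meson le_SucI order_refl)
    moreover have "?n [^] k \<in> H k"
      unfolding H_def using nat_pow_closed[OF nc, of k] by (intro image_eqI[of _ _ "\<one>"]) auto
    ultimately obtain c where c: "c \<in> carrier \<Lambda>" "?n [^] k = c \<otimes> ?n [^] Suc k"
      unfolding H_def by blast
    let ?p = "?n [^] k"
    have pc: "?p \<in> carrier \<Lambda>" by (rule nat_pow_closed[OF nc])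
    \<comment> \<open>\<open>n\<^sup>k = c n\<^sup>k\<^sup>+\<^sup>1\<close> means \<open>(1 - c n) n\<^sup>k = 0\<close>, where \<open>1 - c n\<close> has a left inverse.\<close>
    have pe: "?p = (c \<otimes> ?n) \<otimes> ?p"
      using c nat_pow_Suc2[OF nc, of k] nc pc m_assoc by metis
    have "(c \<otimes> ?n) \<odot>\<^bsub>T\<^esub> t = \<zero>\<^bsub>T\<^esub>" using c nc t nt by (simp add: T.smult_assoc1)
    then obtain w where w: "w \<in> carrier \<Lambda>" "w \<otimes> (\<one> \<ominus> (c \<otimes> ?n)) = \<one>"
      using left_inv[OF Im[OF c(1) nI]] by blast
    define d where "d = c \<otimes> ?n"
    have dc: "d \<in> carrier \<Lambda>" using c(1) nc by (simp add: d_def)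
    have dp: "d \<otimes> ?p = ?p" unfolding d_def by (rule pe[symmetric])
    have "(\<one> \<ominus> d) \<otimes> ?p = ?p \<ominus> d \<otimes> ?p"
      using dc pc by (simp add: a_minus_def l_distr l_minus)
    also have "\<dots> = \<zero>" unfolding dp by (simp only: a_minus_def[of \<Lambda> "?p" "?p"] r_neg[OF pc])
    finally have "w \<otimes> ((\<one> \<ominus> d) \<otimes> ?p) = \<zero>" using w(1) by simp
    then have "(w \<otimes> (\<one> \<ominus> d)) \<otimes> ?p = \<zero>" using w(1) dc pc by (simp add: m_assoc)
    then have "?p = \<zero>" using w(2) pc by (simp add: d_def)
    then show ?thesis by (rule that)
  qed
  have Iuk: "\<exists>y\<in>I. x = y \<otimes> u [^] j" if "x \<in> I" for x and j :: nat
    using that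
  proof (induction j arbitrary: x)
    case 0 then show ?case using Ic by auto
  next
    case (Suc j)
    obtain z where z: "z \<in> I" "x = z \<otimes> u" using Iu Suc.prems by (metis imageE)
    then obtain y where "y \<in> I" "z = y \<otimes> u [^] j" using Suc.IH by blast
    then show ?case using z uc Ic by (intro bexI[of _ y]) (auto simp: m_assoc)
  qed
  \<comment> \<open>If \<open>z u = 0\<close>, then multiplying \<open>z\<close> by \<open>u - 1\<close> changes only its sign.\<close>
  have kill: "z = \<zero>" if "z \<in> carrier \<Lambda>" "z \<otimes> u = \<zero>" "z \<otimes> ?w [^] j = \<zero>" for z and j :: nat
    using that
  proof (induction j arbitrary: z)
    case 0 then show ?case by simp
  next
    case (Suc j)
    have pj: "?w [^] j \<in> carrier \<Lambda>" by (rule nat_pow_closed[OF wc])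
    have "z \<otimes> ?w = \<ominus> z" using Suc.prems(1,2) uc by (simp add: a_minus_def r_distr r_minus)
    moreover have "(z \<otimes> ?w) \<otimes> ?w [^] j = \<zero>"
      using Suc.prems(1,3) nat_pow_Suc2[OF wc, of j] wc pj m_assoc by metis
    ultimately have "(\<ominus> z) \<otimes> ?w [^] j = \<zero>" by simp
    moreover have "(\<ominus> z) \<otimes> u = \<zero>" using Suc.prems(1,2) uc by (simp add: l_minus)
    ultimately have "\<ominus> z = \<zero>" using Suc.IH[of "\<ominus> z"] Suc.prems(1) by simp
    then show ?case using Suc.prems(1) minus_minus minus_zero by metis
  qed
  have inj: "x = \<zero>" if x: "x \<in> I" "x \<otimes> u = \<zero>" for x
  proof -
    obtain y where y: "y \<in> I" "x = y \<otimes> u [^] k" using Iuk[OF x(1)] by blast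
    have yc: "y \<in> carrier \<Lambda>" by (rule Ic[OF y(1)])
    have "y \<otimes> (u [^] k \<otimes> ?w [^] k) = \<zero>"
      using nk pow_mult_distrib[OF comm uc wc, of k] yc by simp
    then have "x \<otimes> ?w [^] k = \<zero>" using y(2) yc uc wc by (simp add: m_assoc)
    then show ?thesis using kill[of x k] x(2) Ic[OF x(1)] by simp
  qed
  obtain e where e: "e \<in> I" "u = e \<otimes> u" using Iu u(1) by (metis imageE)
  have ec: "e \<in> carrier \<Lambda>" by (rule Ic[OF e(1)])
  have xe: "x \<otimes> e = x" if x: "x \<in> I" for x
  proof -
    have xc: "x \<in> carrier \<Lambda>" by (rule Ic[OF x])
    have xeu: "(x \<otimes> e) \<otimes> u = x \<otimes> u"
      by (simp only: m_assoc[OF xc ec uc] e(2)[symmetric])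
    have "(x \<otimes> e \<ominus> x) \<otimes> u = (x \<otimes> e) \<otimes> u \<ominus> x \<otimes> u"
      using xc ec uc by (simp add: a_minus_def l_distr l_minus)
    also have "\<dots> = \<zero>" unfolding xeu using xc uc by (simp add: a_minus_def r_neg)
    finally have "(x \<otimes> e \<ominus> x) \<otimes> u = \<zero>" .
    then have "x \<otimes> e \<ominus> x = \<zero>" by (rule inj[OF Id[OF Im[OF xc e(1)] x]])
    then show ?thesis using L.diff_eq_zero[of "x \<otimes> e" x] xc ec by (simp add: dif)
  qed
  have "projective_cover \<Lambda> (restr (regular \<Lambda>) I) (\<lambda>x. x \<odot>\<^bsub>T\<^esub> t) T"
    unfolding projective_cover_def
  proof (intro conjI allI impI)
    have "H = I" if H: "submodule H \<Lambda> (restr (regular \<Lambda>) I)" "{e} \<subseteq> H" for H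
    proof -
      have "x \<in> H" if "x \<in> I" for x using submod_smult[OF H(1) Ic[OF that], of e] H(2) xe[OF that] by simp
      then show ?thesis using submod_subset[OF H(1)] by auto
    qed
    then have "fin_gen \<Lambda> (restr (regular \<Lambda>) I)"
      unfolding fin_gen_def using e(1) by (intro exI[of _ "{e}"]) auto
    then show "fg_left_module \<Lambda> (restr (regular \<Lambda>) I)" using IM by (simp add: fg_left_module_def)
    show "projective_module \<Lambda> (restr (regular \<Lambda>) I)"
      unfolding projective_module_def
    proof (intro conjI allI impI IM)
      fix B C :: "('a, 'a univ) module" and g h
      assume *: "left_module \<Lambda> B \<and> left_module \<Lambda> C \<and> g \<in> lmod_hom \<Lambda> B C \<and> g ` carrier B = carrier C \<and>
        h \<in> lmod_hom \<Lambda> (restr (regular \<Lambda>) I) C"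
      then have B: "left_module \<Lambda> B" and g: "g \<in> lmod_hom \<Lambda> B C" and s: "g ` carrier B = carrier C"
        and h: "h \<in> lmod_hom \<Lambda> (restr (regular \<Lambda>) I) C" by auto
      have "h e \<in> carrier C" using hom_closed[OF h] e(1) by simp
      then have "h e \<in> g ` carrier B" using s by simp
      then obtain b where b: "b \<in> carrier B" "g b = h e" by auto
      have "(\<lambda>x. x \<odot>\<^bsub>B\<^esub> b) \<in> lmod_hom \<Lambda> (restr (regular \<Lambda>) I) B"
        by (rule hom_from_restr[OF hom_smult_right[OF hom_id B b(1)] submod_subset[OF I]])
      moreover have "g (x \<odot>\<^bsub>B\<^esub> b) = h x" if "x \<in> I" for x
        using hom_smult[OF g Ic[OF that] b(1)] hom_smult[OF h Ic[OF that], of e] b(2) e(1) xe[OF that] by simp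
      ultimately show "\<exists>k\<in>lmod_hom \<Lambda> (restr (regular \<Lambda>) I) B. \<forall>x\<in>carrier (restr (regular \<Lambda>) I). g (k x) = h x"
        by (intro bexI[of _ "\<lambda>x. x \<odot>\<^bsub>B\<^esub> b"]) auto
    qed
    show "left_module \<Lambda> T" by (rule Tm)
    show "(\<lambda>x. x \<odot>\<^bsub>T\<^esub> t) \<in> lmod_hom \<Lambda> (restr (regular \<Lambda>) I) T" by (rule evI)
    show "(\<lambda>x. x \<odot>\<^bsub>T\<^esub> t) ` carrier (restr (regular \<Lambda>) I) = carrier T" using surj by simp
    fix H assume H: "submodule H \<Lambda> (restr (regular \<Lambda>) I) \<and> (\<lambda>x. x \<odot>\<^bsub>T\<^esub> t) ` H = carrier T"
    then have "t \<in> (\<lambda>x. x \<odot>\<^bsub>T\<^esub> t) ` H" using t by simp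
    then obtain h where h: "h \<in> H" "h \<odot>\<^bsub>T\<^esub> t = t" by auto
    have "submodule H \<Lambda> (regular \<Lambda>)" "H \<subseteq> I" using H by (simp_all add: L.submodule_restr_iff[OF I])
    then have "H = I" by (rule FI[OF _ _ h(1)]) (simp add: h(2) t0)
    then show "H = carrier (restr (regular \<Lambda>) I)" by simp
  qed
  then show ?thesis by (rule that)
qed

lemma projective_cover_univ:
  fixes P :: "('a, 'b) module"
  assumes pc: "projective_cover \<Lambda> P p X"
  obtains f :: "'b \<Rightarrow> 'a univ" where "inj_on f (carrier P)"
    "projective_cover \<Lambda> (transport f P) (\<lambda>y. p (inv_into (carrier P) f y)) X"
proof -
  note D = projective_coverD[OF pc]
  obtain f :: "'b \<Rightarrow> 'a univ" where f: "inj_on f (carrier P)"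
    using fin_gen_embeds[OF D(1)] D(3) by (auto simp: fg_left_module_def)
  show ?thesis
    by (rule that[OF f projective_cover_iso_source[OF pc transport[OF D(1) f]]])
qed

lemma projective_cover_univ_exists:
  fixes P :: "('a, 'b) module"
  assumes "projective_cover \<Lambda> P p X"
  shows "\<exists>(P' :: ('a, 'a univ) module) p'. projective_cover \<Lambda> P' p' X"
  using projective_cover_univ[OF assms] by blast

lemma simples_sum_projective_cover:
  fixes M :: "('a, 'b) module"
  assumes art: "artinian_module \<Lambda> (regular \<Lambda>)" and M: "left_module \<Lambda> M" and "simples_sum \<Lambda> M U"
  shows "\<exists>(P :: ('a, 'a univ) module) p. projective_cover \<Lambda> P p (restr M U)"
  using assms(3)
proof induction
  have Lm: "left_module \<Lambda> (regular \<Lambda>)" using art by (simp add: artinian_module_def)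
  interpret L: left_module \<Lambda> "regular \<Lambda>" by (rule Lm)
  interpret M: left_module \<Lambda> M by fact
  case null
  let ?Z = "restr (regular \<Lambda>) {\<zero>\<^bsub>\<Lambda>\<^esub>}" and ?z = "\<lambda>_ :: 'a. \<zero>\<^bsub>M\<^esub>"
  have zs: "submodule {\<zero>\<^bsub>\<Lambda>\<^esub>} \<Lambda> (regular \<Lambda>)" using L.submodule_null by simp
  note Z = L.left_module_restr[OF zs] and M0 = M.left_module_restr[OF M.submodule_null]
  have sub: "H = {\<zero>\<^bsub>\<Lambda>\<^esub>}" if "submodule H \<Lambda> ?Z" for H
    using submod_subset[OF that] submod_zero[OF that] by auto
  have "projective_cover \<Lambda> ?Z ?z (restr M {\<zero>\<^bsub>M\<^esub>})"
    unfolding projective_cover_def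
  proof (intro conjI allI impI M0)
    show "fg_left_module \<Lambda> ?Z"
      unfolding fg_left_module_def fin_gen_def using Z sub by (intro conjI exI[of _ "{}"]) auto
    show "?z \<in> lmod_hom \<Lambda> ?Z (restr M {\<zero>\<^bsub>M\<^esub>})" using hom_null[OF Z M0] by simp
    show "projective_module \<Lambda> ?Z"
      unfolding projective_module_def
    proof (intro conjI allI impI Z)
      fix B C :: "('a, 'a univ) module" and g h
      assume *: "left_module \<Lambda> B \<and> left_module \<Lambda> C \<and> g \<in> lmod_hom \<Lambda> B C \<and> g ` carrier B = carrier C \<and>
        h \<in> lmod_hom \<Lambda> ?Z C"
      have "g \<zero>\<^bsub>B\<^esub> = h \<zero>\<^bsub>\<Lambda>\<^esub>" using * hom_zero[of g \<Lambda> B C] hom_zero[of h \<Lambda> ?Z C] Z by simp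
      then show "\<exists>k\<in>lmod_hom \<Lambda> ?Z B. \<forall>x\<in>carrier ?Z. g (k x) = h x"
        using * hom_null[OF Z, of B] by (intro bexI[of _ "\<lambda>_. \<zero>\<^bsub>B\<^esub>"]) auto
    qed
  qed (use sub in auto)
  then show ?case by (rule projective_cover_univ_exists)
next
  interpret M: left_module \<Lambda> M by fact
  case (add U T)
  note U = simples_sum_submodule[OF add.hyps(1) M] and T = add.hyps(2,3)
  obtain P :: "('a, 'a univ) module" and p where p: "projective_cover \<Lambda> P p (restr M U)" using add.IH by blast
  from simple_submodule_meet[OF M T U] show ?case
  proof
    assume "T \<subseteq> U"
    then have "U <+>\<^bsub>M\<^esub> T = U"
      by (intro subset_antisym set_add_least[OF U] M.subset_set_add(1)[OF U T(1)]) auto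
    then show ?thesis using p by auto
  next
    assume disj: "U \<inter> T = {\<zero>\<^bsub>M\<^esub>}"
    obtain I t where I: "projective_cover \<Lambda> (restr (regular \<Lambda>) I) (\<lambda>x. x \<odot>\<^bsub>restr M T\<^esub> t) (restr M T)"
      using simple_projective_cover[OF art T(2)] .
    show ?thesis by (rule projective_cover_univ_exists[OF projective_cover_add[OF M U T(1) disj p I]])
  qed
qed

text \<open>The projective cover may have elements of any type; it is first replaced by a copy with elements of the
type used in the definition of the translate.\<close>

lemma minimal_presentation_exists:
  fixes N :: "('a, 'b) module" and Q :: "('a, 'q) module"
  assumes art: "artinian_module \<Lambda> (regular \<Lambda>)" and q: "projective_cover \<Lambda> Q q N"
    and ss: "simples_sum \<Lambda> Q (a_kernel Q N q)"
  shows "\<exists>(P1 :: ('a, 'a univ) module) d (P0 :: ('a, 'a univ) module) e. minimal_presentation \<Lambda> P1 d P0 e N"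
proof -
  note D = projective_coverD[OF q]
  obtain f :: "'q \<Rightarrow> 'a univ" where f: "inj_on f (carrier Q)"
    and e: "projective_cover \<Lambda> (transport f Q) (\<lambda>y. q (inv_into (carrier Q) f y)) N"
    using projective_cover_univ[OF q] .
  let ?P0 = "transport f Q" and ?e = "\<lambda>y. q (inv_into (carrier Q) f y)"
  note tr = transport[OF D(1) f]
  have "f ` a_kernel Q N q = a_kernel ?P0 N ?e"
    using f by (auto simp: a_kernel_eq transport_def)
  then have "simples_sum \<Lambda> ?P0 (a_kernel ?P0 N ?e)"
    using simples_sum_image[OF tr(2) D(1) tr(1) ss] by simp
  then obtain P1 :: "('a, 'a univ) module" and d where "projective_cover \<Lambda> P1 d (syzygy ?P0 ?e N)"
    using simples_sum_projective_cover[OF art tr(1)] unfolding syzygy_def by blast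
  then show ?thesis using e unfolding minimal_presentation_def by blast
qed

text \<open>The translate is formed from a presentation that Hilbert choice picks; nothing but its minimality is
known about it, so statements about the translate have to cover all minimal presentations.\<close>

lemma ar_translate_presentation:
  fixes N :: "('a, 'b) module"
  assumes "\<exists>(P1 :: ('a, 'a univ) module) d (P0 :: ('a, 'a univ) module) e. minimal_presentation \<Lambda> P1 d P0 e N"
  obtains P1 d P0 e where "minimal_presentation \<Lambda> (P1 :: ('a, 'a univ) module) d (P0 :: ('a, 'a univ) module) e N"
    "ar_translate R \<phi> \<Lambda> J N = artin_dual R \<phi> J (transpose_of \<Lambda> P1 d P0)"
proof -
  let ?\<Phi> = "\<lambda>(P1 :: ('a, 'a univ) module, d, P0 :: ('a, 'a univ) module, e). minimal_presentation \<Lambda> P1 d P0 e N"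
  have "\<exists>x. ?\<Phi> x" using assms by auto
  then have "?\<Phi> (SOME x. ?\<Phi> x)" by (rule someI_ex)
  moreover obtain P1 d P0 e where x: "(SOME x. ?\<Phi> x) = (P1, d, P0, e)" by (metis prod_cases4)
  ultimately have "minimal_presentation \<Lambda> P1 d P0 e N" by simp
  moreover have "ar_translate R \<phi> \<Lambda> J N = artin_dual R \<phi> J (transpose_of \<Lambda> P1 d P0)"
    unfolding ar_translate_def x by simp
  ultimately show ?thesis by (rule that)
qed

section \<open>A functional on a simple module\<close>

lemma dualizing_left_module: "dualizing_module R J \<Longrightarrow> left_module R J"
  by (simp add: dualizing_module_def injective_envelope_def injective_module_def)

lemma regular_artinian:
  fixes R :: "'r ring"
  assumes "artinian_cring R" shows "artinian_module R (regular R)"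
proof -
  have cr: "cring R" using assms by (simp add: artinian_cring_def)
  then have R: "ring R" by (simp add: cring_def)
  have "\<exists>n. \<forall>m\<ge>n. H m = H n"
    if "\<forall>n. submodule (H n) R (regular R) \<and> H (Suc n) \<subseteq> H n" for H :: "nat \<Rightarrow> 'r set"
    using that assms submodule_regular_ideal[OF cr] unfolding artinian_cring_def by blast
  then show ?thesis using regular_left_module[OF R] by (simp add: artinian_module_def)
qed

lemma ideal_regular_submodule:
  fixes R :: "'r ring"
  assumes "ideal I R" shows "submodule I R (regular R)"
proof -
  interpret ideal I R by fact
  interpret left_module R "regular R" by (rule regular_left_module) (rule ring_axioms)
  show ?thesis by (rule submoduleI) (auto simp: I_l_closed a_Hcarr)
qed

text \<open>Let \<open>p\<close> be the annihilator of \<open>S\<close> in \<open>R\<close>, a prime ideal since \<open>R\<close> acts on \<open>S\<close> by endomorphisms of a simple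
module. Let \<open>D\<close> be minimal among the ideals not contained in \<open>p\<close> and \<open>b \<in> D\<close>, \<open>b \<notin> p\<close>. For \<open>r \<notin> p\<close> the
ideal \<open>R r b\<close> is not contained in \<open>p\<close> either, so it equals \<open>D\<close> and contains \<open>b\<close>. This has two consequences:
\<open>p\<close> is maximal, and \<open>p b\<close> lies in every maximal ideal, so that \<open>r \<mapsto> r b\<close> induces an embedding of
\<open>R/p\<close> into \<open>R/rad R\<close>.

On the other side take a generating set \<open>X\<close> of \<open>S\<close> over \<open>R\<close> of least cardinality and \<open>a \<in> X\<close>. The
other elements of \<open>X\<close> lie in a proper \<open>R\<close>-submodule \<open>T\<close>, and \<open>S/T\<close> is isomorphic to \<open>R/p\<close>. So
\<open>r a + t \<mapsto> r b\<close> is a well-defined nonzero map from \<open>S\<close> to \<open>R/rad R\<close>, which is contained in \<open>J\<close>.\<close>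

lemma dualizing_functional:
  fixes R :: "'r ring" (structure) and J :: "('r, 'j) module" and S :: "('a, 's) module"
  assumes AA: "artin_algebra R \<phi> \<Lambda>" and DJ: "dualizing_module R J" and S: "simple_module \<Lambda> S"
  obtains \<eta> where "\<eta> \<in> lmod_hom R (restrict_scalars \<phi> S) J" "\<exists>x\<in>carrier S. \<eta> x \<noteq> \<zero>\<^bsub>J\<^esub>"
proof -
  note A = artin_algebra_facts[OF AA]
  have J: "left_module R J" by (rule dualizing_left_module[OF DJ])
  note Sm = simple_left_module[OF S]
  interpret R: cring R by (rule A)
  interpret S: left_module \<Lambda> S by (rule Sm)
  let ?V = "restrict_scalars \<phi> S"
  note Vm = restrict_scalars_left_module[OF A(3,5) Sm]
  interpret V: left_module R ?V by (rule Vm)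
  note RR = regular_left_module[OF A(3)]
  interpret RR: left_module R "regular R" by (rule RR)
  have \<phi>c: "\<phi> r \<in> carrier \<Lambda>" if "r \<in> carrier R" for r using ring_hom_closed[OF A(5) that] .
  have \<phi>m: "\<phi> (r \<otimes> s) = \<phi> r \<otimes>\<^bsub>\<Lambda>\<^esub> \<phi> s" if "r \<in> carrier R" "s \<in> carrier R" for r s
    using ring_hom_mult[OF A(5) that] .
  have central: "\<phi> r \<otimes>\<^bsub>\<Lambda>\<^esub> a = a \<otimes>\<^bsub>\<Lambda>\<^esub> \<phi> r" if "r \<in> carrier R" "a \<in> carrier \<Lambda>" for r a
    using AA that by (simp add: artin_algebra_def)
  obtain s\<^sub>0 where s0: "s\<^sub>0 \<in> carrier S" "s\<^sub>0 \<noteq> \<zero>\<^bsub>S\<^esub>"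
    using S S.M.zero_closed by (auto simp: simple_module_def)
  define p where "p = {r \<in> carrier R. \<forall>x\<in>carrier S. \<phi> r \<odot>\<^bsub>S\<^esub> x = \<zero>\<^bsub>S\<^esub>}"
  have surj: "(\<lambda>x. \<phi> r \<odot>\<^bsub>S\<^esub> x) ` carrier S = carrier S" if r: "r \<in> carrier R" "r \<notin> p" for r
  proof -
    have h: "(\<lambda>x. \<phi> r \<odot>\<^bsub>S\<^esub> x) \<in> lmod_hom \<Lambda> S S"
      by (rule lmod_homI)
        (use \<phi>c[OF r(1)] in \<open>auto simp: S.smult_r_distr S.smult_assoc1[symmetric] central[OF r(1)]\<close>)
    obtain x where "x \<in> carrier S" "\<phi> r \<odot>\<^bsub>S\<^esub> x \<noteq> \<zero>\<^bsub>S\<^esub>" using r by (auto simp: p_def)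
    then show ?thesis by (rule simple_hom_surj[OF S Sm h])
  qed
  have prime: "r \<otimes> s \<notin> p" if r: "r \<in> carrier R" "r \<notin> p" and s: "s \<in> carrier R" "s \<notin> p" for r s
  proof
    assume rs: "r \<otimes> s \<in> p"
    obtain x where x: "x \<in> carrier S" "\<phi> r \<odot>\<^bsub>S\<^esub> x \<noteq> \<zero>\<^bsub>S\<^esub>" using r by (auto simp: p_def)
    have "x \<in> (\<lambda>x. \<phi> s \<odot>\<^bsub>S\<^esub> x) ` carrier S" using surj[OF s] x by simp
    then obtain y where y: "y \<in> carrier S" "x = \<phi> s \<odot>\<^bsub>S\<^esub> y" by blast
    have "\<phi> (r \<otimes> s) \<odot>\<^bsub>S\<^esub> y = \<phi> r \<odot>\<^bsub>S\<^esub> x"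
      using y \<phi>c r(1) s(1) by (simp add: \<phi>m S.smult_assoc1)
    then show False using rs y x(2) by (auto simp: p_def)
  qed
  have p_sub: "submodule p R (regular R)"
    by (rule RR.submoduleI)
      (auto simp: p_def \<phi>c \<phi>m ring_hom_add[OF A(5)] V.smult_l_null[simplified] S.smult_l_distr S.smult_assoc1)
  have p_ideal: "ideal p R" by (rule submodule_regular_ideal[OF A(2) p_sub])
  have pc: "r \<in> carrier R" if "r \<in> p" for r using that by (simp add: p_def)
  have one: "\<one> \<notin> p" using s0 by (auto simp: p_def ring_hom_one[OF A(5)])
  define F where "F = {D. submodule D R (regular R) \<and> \<not> D \<subseteq> p}"
  have "carrier R \<in> F" using RR.submodule_carrier one by (auto simp: F_def)
  moreover have "submodule D R (regular R)" if "D \<in> F" for D using that by (simp add: F_def)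
  ultimately obtain D where DF: "D \<in> F" and Dmin: "\<forall>D'\<in>F. D' \<subseteq> D \<longrightarrow> D' = D"
    by (rule artinian_module_minimal[OF regular_artinian[OF A(1)]])
  have Ds: "submodule D R (regular R)" using DF by (simp add: F_def)
  obtain b where b: "b \<in> D" "b \<notin> p" using DF by (auto simp: F_def)
  have bc: "b \<in> carrier R" using submod_mem[OF Ds b(1)] by simp
  have absorb: "\<exists>c\<in>carrier R. b = c \<otimes> (r \<otimes> b)" if r: "r \<in> carrier R" "r \<notin> p" for r
  proof -
    let ?D = "(\<lambda>c. c \<otimes> (r \<otimes> b)) ` carrier R"
    have sub: "submodule ?D R (regular R)" using RR.submodule_cyclic[of "r \<otimes> b"] r(1) bc by simp
    have "r \<otimes> b \<in> D" using submod_smult[OF Ds r(1) b(1)] by simp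
    then have "?D \<subseteq> D" using submod_smult[OF Ds] by auto
    moreover have "r \<otimes> b \<in> ?D" using r(1) bc by (intro image_eqI[of _ _ "\<one>"]) auto
    then have "?D \<in> F" using sub prime[OF r bc b(2)] by (auto simp: F_def)
    ultimately have "?D = D" using Dmin by simp
    then show ?thesis using b(1) by auto
  qed
  have inverse: "\<exists>c\<in>carrier R. \<one> \<ominus> c \<otimes> r \<in> p" if r: "r \<in> carrier R" "r \<notin> p" for r
  proof -
    obtain c where c: "c \<in> carrier R" "b = c \<otimes> (r \<otimes> b)" using absorb[OF r] by blast
    have eq: "(c \<otimes> r) \<otimes> b = b" using c(2) R.m_assoc[OF c(1) r(1) bc] by simp
    have "(\<one> \<ominus> c \<otimes> r) \<otimes> b = b \<ominus> (c \<otimes> r) \<otimes> b"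
      using c(1) r(1) bc by (simp add: a_minus_def R.l_distr R.l_minus)
    also have "\<dots> = \<zero>" unfolding eq using bc by (simp add: a_minus_def R.r_neg)
    also have "\<dots> \<in> p" using submod_zero[OF p_sub] by simp
    finally have "(\<one> \<ominus> c \<otimes> r) \<otimes> b \<in> p" .
    moreover have "\<one> \<ominus> c \<otimes> r \<in> carrier R" using c(1) r(1) by simp
    ultimately have "\<one> \<ominus> c \<otimes> r \<in> p" using prime[OF _ _ bc b(2)] by blast
    then show ?thesis using c(1) by blast
  qed
  have p_max: "maximalideal p R"
  proof (rule maximalidealI[OF p_ideal])
    show "carrier R \<noteq> p" using one by blast
    fix I assume I: "ideal I R" "p \<subseteq> I" "I \<subseteq> carrier R"
    note Is = ideal_regular_submodule[OF I(1)]
    show "I = p \<or> I = carrier R"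
    proof (rule disjCI)
      assume "I \<noteq> carrier R"
      have "r \<in> p" if r: "r \<in> I" for r
      proof (rule ccontr)
        assume rp: "r \<notin> p"
        have rc: "r \<in> carrier R" using r I(3) by blast
        obtain c where c: "c \<in> carrier R" "\<one> \<ominus> c \<otimes> r \<in> p" using inverse[OF rc rp] by blast
        have "(\<one> \<ominus> c \<otimes> r) \<oplus> c \<otimes> r \<in> I"
          using submod_add[OF Is, of "\<one> \<ominus> c \<otimes> r" "c \<otimes> r"] c I(2) submod_smult[OF Is c(1) r] by auto
        then have "\<one> \<in> I" using c(1) rc by (simp add: a_minus_def R.a_assoc R.l_neg)
        then have "x \<in> I" if "x \<in> carrier R" for x using submod_smult[OF Is that, of "\<one>"] that by simp
        then show False using \<open>I \<noteq> carrier R\<close> I(3) by blast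
      qed
      then show "I = p" using I(2) by blast
    qed
  qed
  have rad_sub: "submodule (rad_cring R) R (regular R)"
  proof (rule RR.submoduleI)
    have I: "submodule I R (regular R)" if "maximalideal I R" for I
      by (rule ideal_regular_submodule[OF maximalideal.axioms(1)[OF that]])
    show "rad_cring R \<subseteq> carrier (regular R)" by (auto simp: rad_cring_def)
    show "\<zero>\<^bsub>regular R\<^esub> \<in> rad_cring R" using submod_zero[OF I] by (auto simp: rad_cring_def)
    show "x \<oplus>\<^bsub>regular R\<^esub> y \<in> rad_cring R" if "x \<in> rad_cring R" "y \<in> rad_cring R" for x y
      using that submod_add[OF I] by (auto simp: rad_cring_def)
    show "c \<odot>\<^bsub>regular R\<^esub> x \<in> rad_cring R" if "c \<in> carrier R" "x \<in> rad_cring R" for c x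
      using that submod_smult[OF I that(1)] by (auto simp: rad_cring_def)
  qed
  have pb: "r \<otimes> b \<in> rad_cring R" if r: "r \<in> p" for r
  proof -
    have rb_p: "r \<otimes> b \<in> p" using ideal.I_r_closed[OF p_ideal r bc] .
    have "r \<otimes> b \<in> I" if I: "maximalideal I R" for I
    proof (cases "I \<subseteq> p")
      case True
      then have "p = I \<or> p = carrier R"
        using maximalideal.I_maximal[OF I p_ideal] pc by blast
      then show ?thesis using rb_p one by auto
    next
      case False
      then obtain i where i: "i \<in> I" "i \<notin> p" by blast
      have Ii: "ideal I R" using I by (simp add: maximalideal_def)
      have ic: "i \<in> carrier R" using ideal.Icarr[OF Ii i(1)] .
      obtain c where c: "c \<in> carrier R" "b = c \<otimes> (i \<otimes> b)" using absorb[OF ic i(2)] by blast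
      have "c \<otimes> (i \<otimes> b) \<in> I"
        by (rule ideal.I_l_closed[OF Ii ideal.I_r_closed[OF Ii i(1) bc] c(1)])
      then have "b \<in> I" using c(2) by simp
      then show ?thesis by (rule ideal.I_l_closed[OF Ii _ pc[OF r]])
    qed
    then show ?thesis using pc[OF r] bc by (auto simp: rad_cring_def)
  qed
  have b_rad: "b \<notin> rad_cring R" using b(2) p_max by (auto simp: rad_cring_def)
  let ?K = "quot_mod (regular R) (rad_cring R)" and ?pr = "\<lambda>r. rad_cring R +>\<^bsub>regular R\<^esub> r"
  note K = RR.left_module_quot[OF rad_sub] and pr = RR.quot_proj_hom[OF rad_sub]
  have fgV: "fin_gen R ?V"
  proof -
    have "(\<lambda>x. x \<odot>\<^bsub>S\<^esub> s\<^sub>0) \<in> lmod_hom R (restrict_scalars \<phi> (regular \<Lambda>)) ?V"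
      by (rule lmod_homI) (use s0 \<phi>c in \<open>auto simp: S.smult_l_distr S.smult_assoc1\<close>)
    then show ?thesis
      by (rule fin_gen_image[OF _ restrict_scalars_left_module[OF A(3,5) regular_left_module[OF A(4)]] Vm _ A(6)])
        (use simple_cyclic[OF S s0] in simp)
  qed
  define gen where "gen X \<longleftrightarrow> finite X \<and> X \<subseteq> carrier S \<and> (\<forall>H. submodule H R ?V \<and> X \<subseteq> H \<longrightarrow> H = carrier S)" for X
  have "\<exists>X. gen X" using fgV by (auto simp: fin_gen_def gen_def)
  then obtain X where X: "gen X" and Xmin: "\<forall>Y. gen Y \<longrightarrow> card X \<le> card Y"
    using ex_has_least_nat[of gen _ card] by blast
  have "X \<noteq> {}"
  proof
    assume "X = {}"
    then have "{\<zero>\<^bsub>S\<^esub>} = carrier S" using X V.submodule_null by (simp add: gen_def)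
    then show False using s0 by blast
  qed
  then obtain a where a: "a \<in> X" by blast
  have aS: "a \<in> carrier S" using X a by (auto simp: gen_def)
  have "card (X - {a}) < card X" using a X by (intro psubset_card_mono) (auto simp: gen_def)
  then have "\<not> gen (X - {a})" using Xmin by (meson not_le)
  then obtain T where T: "submodule T R ?V" "X - {a} \<subseteq> T" "T \<noteq> carrier S" using X by (auto simp: gen_def)
  have aT: "a \<notin> T" using X T by (auto simp: gen_def)
  have TA: "r \<in> p" if r: "r \<in> carrier R" "\<phi> r \<odot>\<^bsub>S\<^esub> a \<in> T" for r
  proof (rule ccontr)
    assume "r \<notin> p"
    then obtain c where c: "c \<in> carrier R" "\<one> \<ominus> c \<otimes> r \<in> p" using inverse r by blast
    have "(\<one> \<ominus> c \<otimes> r) \<odot>\<^bsub>?V\<^esub> a = \<zero>\<^bsub>?V\<^esub>" using c(2) aS by (simp add: p_def)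
    moreover have "(\<one> \<ominus> c \<otimes> r) \<odot>\<^bsub>?V\<^esub> a = \<one> \<odot>\<^bsub>?V\<^esub> a \<ominus>\<^bsub>?V\<^esub> (c \<otimes> r) \<odot>\<^bsub>?V\<^esub> a"
      by (rule V.smult_l_diff) (use c r aS in auto)
    moreover have "\<one> \<odot>\<^bsub>?V\<^esub> a = a" by (rule V.smult_one) (use aS in simp)
    moreover have "(c \<otimes> r) \<odot>\<^bsub>?V\<^esub> a = c \<odot>\<^bsub>?V\<^esub> (r \<odot>\<^bsub>?V\<^esub> a)"
      by (rule V.smult_assoc1) (use c r aS in auto)
    ultimately have "a \<ominus>\<^bsub>?V\<^esub> c \<odot>\<^bsub>?V\<^esub> (r \<odot>\<^bsub>?V\<^esub> a) = \<zero>\<^bsub>?V\<^esub>" by metis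
    then have "a = c \<odot>\<^bsub>?V\<^esub> (r \<odot>\<^bsub>?V\<^esub> a)"
      by (subst (asm) V.diff_eq_zero) (use aS c(1) r(1) \<phi>c in auto)
    moreover have "c \<odot>\<^bsub>?V\<^esub> (r \<odot>\<^bsub>?V\<^esub> a) \<in> T" by (rule submod_smult[OF T(1) c(1)]) (use r(2) in simp)
    ultimately show False using aT by simp
  qed
  note TV = V.left_module_restr[OF T(1)]
  \<comment> \<open>\<open>r a + t \<mapsto> r b\<close> is obtained by factoring \<open>(r, t) \<mapsto> r b\<close> through \<open>(r, t) \<mapsto> r a + t\<close>.\<close>
  let ?B = "prod_mod (regular R) (restr ?V T)"
  note Bm = prod_left_module[OF RR TV]
  have aV: "a \<in> carrier ?V" using aS by simp
  have m1: "(\<lambda>r. r \<odot>\<^bsub>?V\<^esub> a) \<in> lmod_hom R (regular R) ?V" by (rule hom_smult_right[OF hom_id Vm aV])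
  have m2: "(\<lambda>x. x) \<in> lmod_hom R (restr ?V T) ?V" by (rule hom_from_restr[OF hom_id submod_subset[OF T(1)]])
  note m = hom_from_prod[OF RR TV Vm m1 m2]
  let ?m = "\<lambda>z. fst z \<odot>\<^bsub>?V\<^esub> a \<oplus>\<^bsub>?V\<^esub> snd z"
  have m_surj: "?m ` carrier ?B = carrier ?V"
  proof -
    note img = submodule_image[OF m Bm Vm left_module.submodule_carrier[OF Bm]]
    have "X \<subseteq> ?m ` carrier ?B"
    proof
      fix x assume x: "x \<in> X"
      show "x \<in> ?m ` carrier ?B"
      proof (cases "x = a")
        case True
        have "?m (\<one>, \<zero>\<^bsub>S\<^esub>) = a" using aS by (simp add: ring_hom_one[OF A(5)])
        then show ?thesis
          using True submod_zero[OF T(1)] by (intro image_eqI[of _ _ "(\<one>, \<zero>\<^bsub>S\<^esub>)"]) auto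
      next
        case False
        then have xT: "x \<in> T" using x T(2) by blast
        then have xV: "x \<in> carrier ?V" by (rule submod_mem[OF T(1)])
        have "?m (\<zero>, x) = x" using V.smult_l_null[OF aV] xV by simp
        then show ?thesis using xT by (intro image_eqI[of _ _ "(\<zero>, x)"]) auto
      qed
    qed
    then show ?thesis using X img by (simp add: gen_def)
  qed
  have g: "(\<lambda>z. ?pr (fst z \<otimes> b)) \<in> lmod_hom R ?B ?K"
  proof -
    have "(\<lambda>r. r \<otimes> b) \<in> lmod_hom R (regular R) (regular R)"
      using hom_smult_right[OF hom_id RR, of b] bc by simp
    from hom_comp[OF hom_comp[OF prod_projections(1) this] pr] show ?thesis .
  qed
  have ker: "?pr (fst z \<otimes> b) = \<zero>\<^bsub>?K\<^esub>" if z: "z \<in> carrier ?B" "?m z = \<zero>\<^bsub>?V\<^esub>" for z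
  proof -
    have zc: "fst z \<in> carrier R" "snd z \<in> T" using z(1) by auto
    have sV: "snd z \<in> carrier ?V" by (rule submod_mem[OF T(1) zc(2)])
    have rV: "fst z \<odot>\<^bsub>?V\<^esub> a \<in> carrier ?V" using zc aV by (intro V.smult_closed)
    have "fst z \<odot>\<^bsub>?V\<^esub> a = \<zero>\<^bsub>?V\<^esub> \<ominus>\<^bsub>?V\<^esub> snd z" using z(2) V.add_diff_cancel[OF rV sV] by simp
    also have "\<dots> \<in> T" by (rule submod_diff[OF T(1) submod_zero[OF T(1)] zc(2)])
    finally have "fst z \<in> p" using TA[OF zc(1)] by simp
    then show ?thesis
      using pb RR.quot_proj_eq_zero[OF rad_sub, of "fst z \<otimes> b"] zc(1) bc by simp
  qed
  obtain h where h: "h \<in> lmod_hom R ?V ?K" "\<And>z. z \<in> carrier ?B \<Longrightarrow> h (?m z) = ?pr (fst z \<otimes> b)"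
    using hom_factor[OF m g Bm Vm K m_surj ker] by blast
  have "h (?m (\<one>, \<zero>\<^bsub>S\<^esub>)) = ?pr b" using h(2)[of "(\<one>, \<zero>\<^bsub>S\<^esub>)"] submod_zero[OF T(1)] bc by simp
  moreover have "?m (\<one>, \<zero>\<^bsub>S\<^esub>) = a" using aS by (simp add: ring_hom_one[OF A(5)])
  ultimately have ha: "h a \<noteq> \<zero>\<^bsub>?K\<^esub>"
    using b_rad RR.quot_proj_eq_zero[OF rad_sub, of b] bc by simp
  obtain i where i: "i \<in> lmod_hom R ?K J" "inj_on i (carrier ?K)"
    using DJ unfolding dualizing_module_def injective_envelope_def by blast
  have "i (h a) \<noteq> \<zero>\<^bsub>J\<^esub>" using ha i hom_inj_iff[OF i(1) K J] hom_closed[OF h(1) aV] by blast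
  then show ?thesis using hom_comp[OF h(1) i(1)] aS by (intro that[of "\<lambda>x. i (h x)"]) auto
qed

section \<open>Homomorphisms into the Auslander-Reiten translate\<close>

lemma op_ring_simps [simp]:
  "carrier (op_ring \<Lambda>) = carrier \<Lambda>" "\<zero>\<^bsub>op_ring \<Lambda>\<^esub> = \<zero>\<^bsub>\<Lambda>\<^esub>" "\<one>\<^bsub>op_ring \<Lambda>\<^esub> = \<one>\<^bsub>\<Lambda>\<^esub>"
  "x \<oplus>\<^bsub>op_ring \<Lambda>\<^esub> y = x \<oplus>\<^bsub>\<Lambda>\<^esub> y" "x \<otimes>\<^bsub>op_ring \<Lambda>\<^esub> y = y \<otimes>\<^bsub>\<Lambda>\<^esub> x"
  by (simp_all add: op_ring_def)

lemma regular_dual_simps: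
  "carrier (regular_dual \<Lambda> P) = lmod_hom \<Lambda> P (regular \<Lambda>) \<inter> extensional (carrier P)"
  "\<zero>\<^bsub>regular_dual \<Lambda> P\<^esub> = (\<lambda>x\<in>carrier P. \<zero>\<^bsub>\<Lambda>\<^esub>)"
  "f \<oplus>\<^bsub>regular_dual \<Lambda> P\<^esub> g = (\<lambda>x\<in>carrier P. f x \<oplus>\<^bsub>\<Lambda>\<^esub> g x)"
  "a \<odot>\<^bsub>regular_dual \<Lambda> P\<^esub> f = (\<lambda>x\<in>carrier P. f x \<otimes>\<^bsub>\<Lambda>\<^esub> a)"
  by (simp_all add: regular_dual_def)

lemma artin_dual_simps:
  "carrier (artin_dual R \<phi> J X) = lmod_hom R (restrict_scalars \<phi> X) J \<inter> extensional (carrier X)"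
  "\<zero>\<^bsub>artin_dual R \<phi> J X\<^esub> = (\<lambda>x\<in>carrier X. \<zero>\<^bsub>J\<^esub>)"
  "f \<oplus>\<^bsub>artin_dual R \<phi> J X\<^esub> g = (\<lambda>x\<in>carrier X. f x \<oplus>\<^bsub>J\<^esub> g x)"
  "a \<odot>\<^bsub>artin_dual R \<phi> J X\<^esub> f = (\<lambda>x\<in>carrier X. f (a \<odot>\<^bsub>X\<^esub> x))"
  by (simp_all add: artin_dual_def)

text \<open>Additive structure does not see the scalars, so sums are the same elements before and after a change
of rings.\<close>

lemma finsum_restrict_scalars: "finsum (restrict_scalars \<phi> M) f A = finsum M f A"
  by (simp add: finsum_def finprod_def restrict_scalars_def)

lemma finsum_regular_op: "finsum (regular (op_ring \<Lambda>)) f A = finsum (regular \<Lambda>) f A"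
  by (simp add: finsum_def finprod_def regular_def op_ring_def)

lemma op_ring_hom:
  assumes "artin_algebra R \<phi> \<Lambda>" shows "\<phi> \<in> ring_hom R (op_ring \<Lambda>)"
proof -
  have \<phi>: "\<phi> \<in> ring_hom R \<Lambda>" by (rule artin_algebra_facts[OF assms])
  have central: "\<phi> r \<otimes>\<^bsub>\<Lambda>\<^esub> a = a \<otimes>\<^bsub>\<Lambda>\<^esub> \<phi> r" if "r \<in> carrier R" "a \<in> carrier \<Lambda>" for r a
    using assms that by (simp add: artin_algebra_def)
  show ?thesis
  proof (rule ring_hom_memI)
    fix r s assume rs: "r \<in> carrier R" "s \<in> carrier R"
    show "\<phi> (r \<otimes>\<^bsub>R\<^esub> s) = \<phi> r \<otimes>\<^bsub>op_ring \<Lambda>\<^esub> \<phi> s"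
      unfolding op_ring_simps ring_hom_mult[OF \<phi> rs] by (rule central[OF rs(1) ring_hom_closed[OF \<phi> rs(2)]])
  qed (simp_all add: ring_hom_closed[OF \<phi>] ring_hom_add[OF \<phi>] ring_hom_one[OF \<phi>])
qed

lemma hom_restrict_scalars:
  assumes "f \<in> lmod_hom \<Lambda> M N" "\<phi> \<in> ring_hom R \<Lambda>"
  shows "f \<in> lmod_hom R (restrict_scalars \<phi> M) (restrict_scalars \<phi> N)"
  by (rule lmod_homI)
    (use assms(1) ring_hom_closed[OF assms(2)] in \<open>auto simp: hom_closed[OF assms(1)] hom_add hom_smult\<close>)

lemma regular_dual_eval:
  assumes "x \<in> carrier P"
  shows "(\<lambda>g. g x) \<in> lmod_hom (op_ring \<Lambda>) (regular_dual \<Lambda> P) (regular (op_ring \<Lambda>))"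
  using assms by (auto simp: lmod_hom_def regular_dual_simps)

lemma regular_dual_map:
  assumes P: "left_module \<Lambda> P" and d: "d \<in> lmod_hom \<Lambda> P Q"
  shows "(\<lambda>f. compose (carrier P) f d) \<in> lmod_hom (op_ring \<Lambda>) (regular_dual \<Lambda> Q) (regular_dual \<Lambda> P)"
proof (rule lmod_homI)
  interpret P: left_module \<Lambda> P by fact
  fix f assume f: "f \<in> carrier (regular_dual \<Lambda> Q)"
  have "compose (carrier P) f d \<in> lmod_hom \<Lambda> P (regular \<Lambda>)"
    by (rule hom_cong[OF hom_comp[OF d] P, of f]) (use f in \<open>auto simp: regular_dual_simps compose_def\<close>)
  then show "compose (carrier P) f d \<in> carrier (regular_dual \<Lambda> P)"
    by (auto simp: regular_dual_simps compose_def)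
qed (use hom_closed[OF d] in \<open>auto simp: regular_dual_simps compose_def fun_eq_iff\<close>)

lemma transpose_facts:
  assumes P1: "left_module \<Lambda> P1" and d: "d \<in> lmod_hom \<Lambda> P1 P0" and P0: "left_module \<Lambda> P0"
  defines "B \<equiv> (\<lambda>f. compose (carrier P1) f d) ` carrier (regular_dual \<Lambda> P0)"
  shows "left_module (op_ring \<Lambda>) (regular_dual \<Lambda> P1)" "submodule B (op_ring \<Lambda>) (regular_dual \<Lambda> P1)"
    "left_module (op_ring \<Lambda>) (transpose_of \<Lambda> P1 d P0)"
    "(\<lambda>g. B +>\<^bsub>regular_dual \<Lambda> P1\<^esub> g) \<in> lmod_hom (op_ring \<Lambda>) (regular_dual \<Lambda> P1) (transpose_of \<Lambda> P1 d P0)"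
    "(\<lambda>g. B +>\<^bsub>regular_dual \<Lambda> P1\<^esub> g) ` carrier (regular_dual \<Lambda> P1) = carrier (transpose_of \<Lambda> P1 d P0)"
    "\<And>g. g \<in> carrier (regular_dual \<Lambda> P1) \<Longrightarrow>
      B +>\<^bsub>regular_dual \<Lambda> P1\<^esub> g = \<zero>\<^bsub>transpose_of \<Lambda> P1 d P0\<^esub> \<longleftrightarrow> g \<in> B"
proof -
  note W = regular_dual_left_module[OF P1] and W0 = regular_dual_left_module[OF P0]
  show "left_module (op_ring \<Lambda>) (regular_dual \<Lambda> P1)" by (rule W)
  show B: "submodule B (op_ring \<Lambda>) (regular_dual \<Lambda> P1)"
    unfolding B_def
    by (rule submodule_image[OF regular_dual_map[OF P1 d] W0 W left_module.submodule_carrier[OF W0]])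
  have X: "transpose_of \<Lambda> P1 d P0 = quot_mod (regular_dual \<Lambda> P1) B" by (simp add: transpose_of_def B_def)
  show "left_module (op_ring \<Lambda>) (transpose_of \<Lambda> P1 d P0)"
    unfolding X by (rule left_module.left_module_quot[OF W B])
  show "(\<lambda>g. B +>\<^bsub>regular_dual \<Lambda> P1\<^esub> g) \<in> lmod_hom (op_ring \<Lambda>) (regular_dual \<Lambda> P1) (transpose_of \<Lambda> P1 d P0)"
    unfolding X by (rule left_module.quot_proj_hom[OF W B])
  show "(\<lambda>g. B +>\<^bsub>regular_dual \<Lambda> P1\<^esub> g) ` carrier (regular_dual \<Lambda> P1) = carrier (transpose_of \<Lambda> P1 d P0)"
    unfolding X by (rule left_module.quot_mod_facts(1)[OF W B])
  show "B +>\<^bsub>regular_dual \<Lambda> P1\<^esub> g = \<zero>\<^bsub>transpose_of \<Lambda> P1 d P0\<^esub> \<longleftrightarrow> g \<in> B"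
    if "g \<in> carrier (regular_dual \<Lambda> P1)" for g
    unfolding X by (rule left_module.quot_proj_eq_zero[OF W B that])
qed

lemma minimal_presentationD:
  assumes "minimal_presentation \<Lambda> P1 d P0 e N"
  shows "projective_cover \<Lambda> P0 e N" "projective_cover \<Lambda> P1 d (restr P0 (a_kernel P0 N e))"
    "d \<in> lmod_hom \<Lambda> P1 P0"
proof -
  show 1: "projective_cover \<Lambda> P0 e N" "projective_cover \<Lambda> P1 d (restr P0 (a_kernel P0 N e))"
    using assms by (simp_all add: minimal_presentation_def syzygy_def)
  show "d \<in> lmod_hom \<Lambda> P1 P0"
    by (rule hom_into_restr[OF projective_coverD(5)[OF 1(2)]]) (auto simp: a_kernel_eq)
qed

text \<open>Let \<open>f : N \<rightarrow> D (Tr N)\<close> and let \<open>\<psi>\<close>, \<open>a\<close> be a dual basis of \<open>P1\<close>. Each \<open>g : P1 \<rightarrow> \<Lambda>\<close> is the sum of the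
\<open>x \<mapsto> \<psi>\<^sub>i x \<cdot> g a\<^sub>i\<close>, and linearity of \<open>f\<close> gives \<open>f m [\<psi>\<^sub>i \<cdot> g a\<^sub>i] = f (g a\<^sub>i \<cdot> m) [\<psi>\<^sub>i]\<close>. Here
\<open>g a\<^sub>i \<cdot> m\<close> is the value at \<open>a\<^sub>i\<close> of the homomorphism \<open>x \<mapsto> g x \<cdot> m\<close> from \<open>P1\<close> to \<open>N\<close>, which is zero.\<close>

lemma tau_rigidI:
  fixes N :: "('a, 'b) module"
  assumes AA: "artin_algebra R \<phi> \<Lambda>" and J: "left_module R J" and N: "left_module \<Lambda> N"
    and ex: "\<exists>(P1 :: ('a, 'a univ) module) d (P0 :: ('a, 'a univ) module) e. minimal_presentation \<Lambda> P1 d P0 e N"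
    and no_homs: "\<And>(P1 :: ('a, 'a univ) module) d (P0 :: ('a, 'a univ) module) e h x.
      minimal_presentation \<Lambda> P1 d P0 e N \<Longrightarrow> h \<in> lmod_hom \<Lambda> P1 N \<Longrightarrow> x \<in> carrier P1 \<Longrightarrow> h x = \<zero>\<^bsub>N\<^esub>"
  shows "tau_rigid R \<phi> \<Lambda> J N"
proof -
  obtain P1 d P0 e where mp: "minimal_presentation \<Lambda> (P1 :: ('a, 'a univ) module) d (P0 :: ('a, 'a univ) module) e N"
    and tau: "ar_translate R \<phi> \<Lambda> J N = artin_dual R \<phi> J (transpose_of \<Lambda> P1 d P0)"
    using ar_translate_presentation[OF ex] .
  note mpD = minimal_presentationD[OF mp]
  note D1 = projective_coverD[OF mpD(2)] and D0 = projective_coverD[OF mpD(1)]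
  interpret N: left_module \<Lambda> N by fact
  interpret J: left_module R J by fact
  let ?W = "regular_dual \<Lambda> P1" and ?X = "transpose_of \<Lambda> P1 d P0"
  define B where "B = (\<lambda>f. compose (carrier P1) f d) ` carrier (regular_dual \<Lambda> P0)"
  note tr = transpose_facts[OF D1(1) mpD(3) D0(1), folded B_def]
  interpret W: left_module "op_ring \<Lambda>" ?W by (rule tr)
  interpret X: left_module "op_ring \<Lambda>" ?X by (rule tr)
  let ?cl = "\<lambda>g. B +>\<^bsub>?W\<^esub> g" and ?D = "artin_dual R \<phi> J ?X"
  note D = artin_dual_left_module[OF AA J tr(3)]
  note A = artin_algebra_facts[OF AA] and \<phi>op = op_ring_hom[OF AA]
  note RW = restrict_scalars_left_module[OF A(3) \<phi>op tr(1)]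
  have cl: "?cl \<in> lmod_hom R (restrict_scalars \<phi> ?W) (restrict_scalars \<phi> ?X)"
    by (rule hom_restrict_scalars[OF tr(4) \<phi>op])
  obtain n :: nat and a \<psi> where a: "\<forall>i<n. a i \<in> carrier P1"
    and \<psi>: "\<forall>i<n. \<psi> i \<in> lmod_hom \<Lambda> P1 (regular \<Lambda>)"
    and basis: "\<forall>x\<in>carrier P1. x = (\<Oplus>\<^bsub>P1\<^esub>i\<in>{..<n}. \<psi> i x \<odot>\<^bsub>P1\<^esub> a i)"
    by (rule dual_basis[OF D1(3,4)])
  define \<psi>' where "\<psi>' i = restrict (\<psi> i) (carrier P1)" for i
  have \<psi>'W: "\<psi>' i \<in> carrier ?W" if "i < n" for i
    using that \<psi> hom_cong[OF _ D1(1), of "\<psi> i" "regular \<Lambda>" "\<psi>' i"] by (auto simp: regular_dual_simps \<psi>'_def)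
  have \<psi>c: "\<psi> i x \<in> carrier \<Lambda>" if "i < n" "x \<in> carrier P1" for i x
    using hom_closed[OF \<psi>[rule_format, OF that(1)] that(2)] by simp
  have "f m = \<zero>\<^bsub>?D\<^esub>" if f: "f \<in> lmod_hom \<Lambda> N ?D" and m: "m \<in> carrier N" for f m
  proof -
    have fD: "f m \<in> lmod_hom R (restrict_scalars \<phi> ?X) J" "f m \<in> extensional (carrier ?X)" if "m \<in> carrier N" for m
      using hom_closed[OF f that] by (auto simp: artin_dual_simps)
    have "f m c = \<zero>\<^bsub>J\<^esub>" if c: "c \<in> carrier ?X" for c
    proof -
      have "c \<in> ?cl ` carrier ?W" using c tr(5) by simp
      then obtain g where g: "g \<in> carrier ?W" "c = ?cl g" by blast
      have gh: "g \<in> lmod_hom \<Lambda> P1 (regular \<Lambda>)" "g \<in> extensional (carrier P1)"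
        using g(1) by (auto simp: regular_dual_simps)
      have gc: "g (a i) \<in> carrier \<Lambda>" if "i < n" for i using hom_closed[OF gh(1)] a that by simp
      let ?t = "\<lambda>i. g (a i) \<odot>\<^bsub>?W\<^esub> \<psi>' i"
      have tW: "?t i \<in> carrier ?W" if "i < n" for i using gc[OF that] \<psi>'W[OF that] by simp
      have g_sum: "g = (\<Oplus>\<^bsub>?W\<^esub>i\<in>{..<n}. ?t i)"
      proof (rule extensionalityI[OF gh(2)])
        have "(\<Oplus>\<^bsub>?W\<^esub>i\<in>{..<n}. ?t i) \<in> carrier ?W" using tW by (intro W.M.finsum_closed) auto
        then show "(\<Oplus>\<^bsub>?W\<^esub>i\<in>{..<n}. ?t i) \<in> extensional (carrier P1)" by (auto simp: regular_dual_simps)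
        fix x assume x: "x \<in> carrier P1"
        interpret L: left_module \<Lambda> "regular \<Lambda>" by (rule regular_left_module[OF A(4)])
        have "g x = g (\<Oplus>\<^bsub>P1\<^esub>i\<in>{..<n}. \<psi> i x \<odot>\<^bsub>P1\<^esub> a i)" using basis x by simp
        also have "\<dots> = (\<Oplus>\<^bsub>regular \<Lambda>\<^esub>i\<in>{..<n}. g (\<psi> i x \<odot>\<^bsub>P1\<^esub> a i))"
          by (rule hom_finsum[OF gh(1) D1(1) L.left_module_axioms])
            (use \<psi>c x a D1(1) in \<open>auto intro: left_module.smult_closed\<close>)
        also have "\<dots> = (\<Oplus>\<^bsub>regular \<Lambda>\<^esub>i\<in>{..<n}. ?t i x)"
          by (rule L.M.finsum_cong')
            (use \<psi>c x a gc in \<open>auto simp: hom_smult[OF gh(1)] regular_dual_simps \<psi>'_def\<close>)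
        also have "\<dots> = (\<Oplus>\<^bsub>regular (op_ring \<Lambda>)\<^esub>i\<in>{..<n}. ?t i x)" by (rule finsum_regular_op[symmetric])
        also have "\<dots> = (\<Oplus>\<^bsub>?W\<^esub>i\<in>{..<n}. ?t i) x"
          by (rule hom_finsum[OF regular_dual_eval[OF x] tr(1) regular_left_module[OF op_ring_ring[OF A(4)]] tW, symmetric])
        finally show "g x = (\<Oplus>\<^bsub>?W\<^esub>i\<in>{..<n}. ?t i) x" .
      qed
      have G: "(\<lambda>w. f m (?cl w)) \<in> lmod_hom R (restrict_scalars \<phi> ?W) J" by (rule hom_comp[OF cl fD(1)[OF m]])
      have zero: "f m (?cl (?t i)) = \<zero>\<^bsub>J\<^esub>" if i: "i < n" for i
      proof -
        have clX: "?cl (\<psi>' i) \<in> carrier ?X" by (rule hom_closed[OF tr(4) \<psi>'W[OF i]])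
        have "?cl (?t i) = g (a i) \<odot>\<^bsub>?X\<^esub> ?cl (\<psi>' i)"
          using hom_smult[OF tr(4) _ \<psi>'W[OF i]] gc[OF i] by simp
        then have "f m (?cl (?t i)) = (g (a i) \<odot>\<^bsub>?D\<^esub> f m) (?cl (\<psi>' i))"
          using clX by (simp add: artin_dual_simps)
        also have "g (a i) \<odot>\<^bsub>?D\<^esub> f m = f (g (a i) \<odot>\<^bsub>N\<^esub> m)" using hom_smult[OF f gc[OF i] m] by simp
        also have "g (a i) \<odot>\<^bsub>N\<^esub> m = \<zero>\<^bsub>N\<^esub>"
          using no_homs[OF mp hom_smult_right[OF gh(1) N m]] a i by simp
        also have "f \<zero>\<^bsub>N\<^esub> = \<zero>\<^bsub>?D\<^esub>" by (rule hom_zero[OF f N D])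
        also have "\<zero>\<^bsub>?D\<^esub> (?cl (\<psi>' i)) = \<zero>\<^bsub>J\<^esub>" using clX by (simp add: artin_dual_simps)
        finally show ?thesis .
      qed
      have "f m c = f m (?cl (\<Oplus>\<^bsub>?W\<^esub>i\<in>{..<n}. ?t i))" using g(2) g_sum by simp
      also have "\<dots> = f m (?cl (\<Oplus>\<^bsub>restrict_scalars \<phi> ?W\<^esub>i\<in>{..<n}. ?t i))" by (simp only: finsum_restrict_scalars)
      also have "\<dots> = (\<Oplus>\<^bsub>J\<^esub>i\<in>{..<n}. f m (?cl (?t i)))"
        by (rule hom_finsum[OF G RW J]) (use tW in simp)
      also have "\<dots> = (\<Oplus>\<^bsub>J\<^esub>i\<in>{..<n}. \<zero>\<^bsub>J\<^esub>)" by (rule J.M.finsum_cong') (use zero in auto)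
      also have "\<dots> = \<zero>\<^bsub>J\<^esub>" by (rule J.M.finsum_zero)
      finally show ?thesis .
    qed
    then show ?thesis
      using fD(2)[OF m] by (intro extensionalityI[of "f m" "carrier ?X"]) (auto simp: artin_dual_simps)
  qed
  then show ?thesis unfolding tau_rigid_def tau by blast
qed

text \<open>Take \<open>h\<close> and \<open>q\<close> with \<open>\<eta> (s (h q)) \<noteq> 0\<close> and define \<open>f m [g] = \<eta> (g q \<cdot> s m)\<close>. This depends only on the class
of \<open>g\<close>: if \<open>g\<close> factors as \<open>g' \<circ> d\<close>, then \<open>g q \<cdot> s m\<close> is the value at \<open>d q\<close> of the map
\<open>x \<mapsto> g' x \<cdot> s m\<close> from \<open>P0\<close> to the simple module \<open>S\<close>, and \<open>d q\<close> lies in the kernel of the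
projective cover \<open>P0 \<rightarrow> N\<close>. If \<open>f\<close> were zero, then expanding \<open>q\<close> in a dual basis of \<open>P1\<close> would
give \<open>\<eta> (s (h q)) = 0\<close>.\<close>

lemma not_tau_rigidI:
  fixes N :: "('a, 'b) module"
  assumes AA: "artin_algebra R \<phi> \<Lambda>" and J: "left_module R J" and N: "left_module \<Lambda> N"
    and ex: "\<exists>(P1 :: ('a, 'a univ) module) d (P0 :: ('a, 'a univ) module) e. minimal_presentation \<Lambda> P1 d P0 e N"
    and S: "simple_module \<Lambda> S" and s: "s \<in> lmod_hom \<Lambda> N S"
    and \<eta>: "\<eta> \<in> lmod_hom R (restrict_scalars \<phi> S) J"
    and hom: "\<And>(P1 :: ('a, 'a univ) module) d (P0 :: ('a, 'a univ) module) e. minimal_presentation \<Lambda> P1 d P0 e N \<Longrightarrow>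
      \<exists>h\<in>lmod_hom \<Lambda> P1 N. \<exists>x\<in>carrier P1. \<eta> (s (h x)) \<noteq> \<zero>\<^bsub>J\<^esub>"
  shows "\<not> tau_rigid R \<phi> \<Lambda> J N"
proof
  assume rigid: "tau_rigid R \<phi> \<Lambda> J N"
  obtain P1 d P0 e where mp: "minimal_presentation \<Lambda> (P1 :: ('a, 'a univ) module) d (P0 :: ('a, 'a univ) module) e N"
    and tau: "ar_translate R \<phi> \<Lambda> J N = artin_dual R \<phi> J (transpose_of \<Lambda> P1 d P0)"
    using ar_translate_presentation[OF ex] .
  obtain h q where h: "h \<in> lmod_hom \<Lambda> P1 N" and q: "q \<in> carrier P1" and nz: "\<eta> (s (h q)) \<noteq> \<zero>\<^bsub>J\<^esub>"
    using hom[OF mp] by blast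
  note mpD = minimal_presentationD[OF mp]
  note D1 = projective_coverD[OF mpD(2)] and D0 = projective_coverD[OF mpD(1)]
  note Sm = simple_left_module[OF S]
  interpret N: left_module \<Lambda> N by fact
  interpret J: left_module R J by fact
  interpret S: left_module \<Lambda> S by (rule Sm)
  interpret P1: left_module \<Lambda> P1 by (rule D1)
  let ?W = "regular_dual \<Lambda> P1" and ?X = "transpose_of \<Lambda> P1 d P0"
  define B where "B = (\<lambda>f. compose (carrier P1) f d) ` carrier (regular_dual \<Lambda> P0)"
  note tr = transpose_facts[OF D1(1) mpD(3) D0(1), folded B_def]
  interpret W: left_module "op_ring \<Lambda>" ?W by (rule tr)
  interpret X: left_module "op_ring \<Lambda>" ?X by (rule tr)
  let ?cl = "\<lambda>g. B +>\<^bsub>?W\<^esub> g" and ?D = "artin_dual R \<phi> J ?X"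
  note D = artin_dual_left_module[OF AA J tr(3)]
  note A = artin_algebra_facts[OF AA] and \<phi>op = op_ring_hom[OF AA]
  note RW = restrict_scalars_left_module[OF A(3) \<phi>op tr(1)]
    and RX = restrict_scalars_left_module[OF A(3) \<phi>op tr(3)]
    and RS = restrict_scalars_left_module[OF A(3,5) Sm]
  have cl: "?cl \<in> lmod_hom R (restrict_scalars \<phi> ?W) (restrict_scalars \<phi> ?X)"
    by (rule hom_restrict_scalars[OF tr(4) \<phi>op])
  have central: "\<phi> r \<otimes>\<^bsub>\<Lambda>\<^esub> a = a \<otimes>\<^bsub>\<Lambda>\<^esub> \<phi> r" if "r \<in> carrier R" "a \<in> carrier \<Lambda>" for r a
    using AA that by (simp add: artin_algebra_def)
  have \<phi>c: "\<phi> r \<in> carrier \<Lambda>" if "r \<in> carrier R" for r using ring_hom_closed[OF A(5) that] .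
  have gq: "g q \<in> carrier \<Lambda>" if "g \<in> carrier ?W" for g
    using that hom_closed[of g \<Lambda> P1 "regular \<Lambda>" q] q by (auto simp: regular_dual_simps)
  note \<eta>_add = hom_add[OF \<eta>, simplified] and \<eta>_smult = hom_smult[OF \<eta>, simplified]
    and \<eta>_closed = hom_closed[OF \<eta>, simplified]
  have sc: "s m \<in> carrier S" if "m \<in> carrier N" for m by (rule hom_closed[OF s that])
  have "\<exists>\<theta>. \<theta> \<in> lmod_hom R (restrict_scalars \<phi> ?X) J \<and>
    (\<forall>g\<in>carrier ?W. \<theta> (?cl g) = \<eta> (g q \<odot>\<^bsub>S\<^esub> s m))" if m: "m \<in> carrier N" for m
  proof -
    have "(\<lambda>g. \<eta> (g q \<odot>\<^bsub>S\<^esub> s m)) \<in> lmod_hom R (restrict_scalars \<phi> ?W) J"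
    proof (rule lmod_homI)
      show "\<eta> (g q \<odot>\<^bsub>S\<^esub> s m) \<in> carrier J" if "g \<in> carrier (restrict_scalars \<phi> ?W)" for g
        using that gq sc[OF m] \<eta>_closed by simp
      show "\<eta> ((g \<oplus>\<^bsub>restrict_scalars \<phi> ?W\<^esub> g') q \<odot>\<^bsub>S\<^esub> s m) = \<eta> (g q \<odot>\<^bsub>S\<^esub> s m) \<oplus>\<^bsub>J\<^esub> \<eta> (g' q \<odot>\<^bsub>S\<^esub> s m)"
        if "g \<in> carrier (restrict_scalars \<phi> ?W)" "g' \<in> carrier (restrict_scalars \<phi> ?W)" for g g'
        using that gq sc[OF m] q by (simp add: regular_dual_simps(3) S.smult_l_distr \<eta>_add)
      show "\<eta> ((r \<odot>\<^bsub>restrict_scalars \<phi> ?W\<^esub> g) q \<odot>\<^bsub>S\<^esub> s m) = r \<odot>\<^bsub>J\<^esub> \<eta> (g q \<odot>\<^bsub>S\<^esub> s m)"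
        if "r \<in> carrier R" "g \<in> carrier (restrict_scalars \<phi> ?W)" for r g
        using that gq[of g] sc[OF m] q \<phi>c
        by (simp add: regular_dual_simps(4) S.smult_assoc1 \<eta>_smult[symmetric] central[symmetric])
    qed
    then obtain \<theta> where "\<theta> \<in> lmod_hom R (restrict_scalars \<phi> ?X) J"
      "\<And>g. g \<in> carrier (restrict_scalars \<phi> ?W) \<Longrightarrow> \<theta> (?cl g) = \<eta> (g q \<odot>\<^bsub>S\<^esub> s m)"
    proof (rule hom_factor[OF cl _ RW RX J])
      show "?cl ` carrier (restrict_scalars \<phi> ?W) = carrier (restrict_scalars \<phi> ?X)" using tr(5) by simp
      fix g assume g: "g \<in> carrier (restrict_scalars \<phi> ?W)" "?cl g = \<zero>\<^bsub>restrict_scalars \<phi> ?X\<^esub>"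
      then have "g \<in> B" using tr(6) by simp
      then obtain g' where g': "g' \<in> lmod_hom \<Lambda> P0 (regular \<Lambda>)" "g = compose (carrier P1) g' d"
        by (auto simp: B_def regular_dual_simps)
      have dq: "d q \<in> carrier P0" "e (d q) = \<zero>\<^bsub>N\<^esub>" using hom_closed[OF D1(5) q] by (auto simp: a_kernel_eq)
      have "g' (d q) \<odot>\<^bsub>S\<^esub> s m = \<zero>\<^bsub>S\<^esub>"
        by (rule projective_cover_kills_kernel[OF mpD(1) S hom_smult_right[OF g'(1) Sm sc[OF m]] dq])
      then have "g q \<odot>\<^bsub>S\<^esub> s m = \<zero>\<^bsub>S\<^esub>" using g'(2) q by (simp add: compose_def)
      then show "\<eta> (g q \<odot>\<^bsub>S\<^esub> s m) = \<zero>\<^bsub>J\<^esub>" using hom_zero[OF \<eta> RS J] by simp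
    qed blast
    then show ?thesis by (intro exI[of _ \<theta>]) auto
  qed
  then obtain \<theta> where \<theta>: "\<And>m. m \<in> carrier N \<Longrightarrow> \<theta> m \<in> lmod_hom R (restrict_scalars \<phi> ?X) J"
    and \<theta>_eq: "\<And>m g. m \<in> carrier N \<Longrightarrow> g \<in> carrier ?W \<Longrightarrow> \<theta> m (?cl g) = \<eta> (g q \<odot>\<^bsub>S\<^esub> s m)" by metis
  define f where "f m = restrict (\<theta> m) (carrier ?X)" for m
  have f_eq: "f m (?cl g) = \<eta> (g q \<odot>\<^bsub>S\<^esub> s m)" if "m \<in> carrier N" "g \<in> carrier ?W" for m g
    using \<theta>_eq[OF that] hom_closed[OF tr(4) that(2)] by (simp add: f_def)
  have repr: "\<exists>g\<in>carrier ?W. c = ?cl g" if "c \<in> carrier ?X" for c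
  proof -
    have "c \<in> ?cl ` carrier ?W" using that tr(5) by simp
    then show ?thesis by blast
  qed
  have f: "f \<in> lmod_hom \<Lambda> N ?D"
  proof (rule lmod_homI)
    fix m assume m: "m \<in> carrier N"
    have "f m \<in> lmod_hom R (restrict_scalars \<phi> ?X) J"
      by (rule hom_cong[OF \<theta>[OF m] RX]) (simp add: f_def)
    then show "f m \<in> carrier ?D" by (simp add: artin_dual_simps f_def)
  next
    fix m m' assume m: "m \<in> carrier N" "m' \<in> carrier N"
    show "f (m \<oplus>\<^bsub>N\<^esub> m') = f m \<oplus>\<^bsub>?D\<^esub> f m'"
    proof (rule extensionalityI[of _ "carrier ?X"])
      fix c assume c: "c \<in> carrier ?X"
      then obtain g where g: "g \<in> carrier ?W" "c = ?cl g" using repr by blast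
      show "f (m \<oplus>\<^bsub>N\<^esub> m') c = (f m \<oplus>\<^bsub>?D\<^esub> f m') c"
        using m g c gq[OF g(1)] sc by (simp add: artin_dual_simps f_eq hom_add[OF s] S.smult_r_distr \<eta>_add)
    qed (auto simp: f_def artin_dual_simps)
  next
    fix a m assume a: "a \<in> carrier \<Lambda>" and m: "m \<in> carrier N"
    show "f (a \<odot>\<^bsub>N\<^esub> m) = a \<odot>\<^bsub>?D\<^esub> f m"
    proof (rule extensionalityI[of _ "carrier ?X"])
      fix c assume c: "c \<in> carrier ?X"
      then obtain g where g: "g \<in> carrier ?W" "c = ?cl g" using repr by blast
      have ag: "a \<odot>\<^bsub>?W\<^esub> g \<in> carrier ?W" using a g(1) by simp
      have "a \<odot>\<^bsub>?X\<^esub> c = ?cl (a \<odot>\<^bsub>?W\<^esub> g)" using hom_smult[OF tr(4) _ g(1), of a] a g(2) by simp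
      then have "(a \<odot>\<^bsub>?D\<^esub> f m) c = \<eta> ((a \<odot>\<^bsub>?W\<^esub> g) q \<odot>\<^bsub>S\<^esub> s m)" using c f_eq[OF m ag] by (simp add: artin_dual_simps)
      also have "(a \<odot>\<^bsub>?W\<^esub> g) q \<odot>\<^bsub>S\<^esub> s m = g q \<odot>\<^bsub>S\<^esub> s (a \<odot>\<^bsub>N\<^esub> m)"
        using q a m gq[OF g(1)] sc[OF m] by (simp add: regular_dual_simps(4) S.smult_assoc1 hom_smult[OF s])
      finally show "f (a \<odot>\<^bsub>N\<^esub> m) c = (a \<odot>\<^bsub>?D\<^esub> f m) c" using f_eq[of "a \<odot>\<^bsub>N\<^esub> m" g] a m g by simp
    qed (auto simp: f_def artin_dual_simps)
  qed
  have vanish: "\<eta> (g q \<odot>\<^bsub>S\<^esub> s m) = \<zero>\<^bsub>J\<^esub>" if m: "m \<in> carrier N" and g: "g \<in> carrier ?W" for m g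
  proof -
    have "f m = \<zero>\<^bsub>?D\<^esub>" using rigid f m unfolding tau_rigid_def tau by blast
    then show ?thesis
      using f_eq[OF m g] hom_closed[OF tr(4) g] by (simp add: artin_dual_simps)
  qed
  obtain n :: nat and a \<psi> where a: "\<forall>i<n. a i \<in> carrier P1"
    and \<psi>: "\<forall>i<n. \<psi> i \<in> lmod_hom \<Lambda> P1 (regular \<Lambda>)"
    and basis: "\<forall>x\<in>carrier P1. x = (\<Oplus>\<^bsub>P1\<^esub>i\<in>{..<n}. \<psi> i x \<odot>\<^bsub>P1\<^esub> a i)"
    by (rule dual_basis[OF D1(3,4)])
  have \<psi>c: "\<psi> i q \<in> carrier \<Lambda>" if "i < n" for i
    using hom_closed[OF \<psi>[rule_format, OF that] q] by simp
  have hc: "h (a i) \<in> carrier N" if "i < n" for i using hom_closed[OF h] a that by simp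
  have sh: "(\<lambda>x. s (h x)) \<in> lmod_hom \<Lambda> P1 S" by (rule hom_comp[OF h s])
  let ?t = "\<lambda>i. \<psi> i q \<odot>\<^bsub>S\<^esub> s (h (a i))"
  have tS: "?t i \<in> carrier S" if "i < n" for i using \<psi>c[OF that] sc[OF hc[OF that]] by simp
  have t0: "\<eta> (?t i) = \<zero>\<^bsub>J\<^esub>" if i: "i < n" for i
  proof -
    have "restrict (\<psi> i) (carrier P1) \<in> lmod_hom \<Lambda> P1 (regular \<Lambda>)"
      by (rule hom_cong[OF \<psi>[rule_format, OF i] D1(1)]) simp
    then have "restrict (\<psi> i) (carrier P1) \<in> carrier ?W" by (simp add: regular_dual_simps)
    from vanish[OF hc[OF i] this] show ?thesis using q by simp
  qed
  have "s (h q) = s (h (\<Oplus>\<^bsub>P1\<^esub>i\<in>{..<n}. \<psi> i q \<odot>\<^bsub>P1\<^esub> a i))" using basis q by simp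
  also have "\<dots> = (\<Oplus>\<^bsub>S\<^esub>i\<in>{..<n}. s (h (\<psi> i q \<odot>\<^bsub>P1\<^esub> a i)))"
    by (rule hom_finsum[OF sh D1(1) Sm]) (use \<psi>c a in simp)
  also have "\<dots> = (\<Oplus>\<^bsub>S\<^esub>i\<in>{..<n}. ?t i)"
    by (rule S.M.finsum_cong') (use \<psi>c a tS hom_smult[OF sh] in auto)
  also have "\<dots> = (\<Oplus>\<^bsub>restrict_scalars \<phi> S\<^esub>i\<in>{..<n}. ?t i)" by (simp only: finsum_restrict_scalars)
  finally have "\<eta> (s (h q)) = (\<Oplus>\<^bsub>J\<^esub>i\<in>{..<n}. \<eta> (?t i))"
    using hom_finsum[OF \<eta> RS J, of n ?t] tS by simp
  also have "\<dots> = (\<Oplus>\<^bsub>J\<^esub>i\<in>{..<n}. \<zero>\<^bsub>J\<^esub>)" by (rule J.M.finsum_cong') (use t0 in auto)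
  also have "\<dots> = \<zero>\<^bsub>J\<^esub>" by (rule J.M.finsum_zero)
  finally show False using nz by simp
qed

section \<open>Quotients of a local projective module\<close>

lemma complementary_sym:
  fixes M (structure)
  assumes "left_module \<Lambda> M" "complementary \<Lambda> M A B" shows "complementary \<Lambda> M B A"
proof -
  interpret M: left_module \<Lambda> M by fact
  have A: "submodule A \<Lambda> M" and B: "submodule B \<Lambda> M" using assms(2) by (auto simp: complementary_def)
  have swap: "V <+>\<^bsub>M\<^esub> U \<subseteq> U <+>\<^bsub>M\<^esub> V" if "U \<subseteq> carrier M" "V \<subseteq> carrier M" for U V
  proof
    fix x assume "x \<in> V <+>\<^bsub>M\<^esub> U"
    then obtain v u where vu: "v \<in> V" "u \<in> U" "x = v \<oplus> u" by (rule set_addE)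
    then have "x = u \<oplus> v" using that M.M.a_comm[of v u] by auto
    then show "x \<in> U <+>\<^bsub>M\<^esub> V" using set_addI[OF vu(2,1)] by simp
  qed
  have "B <+>\<^bsub>M\<^esub> A = A <+>\<^bsub>M\<^esub> B"
    using swap submod_subset[OF A] submod_subset[OF B] by blast
  then show ?thesis using assms(2) by (auto simp: complementary_def)
qed

lemma projective_cover_simple_onto:
  assumes pc: "projective_cover \<Lambda> P p S" and S: "simple_module \<Lambda> S"
    and H: "submodule H \<Lambda> P" and x: "x \<in> H" "p x \<noteq> \<zero>\<^bsub>S\<^esub>"
  shows "H = carrier P"
proof (rule projective_cover_essential[OF pc H])
  note D = projective_coverD[OF pc]
  have "submodule (p ` H) \<Lambda> S" by (rule submodule_image[OF D(5,1,2) H])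
  then have "p ` H = carrier S" using S x by (auto simp: simple_module_def)
  then show "\<exists>h\<in>H. p h = p y" if "y \<in> carrier P" for y
    using hom_closed[OF D(5) that] by (metis imageE)
qed

text \<open>A submodule of \<open>P\<close> on which \<open>p\<close> does not vanish is all of \<open>P\<close>. If \<open>P/Y = A \<oplus> B\<close>, then \<open>p\<close> cannot vanish on the
preimages of both \<open>A\<close> and \<open>B\<close>, so one of \<open>A\<close> and \<open>B\<close> is everything.\<close>

lemma local_quotient_indecomposable:
  assumes pc: "projective_cover \<Lambda> P p S" and S: "simple_module \<Lambda> S"
    and Y: "submodule Y \<Lambda> P" "Y \<subseteq> a_kernel P S p"
  shows "fg_left_module \<Lambda> (quot_mod P Y)" "indecomposable \<Lambda> (quot_mod P Y)"
proof -
  note D = projective_coverD[OF pc]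
  interpret P: left_module \<Lambda> P by (rule D)
  interpret S: left_module \<Lambda> S by (rule D)
  let ?M = "quot_mod P Y" and ?pr = "\<lambda>x. Y +>\<^bsub>P\<^esub> x"
  note M = P.left_module_quot[OF Y(1)] and pr = P.quot_proj_hom[OF Y(1)] and q = P.quot_mod_facts[OF Y(1)]
  interpret M: left_module \<Lambda> ?M by (rule M)
  show "fg_left_module \<Lambda> ?M"
    using fin_gen_image[OF pr D(1) M q(1)] D(3) M by (simp add: fg_left_module_def)
  obtain s where s: "s \<in> carrier S" "s \<noteq> \<zero>\<^bsub>S\<^esub>" using S S.M.zero_closed by (auto simp: simple_module_def)
  obtain x\<^sub>0 where x0: "x\<^sub>0 \<in> carrier P" "p x\<^sub>0 \<noteq> \<zero>\<^bsub>S\<^esub>" using s D(6) by (metis imageE)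
  have pY: "p y = \<zero>\<^bsub>S\<^esub>" if "y \<in> Y" for y using that Y(2) by (auto simp: a_kernel_eq)
  show "indecomposable \<Lambda> ?M"
    unfolding indecomposable_def
  proof (intro conjI allI impI M)
    have "?pr x\<^sub>0 \<noteq> \<zero>\<^bsub>?M\<^esub>" using P.quot_proj_eq_zero[OF Y(1) x0(1)] pY x0(2) by blast
    then show "carrier ?M \<noteq> {\<zero>\<^bsub>?M\<^esub>}" using hom_closed[OF pr x0(1)] by blast
    fix A B assume "complementary \<Lambda> ?M A B"
    then have A: "submodule A \<Lambda> ?M" and B: "submodule B \<Lambda> ?M" and AB: "A \<inter> B = {\<zero>\<^bsub>?M\<^esub>}"
      "A <+>\<^bsub>?M\<^esub> B = carrier ?M" by (auto simp: complementary_def)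
    have whole: "C = carrier ?M"
      if C: "submodule C \<Lambda> ?M" and x: "x \<in> carrier P" "?pr x \<in> C" "p x \<noteq> \<zero>\<^bsub>S\<^esub>" for C x
    proof -
      have "{x \<in> carrier P. ?pr x \<in> C} = carrier P"
        by (rule projective_cover_simple_onto[OF pc S submodule_vimage[OF pr D(1) M C], of x]) (use x in auto)
      then have "?pr ` carrier P \<subseteq> C" by blast
      then show ?thesis using q(1) submod_subset[OF C] by auto
    qed
    have "?pr x\<^sub>0 \<in> A <+>\<^bsub>?M\<^esub> B" using hom_closed[OF pr x0(1)] AB(2) by simp
    then obtain \<alpha> \<beta> where ab: "\<alpha> \<in> A" "\<beta> \<in> B" "?pr x\<^sub>0 = \<alpha> \<oplus>\<^bsub>?M\<^esub> \<beta>" by (rule set_addE)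
    have "\<alpha> \<in> ?pr ` carrier P" "\<beta> \<in> ?pr ` carrier P"
      using ab submod_mem[OF A] submod_mem[OF B] q(1) by simp_all
    then obtain a b where a: "a \<in> carrier P" "\<alpha> = ?pr a" and b: "b \<in> carrier P" "\<beta> = ?pr b" by blast
    have "?pr x\<^sub>0 = ?pr (a \<oplus>\<^bsub>P\<^esub> b)" using ab(3) a b hom_add[OF pr] by simp
    then have "x\<^sub>0 \<ominus>\<^bsub>P\<^esub> (a \<oplus>\<^bsub>P\<^esub> b) \<in> Y" using P.a_rcos_eq_iff[OF Y(1) x0(1)] a b by simp
    then have "p (x\<^sub>0 \<ominus>\<^bsub>P\<^esub> (a \<oplus>\<^bsub>P\<^esub> b)) = \<zero>\<^bsub>S\<^esub>" by (rule pY)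
    then have "p x\<^sub>0 = p (a \<oplus>\<^bsub>P\<^esub> b)"
      using hom_diff[OF D(5,1,2) x0(1)] a b hom_closed[OF D(5)] x0(1) by (simp add: S.diff_eq_zero)
    then have "p a \<oplus>\<^bsub>S\<^esub> p b \<noteq> \<zero>\<^bsub>S\<^esub>" using x0(2) a b hom_add[OF D(5)] by simp
    then have "p a \<noteq> \<zero>\<^bsub>S\<^esub> \<or> p b \<noteq> \<zero>\<^bsub>S\<^esub>" by auto
    then show "A = {\<zero>\<^bsub>?M\<^esub>} \<or> B = {\<zero>\<^bsub>?M\<^esub>}"
    proof
      assume "p a \<noteq> \<zero>\<^bsub>S\<^esub>"
      then have "A = carrier ?M" using whole[OF A a(1)] ab(1) a(2) by simp
      then show ?thesis using AB(1) submod_subset[OF B] by blast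
    next
      assume "p b \<noteq> \<zero>\<^bsub>S\<^esub>"
      then have "B = carrier ?M" using whole[OF B b(1)] ab(2) b(2) by simp
      then show ?thesis using AB(1) submod_subset[OF A] by blast
    qed
  qed
qed

text \<open>If \<open>P/Y\<close> were projective, then \<open>P \<rightarrow> P/Y\<close> would have a section, and the section would be onto because
\<open>P \<rightarrow> P/Y\<close> is essential.\<close>

lemma local_quotient_not_projective:
  assumes pc: "projective_cover \<Lambda> P p X" and Y: "submodule Y \<Lambda> P" "Y \<subseteq> a_kernel P X p"
    and fg: "fg_left_module \<Lambda> (quot_mod P Y)" and nz: "Y \<noteq> {\<zero>\<^bsub>P\<^esub>}"
  shows "\<not> projective_module \<Lambda> (quot_mod P Y)"
proof
  assume proj: "projective_module \<Lambda> (quot_mod P Y)"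
  note D = projective_coverD[OF pc]
  interpret P: left_module \<Lambda> P by (rule D)
  let ?M = "quot_mod P Y" and ?pr = "\<lambda>x. Y +>\<^bsub>P\<^esub> x"
  note M = P.left_module_quot[OF Y(1)] and pr = P.quot_proj_hom[OF Y(1)] and q = P.quot_mod_facts[OF Y(1)]
  interpret M: left_module \<Lambda> ?M by (rule M)
  obtain k where k: "k \<in> lmod_hom \<Lambda> ?M P" "\<And>c. c \<in> carrier ?M \<Longrightarrow> ?pr (k c) = c"
    using projective_lift[OF fg proj D(1) M pr q(1) hom_id] by blast
  have "k ` carrier ?M = carrier P"
  proof (rule projective_cover_essential[OF projective_cover_quot[OF pc Y]])
    show "submodule (k ` carrier ?M) \<Lambda> P" by (rule submodule_image[OF k(1) M D(1) M.submodule_carrier])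
    show "\<exists>h\<in>k ` carrier ?M. ?pr h = ?pr x" if "x \<in> carrier P" for x
      using k(2) hom_closed[OF pr that] by blast
  qed
  then have "y = \<zero>\<^bsub>P\<^esub>" if y: "y \<in> Y" for y
  proof -
    have "y \<in> k ` carrier ?M" using \<open>k ` carrier ?M = carrier P\<close> submod_mem[OF Y(1) y] by simp
    then obtain c where c: "c \<in> carrier ?M" "y = k c" by blast
    have "c = \<zero>\<^bsub>?M\<^esub>"
      using k(2)[OF c(1)] c(2) P.quot_proj_eq_zero[OF Y(1) submod_mem[OF Y(1) y]] y by simp
    then show ?thesis using c(2) hom_zero[OF k(1) M D(1)] by simp
  qed
  then show False using nz submod_zero[OF Y(1)] by blast
qed

lemma complement_short_exact:
  assumes P: "left_module \<Lambda> P" and W: "submodule W \<Lambda> P" and XY: "complementary \<Lambda> (restr P W) X Y"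
  shows "\<exists>\<iota> \<pi>. short_exact \<Lambda> (quot_mod (restr P W) X) \<iota> P \<pi> (quot_mod P Y)"
proof -
  interpret P: left_module \<Lambda> P by fact
  let ?\<Omega> = "restr P W"
  note Om = P.left_module_restr[OF W]
  interpret O: left_module \<Lambda> ?\<Omega> by (rule Om)
  have X: "submodule X \<Lambda> ?\<Omega>" and Y\<Omega>: "submodule Y \<Lambda> ?\<Omega>" using XY by (auto simp: complementary_def)
  have Y: "submodule Y \<Lambda> P" using Y\<Omega> P.submodule_restr_iff[OF W] by blast
  obtain \<pi> where \<pi>: "\<pi> \<in> lmod_hom \<Lambda> ?\<Omega> (restr ?\<Omega> Y)" "\<forall>x\<in>carrier ?\<Omega>. x \<ominus>\<^bsub>?\<Omega>\<^esub> \<pi> x \<in> X"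
    "\<forall>y\<in>Y. \<pi> y = y" "\<forall>x\<in>X. \<pi> x = \<zero>\<^bsub>?\<Omega>\<^esub>"
    by (rule complementary_projection[OF Om complementary_sym[OF Om XY]])
  have \<pi>P: "\<pi> \<in> lmod_hom \<Lambda> ?\<Omega> P" using hom_into_restr[of \<pi> \<Lambda> ?\<Omega> Y P] \<pi>(1) submod_subset[OF Y] by simp
  let ?Q = "quot_mod ?\<Omega> X" and ?pr = "\<lambda>x. X +>\<^bsub>?\<Omega>\<^esub> x"
  note Q = O.left_module_quot[OF X] and pr = O.quot_proj_hom[OF X] and q = O.quot_mod_facts[OF X]
  have ker: "\<pi> x = \<zero>\<^bsub>P\<^esub>" if "x \<in> carrier ?\<Omega>" "?pr x = \<zero>\<^bsub>?Q\<^esub>" for x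
    using that O.quot_proj_eq_zero[OF X, of x] \<pi>(4) by simp
  obtain \<iota> where \<iota>: "\<iota> \<in> lmod_hom \<Lambda> ?Q P" "\<And>x. x \<in> carrier ?\<Omega> \<Longrightarrow> \<iota> (?pr x) = \<pi> x"
    using hom_factor[OF pr \<pi>P Om Q P q(1) ker] by blast
  have "inj_on \<iota> (carrier ?Q)"
    unfolding hom_inj_iff[OF \<iota>(1) Q P]
  proof (intro ballI impI)
    fix c assume c: "c \<in> carrier ?Q" "\<iota> c = \<zero>\<^bsub>P\<^esub>"
    then have "c \<in> ?pr ` carrier ?\<Omega>" using q(1) by simp
    then obtain x where x: "x \<in> carrier ?\<Omega>" "c = ?pr x" by blast
    have "\<pi> x = \<zero>\<^bsub>?\<Omega>\<^esub>" using \<iota>(2)[OF x(1)] x(2) c(2) by simp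
    then have "x \<in> X" using \<pi>(2) x(1) O.diff_zero[OF x(1)] by auto
    then show "c = \<zero>\<^bsub>?Q\<^esub>" using O.quot_proj_eq_zero[OF X x(1)] x(2) by simp
  qed
  moreover have "\<iota> ` carrier ?Q = a_kernel P (quot_mod P Y) (\<lambda>x. Y +>\<^bsub>P\<^esub> x)"
  proof -
    have "\<iota> ` carrier ?Q = (\<lambda>x. \<iota> (?pr x)) ` carrier ?\<Omega>" unfolding q(1)[symmetric] by (simp only: image_image)
    also have "\<dots> = \<pi> ` carrier ?\<Omega>" by (rule image_cong) (use \<iota>(2) in auto)
    also have "\<dots> = Y"
    proof
      show "\<pi> ` carrier ?\<Omega> \<subseteq> Y" using hom_closed[OF \<pi>(1)] by auto
      show "Y \<subseteq> \<pi> ` carrier ?\<Omega>"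
        using \<pi>(3) submod_mem[OF Y\<Omega>] by (metis imageI subsetI)
    qed
    also have "\<dots> = a_kernel P (quot_mod P Y) (\<lambda>x. Y +>\<^bsub>P\<^esub> x)"
      using P.quot_proj_eq_zero[OF Y] submod_mem[OF Y] by (auto simp: a_kernel_eq)
    finally show ?thesis .
  qed
  ultimately have "short_exact \<Lambda> ?Q \<iota> P (\<lambda>x. Y +>\<^bsub>P\<^esub> x) (quot_mod P Y)"
    unfolding short_exact_def using \<iota>(1) P.quot_proj_hom[OF Y] P.quot_mod_facts(1)[OF Y] by blast
  then show ?thesis by blast
qed

section \<open>Modules whose projective cover is that of a simple module with semisimple syzygy\<close>

lemma simples_sum_syzygy:
  assumes P: "left_module \<Lambda> P" and W: "submodule W \<Lambda> P" and ss: "simples_sum \<Lambda> (restr P W) W"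
  shows "simples_sum \<Lambda> P W"
proof -
  interpret P: left_module \<Lambda> P by fact
  have "simples_sum \<Lambda> P ((\<lambda>x. x) ` W)"
    by (rule simples_sum_image[OF hom_from_restr[OF hom_id submod_subset[OF W]] P.left_module_restr[OF W] P ss])
  then show ?thesis by simp
qed

text \<open>The homomorphisms from \<open>P1\<close> to \<open>S\<close> and to \<open>T\<close> vanish, because each of them would give a homomorphism from
\<open>\<Omega>\<close> that vanishes on \<open>X\<close> (the fact \<open>push\<close>). So a homomorphism from \<open>P1\<close> to \<open>P/Y\<close> takes its values in the
kernel of \<open>P/Y \<rightarrow> S\<close>, and this kernel is isomorphic to \<open>X\<close> and so to a power of \<open>T\<close>.\<close>

lemma isotypic_quotient_tau_rigid:
  fixes R :: "'r ring" and P :: "('a, 'p) module" and S :: "('a, 's) module" and T :: "('a, 't) module"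
    and J :: "('r, 'j) module"
  assumes AA: "artin_algebra R \<phi> \<Lambda>" and J: "left_module R J" and S: "simple_module \<Lambda> S"
    and pc: "projective_cover \<Lambda> P p S" and \<Omega>: "\<Omega> = syzygy P p S" and ss: "semisimple_module \<Lambda> \<Omega>"
    and XY: "complementary \<Lambda> \<Omega> X Y" and T: "simple_module \<Lambda> T"
    and iso: "lmod_iso \<Lambda> (mod_power T m) (restr \<Omega> X)"
    and noT: "\<not> direct_summand \<Lambda> (mod_power T (Suc m)) \<Omega>"
    and noS: "\<And>q. q \<in> lmod_hom \<Lambda> \<Omega> S \<Longrightarrow> \<forall>x\<in>X. q x = \<zero>\<^bsub>S\<^esub> \<Longrightarrow> \<forall>x\<in>carrier \<Omega>. q x = \<zero>\<^bsub>S\<^esub>"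
  shows "tau_rigid R \<phi> \<Lambda> J (quot_mod P Y)"
proof -
  note D = projective_coverD[OF pc]
  note Tm = simple_left_module[OF T]
  interpret P: left_module \<Lambda> P by (rule D)
  interpret S: left_module \<Lambda> S by (rule D)
  interpret T: left_module \<Lambda> T by (rule Tm)
  define W where "W = a_kernel P S p"
  have \<Omega>W: "\<Omega> = restr P W" by (simp add: \<Omega> syzygy_def W_def)
  have W: "submodule W \<Lambda> P" unfolding W_def by (rule submodule_kernel[OF D(5,1,2)])
  have Om: "left_module \<Lambda> \<Omega>" unfolding \<Omega>W by (rule P.left_module_restr[OF W])
  interpret O: left_module \<Lambda> \<Omega> by (rule Om)
  have Oc: "carrier \<Omega> = W" by (simp add: \<Omega>W)
  have X\<Omega>: "submodule X \<Lambda> \<Omega>" and Y\<Omega>: "submodule Y \<Lambda> \<Omega>" using XY by (auto simp: complementary_def)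
  have Y: "submodule Y \<Lambda> P" and YW: "Y \<subseteq> W"
    using Y\<Omega> P.submodule_restr_iff[OF W] by (auto simp: \<Omega>W)
  have ss\<Omega>: "simples_sum \<Lambda> \<Omega> (carrier \<Omega>)" by (rule semisimple_simples_sum[OF ss])
  have ssP: "simples_sum \<Lambda> P Y"
    using simples_sum_subset[OF simples_sum_syzygy[OF D(1) W] D(1) Y YW] ss\<Omega> by (simp add: \<Omega>W)
  let ?M = "quot_mod P Y" and ?pr = "\<lambda>x. Y +>\<^bsub>P\<^esub> x"
  note M = P.left_module_quot[OF Y] and pr = P.quot_proj_hom[OF Y] and q = P.quot_mod_facts[OF Y]
  interpret M: left_module \<Lambda> ?M by (rule M)
  have pcM: "projective_cover \<Lambda> P ?pr ?M" using projective_cover_quot[OF pc Y] YW by (simp add: W_def)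
  have ker_pr: "a_kernel P ?M ?pr = Y"
    using P.quot_proj_eq_zero[OF Y] submod_mem[OF Y] by (auto simp: a_kernel_eq)
  obtain \<pi> where \<pi>: "\<pi> \<in> lmod_hom \<Lambda> \<Omega> (restr \<Omega> Y)" "\<forall>y\<in>Y. \<pi> y = y" "\<forall>x\<in>X. \<pi> x = \<zero>\<^bsub>\<Omega>\<^esub>"
    by (rule complementary_projection[OF Om complementary_sym[OF Om XY]])
  obtain \<rho> where \<rho>: "\<rho> \<in> lmod_hom \<Lambda> \<Omega> (restr \<Omega> X)" "\<forall>x\<in>carrier \<Omega>. x \<ominus>\<^bsub>\<Omega>\<^esub> \<rho> x \<in> Y" "\<forall>y\<in>Y. \<rho> y = \<zero>\<^bsub>\<Omega>\<^esub>"
    by (rule complementary_projection[OF Om XY])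
  show ?thesis
  proof (rule tau_rigidI[OF AA J M])
    show "\<exists>(P1 :: ('a, 'a univ) module) d (P0 :: ('a, 'a univ) module) e. minimal_presentation \<Lambda> P1 d P0 e ?M"
      by (rule minimal_presentation_exists[OF artin_algebra_artinian[OF AA] pcM]) (simp add: ker_pr ssP)
    fix P1 P0 :: "('a, 'a univ) module" and d e h x
    assume mp: "minimal_presentation \<Lambda> P1 d P0 e ?M" and h: "h \<in> lmod_hom \<Lambda> P1 ?M" and x: "x \<in> carrier P1"
    note mpD = minimal_presentationD[OF mp]
    note D1 = projective_coverD[OF mpD(2)]
    let ?K = "a_kernel P0 ?M e"
    obtain \<alpha> where \<alpha>: "\<alpha> \<in> lmod_hom \<Lambda> P P0" "bij_betw \<alpha> (carrier P) (carrier P0)"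
      "\<And>x. x \<in> carrier P \<Longrightarrow> e (\<alpha> x) = ?pr x"
      using projective_cover_unique[OF mpD(1) pcM] by blast
    have \<alpha>K: "\<alpha> \<in> lmod_hom \<Lambda> (restr \<Omega> Y) (restr P0 ?K)"
    proof -
      have "\<alpha> \<in> lmod_hom \<Lambda> (restr P Y) P0" by (rule hom_from_restr[OF \<alpha>(1) submod_subset[OF Y]])
      moreover have "\<alpha> y \<in> ?K" if "y \<in> Y" for y
        using that submod_mem[OF Y that] \<alpha>(3) hom_closed[OF \<alpha>(1)] P.quot_proj_eq_zero[OF Y]
        by (simp add: a_kernel_eq)
      ultimately show ?thesis using hom_to_restr[of \<alpha> \<Lambda> "restr P Y" P0 ?K] by (simp add: \<Omega>W)
    qed
    \<comment> \<open>A map on \<open>P1\<close> factors through \<open>d\<close>; it is carried over from \<open>ker e\<close> to \<open>Y\<close> by \<open>\<alpha>\<close> and extended by zero on \<open>X\<close>.\<close>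
    have push: "\<exists>q. q \<in> lmod_hom \<Lambda> \<Omega> U \<and> (\<forall>x\<in>X. q x = \<zero>\<^bsub>U\<^esub>) \<and> (\<exists>x\<in>carrier \<Omega>. q x \<noteq> \<zero>\<^bsub>U\<^esub>)"
      if U: "simple_module \<Lambda> U" and g: "g \<in> lmod_hom \<Lambda> P1 U" and x0: "x\<^sub>0 \<in> carrier P1" "g x\<^sub>0 \<noteq> \<zero>\<^bsub>U\<^esub>"
      for U :: "('a, 'u) module" and g x\<^sub>0
    proof -
      note Um = simple_left_module[OF U]
      have kills: "g z = \<zero>\<^bsub>U\<^esub>" if "z \<in> carrier P1" "d z = \<zero>\<^bsub>restr P0 ?K\<^esub>" for z
        by (rule projective_cover_kills_kernel[OF mpD(2) U g that])
      obtain g' where g': "g' \<in> lmod_hom \<Lambda> (restr P0 ?K) U" "\<And>z. z \<in> carrier P1 \<Longrightarrow> g' (d z) = g z"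
        using hom_factor[OF D1(5) g D1(1,2) Um D1(6) kills] by blast
      let ?q = "\<lambda>w. g' (\<alpha> (\<pi> w))"
      have q: "?q \<in> lmod_hom \<Lambda> \<Omega> U" by (rule hom_comp[OF hom_comp[OF \<pi>(1) \<alpha>K] g'(1)])
      have "?q w = \<zero>\<^bsub>U\<^esub>" if "w \<in> X" for w
      proof -
        have "?q w = ?q \<zero>\<^bsub>\<Omega>\<^esub>" using that \<pi>(3,2) submod_zero[OF Y\<Omega>] by simp
        then show ?thesis using hom_zero[OF q Om Um] by simp
      qed
      moreover have "\<exists>w\<in>carrier \<Omega>. ?q w \<noteq> \<zero>\<^bsub>U\<^esub>"
      proof -
        have dx: "d x\<^sub>0 \<in> carrier P0" "e (d x\<^sub>0) = \<zero>\<^bsub>?M\<^esub>" using hom_closed[OF D1(5) x0(1)] by (auto simp: a_kernel_eq)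
        then have "d x\<^sub>0 \<in> \<alpha> ` carrier P" using \<alpha>(2) by (simp add: bij_betw_def)
        then obtain y where y: "y \<in> carrier P" "d x\<^sub>0 = \<alpha> y" by blast
        have "y \<in> Y" using \<alpha>(3)[OF y(1)] y(2) dx(2) P.quot_proj_eq_zero[OF Y y(1)] by simp
        then have "?q y = g x\<^sub>0" using \<pi>(2) y(2) g'(2)[OF x0(1)] by simp
        then show ?thesis using \<open>y \<in> Y\<close> YW x0(2) by (intro bexI[of _ y]) (auto simp: Oc)
      qed
      ultimately show ?thesis using q by (intro exI[of _ ?q]) blast
    qed
    have toS: "g z = \<zero>\<^bsub>S\<^esub>" if "g \<in> lmod_hom \<Lambda> P1 S" "z \<in> carrier P1" for g z
      using push[OF S that] noS by blast
    have toT: "g z = \<zero>\<^bsub>T\<^esub>" if "g \<in> lmod_hom \<Lambda> P1 T" "z \<in> carrier P1" for g z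
      using push[OF T that] direct_summand_power_Suc[OF Om ss\<Omega> T _ _ XY _ iso] noT by blast
    have pY: "p y = \<zero>\<^bsub>S\<^esub>" if "y \<in> carrier P" "?pr y = \<zero>\<^bsub>?M\<^esub>" for y
      using that P.quot_proj_eq_zero[OF Y that(1)] YW by (auto simp: W_def a_kernel_eq)
    obtain \<sigma> where \<sigma>: "\<sigma> \<in> lmod_hom \<Lambda> ?M S" "\<And>y. y \<in> carrier P \<Longrightarrow> \<sigma> (?pr y) = p y"
      using hom_factor[OF pr D(5) D(1) M D(2) q(1) pY] by blast
    let ?L = "a_kernel ?M S \<sigma>"
    note L = submodule_kernel[OF \<sigma>(1) M D(2)]
    have hL: "h \<in> lmod_hom \<Lambda> P1 (restr ?M ?L)"
      by (rule hom_to_restr[OF h]) (use toS[OF hom_comp[OF h \<sigma>(1)]] hom_closed[OF h] in \<open>simp add: a_kernel_eq\<close>)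
    have prW: "?pr \<in> lmod_hom \<Lambda> \<Omega> (restr ?M ?L)"
    proof (rule hom_to_restr)
      show "?pr \<in> lmod_hom \<Lambda> \<Omega> ?M" unfolding \<Omega>W by (rule hom_from_restr[OF pr submod_subset[OF W]])
      show "?pr w \<in> ?L" if "w \<in> carrier \<Omega>" for w
        using that \<sigma>(2)[of w] hom_closed[OF pr, of w] by (auto simp: Oc W_def a_kernel_eq)
    qed
    have surj: "?pr ` carrier \<Omega> = carrier (restr ?M ?L)"
    proof
      show "?pr ` carrier \<Omega> \<subseteq> carrier (restr ?M ?L)" using hom_closed[OF prW] by blast
      show "carrier (restr ?M ?L) \<subseteq> ?pr ` carrier \<Omega>"
      proof
        fix c assume "c \<in> carrier (restr ?M ?L)"
        then have c: "c \<in> carrier ?M" "\<sigma> c = \<zero>\<^bsub>S\<^esub>" by (auto simp: a_kernel_eq)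
        then have "c \<in> ?pr ` carrier P" using q(1) by simp
        then obtain y where y: "y \<in> carrier P" "c = ?pr y" by blast
        then have "y \<in> carrier \<Omega>" using c(2) \<sigma>(2) by (simp add: Oc W_def a_kernel_eq)
        then show "c \<in> ?pr ` carrier \<Omega>" using y(2) by blast
      qed
    qed
    note Lm = M.left_module_restr[OF L] and Xm = O.left_module_restr[OF X\<Omega>]
    have \<rho>Y: "\<rho> w = \<zero>\<^bsub>restr \<Omega> X\<^esub>" if "w \<in> carrier \<Omega>" "?pr w = \<zero>\<^bsub>restr ?M ?L\<^esub>" for w
      using that \<rho>(3) P.quot_proj_eq_zero[OF Y, of w] submod_mem[OF W] by (simp add: Oc)
    \<comment> \<open>\<open>\<kappa>\<close> is the isomorphism from the kernel of \<open>P/Y \<rightarrow> S\<close> to \<open>X\<close> that the projection of \<open>\<Omega>\<close> to \<open>X\<close> induces.\<close>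
    obtain \<kappa> where \<kappa>: "\<kappa> \<in> lmod_hom \<Lambda> (restr ?M ?L) (restr \<Omega> X)" "\<And>w. w \<in> carrier \<Omega> \<Longrightarrow> \<kappa> (?pr w) = \<rho> w"
      using hom_factor[OF prW \<rho>(1) Om Lm Xm surj \<rho>Y] by blast
    obtain \<theta> where \<theta>: "\<theta> \<in> lmod_hom \<Lambda> (mod_power T m) (restr \<Omega> X)"
      "bij_betw \<theta> (carrier (mod_power T m)) (carrier (restr \<Omega> X))" using iso unfolding lmod_iso_def by blast
    note Tp = mod_power_left_module[OF Tm, of m]
    note \<theta>' = hom_inv_into[OF \<theta>(1) Tp \<theta>(2)]
    let ?\<theta> = "inv_into (carrier (mod_power T m)) \<theta>"
    have k: "(\<lambda>z. ?\<theta> (\<kappa> (h z))) \<in> lmod_hom \<Lambda> P1 (mod_power T m)"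
      by (rule hom_comp[OF hom_comp[OF hL \<kappa>(1)] \<theta>'(1)])
    have "?\<theta> (\<kappa> (h x)) i = \<zero>\<^bsub>T\<^esub>" if "i < m" for i
      using toT[OF hom_comp[OF k mod_power_proj_hom[OF that]] x] .
    then have "?\<theta> (\<kappa> (h x)) = \<zero>\<^bsub>mod_power T m\<^esub>"
      using hom_closed[OF k x] by (auto simp: mod_power_simps PiE_iff extensional_def fun_eq_iff)
    moreover have "\<kappa> (h x) \<in> carrier (restr \<Omega> X)" by (rule hom_closed[OF hom_comp[OF hL \<kappa>(1)] x])
    ultimately have \<kappa>0: "\<kappa> (h x) = \<zero>\<^bsub>restr \<Omega> X\<^esub>"
      using hom_inj_iff[OF \<theta>'(1) Xm Tp] \<theta>'(2) by (simp add: bij_betw_def)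
    have "h x \<in> ?pr ` carrier \<Omega>" using hom_closed[OF hL x] surj by simp
    then obtain w where w: "w \<in> carrier \<Omega>" "h x = ?pr w" by blast
    have "\<rho> w = \<zero>\<^bsub>\<Omega>\<^esub>" using \<kappa>0 \<kappa>(2)[OF w(1)] w(2) by simp
    then have "w \<in> Y" using \<rho>(2) w(1) O.diff_zero[OF w(1)] by auto
    then show "h x = \<zero>\<^bsub>?M\<^esub>" using w(2) P.quot_proj_eq_zero[OF Y submod_mem[OF Y]] by simp
  qed
qed

text \<open>The homomorphism from \<open>P1\<close> to \<open>N\<close> required by \<open>not_tau_rigidI\<close> is a lift, along \<open>s : N \<rightarrow> S\<close>, of the composite of
\<open>P1 \<rightarrow> ker e\<close>, the embedding of \<open>ker e\<close> into \<open>\<Omega>\<close>, the isomorphism from \<open>\<Omega>\<close> to \<open>S\<^sup>n\<close>, and a coordinate. Some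
coordinate is nonzero on \<open>ker e\<close> because \<open>N\<close> is not projective.\<close>

lemma isotypic_syzygy_not_tau_rigid:
  fixes R :: "'r ring" and P :: "('a, 'p) module" and S :: "('a, 's) module" and J :: "('r, 'j) module"
    and N :: "('a, 'n) module" and Q :: "('a, 'q) module"
  assumes AA: "artin_algebra R \<phi> \<Lambda>" and DJ: "dualizing_module R J" and S: "simple_module \<Lambda> S"
    and pc: "projective_cover \<Lambda> P p S" and \<Omega>: "\<Omega> = syzygy P p S" and ss: "semisimple_module \<Lambda> \<Omega>"
    and iso: "lmod_iso \<Lambda> \<Omega> (mod_power S n)"
    and np: "\<not> projective_module \<Lambda> N" and Q: "projective_cover \<Lambda> Q q N" and QP: "lmod_iso \<Lambda> Q P"
  shows "\<not> tau_rigid R \<phi> \<Lambda> J N"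
proof -
  note D = projective_coverD[OF pc] and E = projective_coverD[OF Q]
  have J: "left_module R J" by (rule dualizing_left_module[OF DJ])
  interpret P: left_module \<Lambda> P by (rule D)
  interpret S: left_module \<Lambda> S by (rule D)
  interpret Q: left_module \<Lambda> Q by (rule E)
  interpret N: left_module \<Lambda> N by (rule E)
  define W where "W = a_kernel P S p"
  have \<Omega>W: "\<Omega> = restr P W" by (simp add: \<Omega> syzygy_def W_def)
  have W: "submodule W \<Lambda> P" unfolding W_def by (rule submodule_kernel[OF D(5,1,2)])
  have Om: "left_module \<Lambda> \<Omega>" unfolding \<Omega>W by (rule P.left_module_restr[OF W])
  have ssW: "simples_sum \<Lambda> P W"
    using simples_sum_syzygy[OF D(1) W] semisimple_simples_sum[OF ss] by (simp add: \<Omega>W)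
  obtain \<psi> where \<psi>: "\<psi> \<in> lmod_hom \<Lambda> Q P" "bij_betw \<psi> (carrier Q) (carrier P)"
    using QP unfolding lmod_iso_def by blast
  note \<psi>' = hom_inv_into[OF \<psi>(1) E(1) \<psi>(2)]
  note p\<psi> = hom_comp[OF \<psi>(1) D(5)]
  have kills: "p (\<psi> x) = \<zero>\<^bsub>S\<^esub>" if "x \<in> carrier Q" "q x = \<zero>\<^bsub>N\<^esub>" for x
    by (rule projective_cover_kills_kernel[OF Q S p\<psi> that])
  obtain s where s: "s \<in> lmod_hom \<Lambda> N S" "\<And>x. x \<in> carrier Q \<Longrightarrow> s (q x) = p (\<psi> x)"
    using hom_factor[OF E(5) p\<psi> E(1,2) D(2) E(6) kills] by blast
  have s_surj: "s ` carrier N = carrier S"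
  proof -
    have "s ` carrier N = (\<lambda>x. s (q x)) ` carrier Q" unfolding E(6)[symmetric] by (simp only: image_image)
    also have "\<dots> = (\<lambda>x. p (\<psi> x)) ` carrier Q" by (rule image_cong) (use s(2) in auto)
    also have "\<dots> = p ` \<psi> ` carrier Q" by (simp only: image_image)
    also have "\<dots> = carrier S" using \<psi>(2) D(6) by (simp add: bij_betw_def)
    finally show ?thesis .
  qed
  have "a_kernel Q N q \<subseteq> inv_into (carrier Q) \<psi> ` W"
  proof
    fix x assume "x \<in> a_kernel Q N q"
    then have x: "x \<in> carrier Q" "q x = \<zero>\<^bsub>N\<^esub>" by (auto simp: a_kernel_eq)
    then have "\<psi> x \<in> W" using kills hom_closed[OF \<psi>(1)] by (simp add: W_def a_kernel_eq)
    moreover have "x = inv_into (carrier Q) \<psi> (\<psi> x)" using x(1) \<psi>(2) by (simp add: bij_betw_def)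
    ultimately show "x \<in> inv_into (carrier Q) \<psi> ` W" by blast
  qed
  then have ssK: "simples_sum \<Lambda> Q (a_kernel Q N q)"
    by (rule simples_sum_subset[OF simples_sum_image[OF \<psi>'(1) D(1) E(1) ssW] E(1) submodule_kernel[OF E(5,1,2)]])
  obtain \<eta> where \<eta>: "\<eta> \<in> lmod_hom R (restrict_scalars \<phi> S) J" and "\<exists>x\<in>carrier S. \<eta> x \<noteq> \<zero>\<^bsub>J\<^esub>"
    using dualizing_functional[OF AA DJ S] .
  then obtain s\<^sub>0 where s0: "s\<^sub>0 \<in> carrier S" "\<eta> s\<^sub>0 \<noteq> \<zero>\<^bsub>J\<^esub>" by blast
  obtain \<theta> where \<theta>: "\<theta> \<in> lmod_hom \<Lambda> \<Omega> (mod_power S n)"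
    "bij_betw \<theta> (carrier \<Omega>) (carrier (mod_power S n))" using iso unfolding lmod_iso_def by blast
  note Sn = mod_power_left_module[OF D(2), of n]
  show ?thesis
  proof (rule not_tau_rigidI[OF AA J E(2) _ S s(1) \<eta>])
    show "\<exists>(P1 :: ('a, 'a univ) module) d (P0 :: ('a, 'a univ) module) e. minimal_presentation \<Lambda> P1 d P0 e N"
      by (rule minimal_presentation_exists[OF artin_algebra_artinian[OF AA] Q ssK])
    fix P1 P0 :: "('a, 'a univ) module" and d e
    assume mp: "minimal_presentation \<Lambda> P1 d P0 e N"
    note mpD = minimal_presentationD[OF mp]
    note D1 = projective_coverD[OF mpD(2)] and D0 = projective_coverD[OF mpD(1)]
    interpret P0: left_module \<Lambda> P0 by (rule D0)
    let ?K = "a_kernel P0 N e"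
    note K = submodule_kernel[OF D0(5,1,2)]
    obtain \<alpha> where \<alpha>: "\<alpha> \<in> lmod_hom \<Lambda> P0 Q" "bij_betw \<alpha> (carrier P0) (carrier Q)"
      "\<And>x. x \<in> carrier P0 \<Longrightarrow> q (\<alpha> x) = e x"
      using projective_cover_unique[OF Q mpD(1)] by blast
    have "\<exists>z\<in>?K. z \<noteq> \<zero>\<^bsub>P0\<^esub>"
    proof (rule ccontr)
      assume "\<not> (\<exists>z\<in>?K. z \<noteq> \<zero>\<^bsub>P0\<^esub>)"
      then have "inj_on e (carrier P0)" unfolding hom_inj_iff[OF D0(5,1,2)] by (auto simp: a_kernel_eq)
      then have "bij_betw e (carrier P0) (carrier N)" using D0(6) by (simp add: bij_betw_def)
      from projective_iso[OF D0(4) D0(2) D0(5) this] np show False by blast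
    qed
    then obtain z where z: "z \<in> ?K" "z \<noteq> \<zero>\<^bsub>P0\<^esub>" by blast
    have zP: "z \<in> carrier P0" by (rule submod_mem[OF K z(1)])
    let ?f = "\<lambda>w. \<psi> (\<alpha> w)"
    have f: "?f \<in> lmod_hom \<Lambda> P0 P" by (rule hom_comp[OF \<alpha>(1) \<psi>(1)])
    have fK: "?f w \<in> W" if "w \<in> ?K" for w
    proof -
      have w: "w \<in> carrier P0" "e w = \<zero>\<^bsub>N\<^esub>" using that by (auto simp: a_kernel_eq)
      then have "p (?f w) = \<zero>\<^bsub>S\<^esub>" using kills[OF hom_closed[OF \<alpha>(1) w(1)]] \<alpha>(3)[OF w(1)] by simp
      then show ?thesis using hom_closed[OF f w(1)] by (simp add: W_def a_kernel_eq)
    qed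
    have f\<Omega>: "?f \<in> lmod_hom \<Lambda> (restr P0 ?K) \<Omega>"
      unfolding \<Omega>W
      by (rule hom_to_restr[OF hom_from_restr[OF f submod_subset[OF K]]]) (use fK in simp)
    have "inj_on ?f (carrier P0)"
      using comp_inj_on[of \<alpha> "carrier P0" \<psi>] \<alpha>(2) \<psi>(2) by (simp add: bij_betw_def comp_def)
    then have "?f z \<noteq> \<zero>\<^bsub>P\<^esub>" using hom_inj_iff[OF f D0(1) D(1)] zP z(2) by blast
    moreover have "inj_on \<theta> (carrier \<Omega>)" using \<theta>(2) by (simp add: bij_betw_def)
    ultimately have nz: "\<theta> (?f z) \<noteq> \<zero>\<^bsub>mod_power S n\<^esub>"
      using hom_inj_iff[OF \<theta>(1) Om Sn] fK[OF z(1)] by (auto simp: \<Omega>W)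
    have "\<theta> (?f z) \<in> carrier (mod_power S n)" using hom_closed[OF \<theta>(1)] fK[OF z(1)] by (simp add: \<Omega>W)
    then obtain i where i: "i < n" "\<theta> (?f z) i \<noteq> \<zero>\<^bsub>S\<^esub>"
      using nz by (auto simp: mod_power_simps PiE_iff extensional_def fun_eq_iff split: if_splits)
    let ?g = "\<lambda>x. \<theta> (?f (d x)) i"
    have g: "?g \<in> lmod_hom \<Lambda> P1 S"
      by (rule hom_comp[OF hom_comp[OF hom_comp[OF D1(5) f\<Omega>] \<theta>(1)] mod_power_proj_hom[OF i(1)]])
    have "z \<in> d ` carrier P1" using D1(6) z(1) by simp
    then obtain x1 where x1: "x1 \<in> carrier P1" "z = d x1" by blast
    have "?g ` carrier P1 = carrier S"
      by (rule simple_hom_surj[OF S D1(1) g x1(1)]) (use i(2) x1(2) in simp)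
    then have "s\<^sub>0 \<in> ?g ` carrier P1" using s0 by simp
    then obtain x where x: "x \<in> carrier P1" "?g x = s\<^sub>0" by blast
    obtain h where h: "h \<in> lmod_hom \<Lambda> P1 N" "\<And>x. x \<in> carrier P1 \<Longrightarrow> s (h x) = ?g x"
      using projective_lift[OF D1(3,4) E(2) D(2) s(1) s_surj g] by blast
    show "\<exists>h\<in>lmod_hom \<Lambda> P1 N. \<exists>x\<in>carrier P1. \<eta> (s (h x)) \<noteq> \<zero>\<^bsub>J\<^esub>"
      using h x s0(2) by (intro bexI[of _ h] bexI[of _ x]) auto
  qed
qed

lemma lmod_iso_sym:
  assumes "lmod_iso \<Lambda> M N" "left_module \<Lambda> M" shows "lmod_iso \<Lambda> N M"
  using assms hom_inv_into unfolding lmod_iso_def by blast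

theorem theorem4p1:
  fixes R :: "'r ring" and \<phi> :: "'r \<Rightarrow> 'a" and \<Lambda> :: "'a ring" and J :: "('r, 'j) module"
    and S :: "('a, 's) module" and P :: "('a, 'p) module" and p :: "'p \<Rightarrow> 's"
    and \<Omega> :: "('a, 'p) module"
  assumes "artin_algebra R \<phi> \<Lambda>" and "basic_algebra \<Lambda>" and "connected_algebra \<Lambda>"
    and "\<not> semisimple_module \<Lambda> (regular \<Lambda>)"
    and "dualizing_module R J"
    and "simple_module \<Lambda> S"
    and "projective_cover \<Lambda> P p S"
    and "\<Omega> = syzygy P p S"
    and "carrier \<Omega> \<noteq> {\<zero>\<^bsub>\<Omega>\<^esub>}" and "semisimple_module \<Lambda> \<Omega>"
  shows
    "(\<not> direct_summand \<Lambda> S \<Omega> \<longrightarrow>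
       (\<forall>S1 m X Y. submodule S1 \<Lambda> \<Omega> \<and> simple_module \<Lambda> (restr \<Omega> S1) \<and>
          max_power_summand \<Lambda> (restr \<Omega> S1) \<Omega> m \<and>
          complementary \<Lambda> \<Omega> X Y \<and> lmod_iso \<Lambda> (mod_power (restr \<Omega> S1) m) (restr \<Omega> X) \<longrightarrow>
          (\<exists>(M :: ('a, 'p set) module) \<iota> \<pi>. fg_left_module \<Lambda> M \<and>
             short_exact \<Lambda> (quot_mod \<Omega> X) \<iota> P \<pi> M \<and>
             indecomposable \<Lambda> M \<and> tau_rigid R \<phi> \<Lambda> J M)))
   \<and> (direct_summand \<Lambda> S \<Omega> \<longrightarrow>
       (\<forall>n. max_power_summand \<Lambda> S \<Omega> n \<longrightarrow>
          (lmod_iso \<Lambda> \<Omega> (mod_power S n) \<longrightarrow>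
             \<not> (\<exists>(N :: ('a, 'n) module) (Q :: ('a, 'q) module) q.
                   fg_left_module \<Lambda> N \<and> \<not> projective_module \<Lambda> N \<and> indecomposable \<Lambda> N \<and>
                   tau_rigid R \<phi> \<Lambda> J N \<and> projective_cover \<Lambda> Q q N \<and> lmod_iso \<Lambda> Q P)) \<and>
          (\<not> lmod_iso \<Lambda> \<Omega> (mod_power S n) \<longrightarrow>
             (\<forall>X Y. complementary \<Lambda> \<Omega> X Y \<and> lmod_iso \<Lambda> (mod_power S n) (restr \<Omega> X) \<longrightarrow>
                (\<exists>(N :: ('a, 'p set) module) \<iota> \<pi>. fg_left_module \<Lambda> N \<and>
                   short_exact \<Lambda> (quot_mod \<Omega> X) \<iota> P \<pi> N \<and>
                   indecomposable \<Lambda> N \<and> \<not> projective_module \<Lambda> N \<and> tau_rigid R \<phi> \<Lambda> J N)))))"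
proof -
  note AA = assms(1) and S = assms(6) and pc = assms(7) and \<Omega> = assms(8) and ss = assms(10)
  have J: "left_module R J" by (rule dualizing_left_module[OF assms(5)])
  note D = projective_coverD[OF pc]
  interpret P: left_module \<Lambda> P by (rule D)
  define W where "W = a_kernel P S p"
  have \<Omega>W: "\<Omega> = restr P W" by (simp add: \<Omega> syzygy_def W_def)
  have W: "submodule W \<Lambda> P" unfolding W_def by (rule submodule_kernel[OF D(5,1,2)])
  have Om: "left_module \<Lambda> \<Omega>" unfolding \<Omega>W by (rule P.left_module_restr[OF W])
  note ss\<Omega> = semisimple_simples_sum[OF ss]
  have quotient: "fg_left_module \<Lambda> (quot_mod P Y)" "indecomposable \<Lambda> (quot_mod P Y)"
    "\<exists>\<iota> \<pi>. short_exact \<Lambda> (quot_mod \<Omega> X) \<iota> P \<pi> (quot_mod P Y)"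
    "submodule Y \<Lambda> P" "Y \<subseteq> a_kernel P S p"
    if XY: "complementary \<Lambda> \<Omega> X Y" for X Y
  proof -
    show Y: "submodule Y \<Lambda> P" "Y \<subseteq> a_kernel P S p"
      using XY P.submodule_restr_iff[OF W] by (auto simp: complementary_def \<Omega>W W_def)
    show "fg_left_module \<Lambda> (quot_mod P Y)" "indecomposable \<Lambda> (quot_mod P Y)"
      by (rule local_quotient_indecomposable[OF pc S Y])+
    show "\<exists>\<iota> \<pi>. short_exact \<Lambda> (quot_mod \<Omega> X) \<iota> P \<pi> (quot_mod P Y)"
      using complement_short_exact[OF D(1) W] XY by (simp add: \<Omega>W)
  qed
  have not_Suc: "\<not> direct_summand \<Lambda> (mod_power T (Suc m)) \<Omega>"
    if "max_power_summand \<Lambda> T \<Omega> m" for T :: "('a, 't) module" and m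
    using that by (auto simp: max_power_summand_def)
  show ?thesis
  proof (intro conjI impI allI)
    fix S1 m X Y
    assume noS: "\<not> direct_summand \<Lambda> S \<Omega>"
      and *: "submodule S1 \<Lambda> \<Omega> \<and> simple_module \<Lambda> (restr \<Omega> S1) \<and>
        max_power_summand \<Lambda> (restr \<Omega> S1) \<Omega> m \<and>
        complementary \<Lambda> \<Omega> X Y \<and> lmod_iso \<Lambda> (mod_power (restr \<Omega> S1) m) (restr \<Omega> X)"
    then have T: "simple_module \<Lambda> (restr \<Omega> S1)" and mx: "max_power_summand \<Lambda> (restr \<Omega> S1) \<Omega> m"
      and XY: "complementary \<Lambda> \<Omega> X Y" and iso: "lmod_iso \<Lambda> (mod_power (restr \<Omega> S1) m) (restr \<Omega> X)" by auto
    have "tau_rigid R \<phi> \<Lambda> J (quot_mod P Y)"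
      by (rule isotypic_quotient_tau_rigid[OF AA J S pc \<Omega> ss XY T iso not_Suc[OF mx]])
        (use direct_summand_simple_quotient[OF Om ss\<Omega> S] noS in blast)
    then show "\<exists>(M :: ('a, 'p set) module) \<iota> \<pi>. fg_left_module \<Lambda> M \<and>
        short_exact \<Lambda> (quot_mod \<Omega> X) \<iota> P \<pi> M \<and> indecomposable \<Lambda> M \<and> tau_rigid R \<phi> \<Lambda> J M"
      using quotient[OF XY] by blast
  next
    fix n
    assume "lmod_iso \<Lambda> \<Omega> (mod_power S n)"
    then show "\<not> (\<exists>(N :: ('a, 'n) module) (Q :: ('a, 'q) module) q.
        fg_left_module \<Lambda> N \<and> \<not> projective_module \<Lambda> N \<and> indecomposable \<Lambda> N \<and>
        tau_rigid R \<phi> \<Lambda> J N \<and> projective_cover \<Lambda> Q q N \<and> lmod_iso \<Lambda> Q P)"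
      using isotypic_syzygy_not_tau_rigid[OF AA assms(5) S pc \<Omega> ss] by blast
  next
    fix n X Y
    assume mx: "max_power_summand \<Lambda> S \<Omega> n" and ni: "\<not> lmod_iso \<Lambda> \<Omega> (mod_power S n)"
      and *: "complementary \<Lambda> \<Omega> X Y \<and> lmod_iso \<Lambda> (mod_power S n) (restr \<Omega> X)"
    then have XY: "complementary \<Lambda> \<Omega> X Y" and iso: "lmod_iso \<Lambda> (mod_power S n) (restr \<Omega> X)" by auto
    note Q = quotient[OF XY]
    have noS: "\<forall>x\<in>carrier \<Omega>. q x = \<zero>\<^bsub>S\<^esub>" if q: "q \<in> lmod_hom \<Lambda> \<Omega> S" "\<forall>x\<in>X. q x = \<zero>\<^bsub>S\<^esub>" for q
      using direct_summand_power_Suc[OF Om ss\<Omega> S q(1) _ XY q(2) iso] not_Suc[OF mx] by blast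
    have rigid: "tau_rigid R \<phi> \<Lambda> J (quot_mod P Y)"
      by (rule isotypic_quotient_tau_rigid[OF AA J S pc \<Omega> ss XY S iso not_Suc[OF mx] noS])
    have "Y \<noteq> {\<zero>\<^bsub>P\<^esub>}"
    proof
      interpret O: left_module \<Lambda> \<Omega> by (rule Om)
      assume "Y = {\<zero>\<^bsub>P\<^esub>}"
      then have "Y = {\<zero>\<^bsub>\<Omega>\<^esub>}" by (simp add: \<Omega>W)
      moreover have X: "submodule X \<Lambda> \<Omega>" and "X <+>\<^bsub>\<Omega>\<^esub> Y = carrier \<Omega>" using XY by (auto simp: complementary_def)
      ultimately have "carrier \<Omega> \<subseteq> X"
        using set_add_least[OF X, of X Y] submod_zero[OF X] by auto
      then have "X = carrier \<Omega>" using submod_subset[OF X] by blast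
      then have "lmod_iso \<Lambda> (mod_power S n) \<Omega>" using iso by simp
      then show False using lmod_iso_sym mod_power_left_module[OF D(2)] ni by blast
    qed
    then have "\<not> projective_module \<Lambda> (quot_mod P Y)"
      by (rule local_quotient_not_projective[OF pc Q(4,5,1)])
    then show "\<exists>(N :: ('a, 'p set) module) \<iota> \<pi>. fg_left_module \<Lambda> N \<and>
        short_exact \<Lambda> (quot_mod \<Omega> X) \<iota> P \<pi> N \<and>
        indecomposable \<Lambda> N \<and> \<not> projective_module \<Lambda> N \<and> tau_rigid R \<phi> \<Lambda> J N"
      using Q rigid by blast
  qed
qed

end
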